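(* Let $(M^4,g)$ be a Riemannian $4$-manifold, let $(N^2,h)$ be a Riemannian $2$-surface and let $F:M^4\to N^2$ be a harmonic morphism. Let $j$ be the complex structure on $N^2$ compatible with the metric and orientation. For a regular point $m$ of $F$, let $J_+$ (resp. $J_-$) be the almost complex structure on $T_mM^4$ such that i) $J_+$ and $J_-$ preserve the metric $g$; ii) $J_+$ (resp. $J_-$) preserves (resp. reverses) the orientation on $T_mM^4$; iii) the map $dF:(T_mM^4,J_{\pm})\to (T_{F(m)}N^2,j)$ is complex-linear. Let $K$ be a compact subset of $M^4$. Then there exists a constant $A$ such that, for every regular point $m$ of $F$ in $K$ and every unit vertical tangent vector $T$ at $m$, $$\|\nabla_T J_+\|\,\|\nabla_T J_-\|\le A,$$ where $\nabla$ denotes the connection induced by the Levi-Civita connection on $M^4$.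
   Context: A harmonic morphism is a smooth map between Riemannian manifolds which pulls back local harmonic functions on the target to local harmonic functions on the source; equivalently, it is harmonic and horizontally weakly conformal (at each $x$, either $dF_x=0$ or $dF_x$ maps $\mathrm{Ker}(dF_x)^\perp$ conformally onto $T_{F(x)}N$). A regular point is a point where $dF\ne0$. The vertical space at a regular point $m$ is $V_m=\mathrm{Ker}(dF_m)$, the horizontal space is $H_m=V_m^\perp$. Near a regular point $J_\pm$ are smooth local sections of $\mathrm{End}(TM^4)$, and $\nabla_TJ_\pm$ is their covariant derivative; its norm is the Euclidean norm $\|\nabla_TJ\|^2=\sum_{i,j=1}^4\langle(\nabla_TJ)e_i,e_j\rangle^2$ for an orthonormal basis $(e_i)$ of $T_mM^4$. *)

theory Defs
  imports "HOL-Analysis.Analysis"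
begin

text \<open>The sets \<open>S\<close> are always open below;
  for open \<open>S\<close>, \<open>Ck_on k f S\<close> says that all iterated directional derivatives of
  order at most \<open>k\<close> exist (those of order below \<open>k\<close> being again differentiable)
  and are continuous.\<close>

fun Ck_on :: "nat \<Rightarrow> ('a::euclidean_space \<Rightarrow> 'b::euclidean_space) \<Rightarrow> 'a set \<Rightarrow> bool" where
  "Ck_on 0 f S \<longleftrightarrow> continuous_on S f"
| "Ck_on (Suc k) f S \<longleftrightarrow>
     (\<forall>x\<in>S. f differentiable (at x)) \<and> (\<forall>v. Ck_on k (\<lambda>x. frechet_derivative f (at x) v) S)"

definition smooth_on :: "('a::euclidean_space \<Rightarrow> 'b::euclidean_space) \<Rightarrow> 'a set \<Rightarrow> bool" where
  "smooth_on f S \<longleftrightarrow> (\<forall>k. Ck_on k f S)"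

text \<open>A manifold is given by an atlas on an open subset of a topological space; its underlying
  set is the union of the chart domains. A chart is a pair of a domain and a coordinate map.\<close>

type_synonym ('m, 'n) chart = "'m set \<times> ('m \<Rightarrow> real ^ 'n)"

definition chart_image :: "('m, 'n::finite) chart \<Rightarrow> (real ^ 'n) set" where
  "chart_image c = snd c ` fst c"

definition chart_inv :: "('m, 'n::finite) chart \<Rightarrow> real ^ 'n \<Rightarrow> 'm" where
  "chart_inv c = inv_into (fst c) (snd c)"

definition is_chart :: "('m::topological_space, 'n::finite) chart \<Rightarrow> bool" where
  "is_chart c \<longleftrightarrow> open (fst c) \<and> open (chart_image c) \<and>
     homeomorphism (fst c) (chart_image c) (snd c) (chart_inv c)"

definition transition :: "('m, 'n::finite) chart \<Rightarrow> ('m, 'n) chart \<Rightarrow> real ^ 'n \<Rightarrow> real ^ 'n" where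
  "transition c d = snd d \<circ> chart_inv c"

definition smooth_atlas :: "('m::topological_space, 'n::finite) chart set \<Rightarrow> bool" where
  "smooth_atlas A \<longleftrightarrow> (\<forall>c\<in>A. is_chart c) \<and>
     (\<forall>c\<in>A. \<forall>d\<in>A. smooth_on (transition c d) (snd c ` (fst c \<inter> fst d)))"

definition oriented_atlas :: "('m, 'n::finite) chart set \<Rightarrow> bool" where
  "oriented_atlas A \<longleftrightarrow> (\<forall>c\<in>A. \<forall>d\<in>A. \<forall>x\<in>snd c ` (fst c \<inter> fst d).
     0 < det (jacobian (transition c d) (at x)))"

definition carrier :: "('m, 'n::finite) chart set \<Rightarrow> 'm set" where
  "carrier A = (\<Union>c\<in>A. fst c)"

text \<open>Tensor fields are given by their components in every chart: \<open>g c x\<close> is the matrix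
  \<open>(g_ij)\<close> of the metric in the chart \<open>c\<close>, at the point with coordinates \<open>x\<close>. Likewise a
  tangent vector at a point of the domain of \<open>c\<close> is given by its component vector in \<open>c\<close>.\<close>

type_synonym ('m, 'n) matrix_field = "('m, 'n) chart \<Rightarrow> real ^ 'n \<Rightarrow> real ^ 'n ^ 'n"

definition ip :: "real ^ 'n ^ 'n \<Rightarrow> real ^ 'n \<Rightarrow> real ^ 'n::finite \<Rightarrow> real" where
  "ip G u v = u \<bullet> (G *v v)"

definition riemannian_manifold ::
    "('m::topological_space, 'n::finite) chart set \<Rightarrow> ('m, 'n) matrix_field \<Rightarrow> bool" where
  "riemannian_manifold A g \<longleftrightarrow> smooth_atlas A \<and>
     (\<forall>c\<in>A. smooth_on (g c) (chart_image c)) \<and>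
     (\<forall>c\<in>A. \<forall>x\<in>chart_image c. transpose (g c x) = g c x \<and> (\<forall>v. v \<noteq> 0 \<longrightarrow> 0 < ip (g c x) v v)) \<and>
     (\<forall>c\<in>A. \<forall>d\<in>A. \<forall>x\<in>snd c ` (fst c \<inter> fst d).
        g c x = transpose (jacobian (transition c d) (at x)) ** g d (transition c d x)
                  ** jacobian (transition c d) (at x))"

definition pd :: "'n \<Rightarrow> (real ^ 'n \<Rightarrow> real) \<Rightarrow> real ^ 'n::finite \<Rightarrow> real" where
  "pd i f x = frechet_derivative f (at x) (axis i 1)"

text \<open>\<open>christoffel G k i j x\<close> is the symbol with upper index \<open>k\<close> and lower indices \<open>i\<close>, \<open>j\<close> of the
  Levi-Civita connection of the metric with components \<open>G\<close>.\<close>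

definition christoffel ::
    "(real ^ 'n \<Rightarrow> real ^ 'n ^ 'n) \<Rightarrow> 'n \<Rightarrow> 'n \<Rightarrow> 'n \<Rightarrow> real ^ 'n::finite \<Rightarrow> real" where
  "christoffel G k i j x = (1/2) * (\<Sum>l\<in>UNIV. matrix_inv (G x) $ k $ l *
     (pd i (\<lambda>y. G y $ j $ l) x + pd j (\<lambda>y. G y $ i $ l) x - pd l (\<lambda>y. G y $ i $ j) x))"

text \<open>The matrix of the endomorphism \<open>X \<mapsto> \<Gamma>(T, X)\<close>.\<close>

definition connection_matrix ::
    "(real ^ 'n \<Rightarrow> real ^ 'n ^ 'n) \<Rightarrow> real ^ 'n \<Rightarrow> real ^ 'n \<Rightarrow> real ^ 'n ^ 'n::finite" where
  "connection_matrix G x T = (\<chi> k j. \<Sum>i\<in>UNIV. T $ i * christoffel G k i j x)"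

text \<open>Covariant derivative at \<open>x\<close>, in the direction \<open>T\<close>, of a section \<open>J\<close> of the endomorphism bundle,
  for the connection induced by the Levi-Civita connection:
  \<open>(\<nabla>_T J) X = \<nabla>_T (J X) - J (\<nabla>_T X)\<close>.\<close>

definition cov_deriv_endo ::
    "(real ^ 'n \<Rightarrow> real ^ 'n ^ 'n) \<Rightarrow> (real ^ 'n \<Rightarrow> real ^ 'n ^ 'n) \<Rightarrow> real ^ 'n \<Rightarrow> real ^ 'n
      \<Rightarrow> real ^ 'n ^ 'n::finite" where
  "cov_deriv_endo G J x T = frechet_derivative J (at x) T
     + connection_matrix G x T ** J x - J x ** connection_matrix G x T"

definition orthonormal_frame :: "real ^ 'n ^ 'n \<Rightarrow> ('n \<Rightarrow> real ^ 'n::finite) \<Rightarrow> bool" where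
  "orthonormal_frame G e \<longleftrightarrow> (\<forall>i j. ip G (e i) (e j) = (if i = j then 1 else 0))"

text \<open>The Euclidean norm of an endomorphism does not depend on the choice of the frame.\<close>

definition endo_norm :: "real ^ 'n ^ 'n \<Rightarrow> real ^ 'n ^ 'n::finite \<Rightarrow> real" where
  "endo_norm G L = (let e = (SOME e. orthonormal_frame G e)
     in sqrt (\<Sum>i\<in>UNIV. \<Sum>j\<in>UNIV. (ip G (L *v e i) (e j))\<^sup>2))"

text \<open>Laplace-Beltrami operator: the trace of the Hessian with respect to the metric.\<close>

definition laplacian ::
    "(real ^ 'n \<Rightarrow> real ^ 'n ^ 'n) \<Rightarrow> (real ^ 'n \<Rightarrow> real) \<Rightarrow> real ^ 'n::finite \<Rightarrow> real" where
  "laplacian G f x = (\<Sum>i\<in>UNIV. \<Sum>j\<in>UNIV. matrix_inv (G x) $ i $ j *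
     (pd i (pd j f) x - (\<Sum>k\<in>UNIV. christoffel G k i j x * pd k f x)))"

definition harmonic_on ::
    "('m, 'n::finite) chart set \<Rightarrow> ('m, 'n) matrix_field \<Rightarrow> 'm set \<Rightarrow> ('m \<Rightarrow> real) \<Rightarrow> bool" where
  "harmonic_on A g V f \<longleftrightarrow> (\<forall>c\<in>A.
     Ck_on 2 (f \<circ> chart_inv c) (snd c ` (fst c \<inter> V)) \<and>
     (\<forall>x\<in>snd c ` (fst c \<inter> V). laplacian (g c) (f \<circ> chart_inv c) x = 0))"

text \<open>\<open>local_rep c F d\<close> is \<open>F\<close> read in the charts \<open>c\<close> of the source and \<open>d\<close> of the target; its
  Jacobian matrix at \<open>x\<close> represents the differential of \<open>F\<close>.\<close>

definition local_rep ::
    "('m, 'k::finite) chart \<Rightarrow> ('m \<Rightarrow> 'n) \<Rightarrow> ('n, 'l::finite) chart \<Rightarrow> real ^ 'k \<Rightarrow> real ^ 'l" where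
  "local_rep c F d = snd d \<circ> F \<circ> chart_inv c"

definition differential ::
    "('m, 'k::finite) chart \<Rightarrow> ('m \<Rightarrow> 'n) \<Rightarrow> ('n, 'l::finite) chart \<Rightarrow> real ^ 'k \<Rightarrow> real ^ 'k ^ 'l" where
  "differential c F d x = jacobian (local_rep c F d) (at x)"

definition smooth_map ::
    "('m::topological_space, 'k::finite) chart set \<Rightarrow> ('n::topological_space, 'l::finite) chart set
      \<Rightarrow> ('m \<Rightarrow> 'n) \<Rightarrow> bool" where
  "smooth_map A B F \<longleftrightarrow> F ` carrier A \<subseteq> carrier B \<and> continuous_on (carrier A) F \<and>
     (\<forall>c\<in>A. \<forall>d\<in>B. smooth_on (local_rep c F d) (snd c ` {p \<in> fst c. F p \<in> fst d}))"

definition harmonic_morphism ::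
    "('m::topological_space, 'k::finite) chart set \<Rightarrow> ('m, 'k) matrix_field
      \<Rightarrow> ('n::topological_space, 'l::finite) chart set \<Rightarrow> ('n, 'l) matrix_field
      \<Rightarrow> ('m \<Rightarrow> 'n) \<Rightarrow> bool" where
  "harmonic_morphism A g B h F \<longleftrightarrow> smooth_map A B F \<and>
     (\<forall>V f. open V \<longrightarrow> V \<subseteq> carrier B \<longrightarrow> harmonic_on B h V f \<longrightarrow>
        harmonic_on A g {p \<in> carrier A. F p \<in> V} (f \<circ> F))"

definition regular_point ::
    "('m, 'k::finite) chart set \<Rightarrow> ('n, 'l::finite) chart set \<Rightarrow> ('m \<Rightarrow> 'n) \<Rightarrow> 'm \<Rightarrow> bool" where
  "regular_point A B F m \<longleftrightarrow> (\<exists>c\<in>A. \<exists>d\<in>B. m \<in> fst c \<and> F m \<in> fst d \<and>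
     differential c F d (snd c m) \<noteq> 0)"

definition vertical ::
    "('n, 'l::finite) chart set \<Rightarrow> ('m \<Rightarrow> 'n) \<Rightarrow> ('m, 'k::finite) chart \<Rightarrow> 'm \<Rightarrow> real ^ 'k \<Rightarrow> bool" where
  "vertical B F c m T \<longleftrightarrow> (\<forall>d\<in>B. F m \<in> fst d \<longrightarrow> differential c F d (snd c m) *v T = 0)"

definition hermitian_structure :: "real ^ 'n ^ 'n \<Rightarrow> real ^ 'n ^ 'n::finite \<Rightarrow> bool" where
  "hermitian_structure G J \<longleftrightarrow> J ** J = - mat 1 \<and> (\<forall>u v. ip G (J *v u) (J *v v) = ip G u v)"

definition surface_complex_structure ::
    "('n, 2) chart set \<Rightarrow> ('n, 2) matrix_field \<Rightarrow> ('n, 2) matrix_field \<Rightarrow> bool" where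
  "surface_complex_structure B h j \<longleftrightarrow> (\<forall>d\<in>B. \<forall>y\<in>chart_image d.
     hermitian_structure (h d y) (j d y) \<and>
     (\<forall>u. u \<noteq> 0 \<longrightarrow> 0 < det (vector [u, j d y *v u] :: real ^ 2 ^ 2)))"

text \<open>Every complex structure on a real 4-dimensional space has determinant 1 as a linear map.
  That it preserves (\<open>s = 1\<close>) or reverses (\<open>s = -1\<close>) the orientation refers to the
  orientation it induces, i.e. that of the bases \<open>(u, J u, v, J v)\<close>. The rows of the matrix below
  are the vectors of such a basis.\<close>

definition induces_orientation :: "real \<Rightarrow> real ^ 4 ^ 4 \<Rightarrow> bool" where
  "induces_orientation s J \<longleftrightarrow> (\<forall>u v.
     let D = det (vector [u, J *v u, v, J *v v] :: real ^ 4 ^ 4) in D \<noteq> 0 \<longrightarrow> sgn D = s)"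

text \<open>\<open>J c x\<close> is the matrix, in the chart \<open>c\<close>, of the almost complex structure at the point with
  coordinates \<open>x\<close>. The sign \<open>s\<close> is relative to the orientation given by the coordinates of \<open>c\<close>,
  so that no global orientation of the 4-manifold is needed; for an oriented atlas this is
  the orientation of the manifold. Exchanging the orientation exchanges the structures
  with \<open>s = 1\<close> and \<open>s = -1\<close>.\<close>

definition adapted_almost_complex_structure ::
    "('m, 4) chart set \<Rightarrow> ('m, 4) matrix_field \<Rightarrow> ('n, 2) chart set \<Rightarrow> ('n, 2) matrix_field
      \<Rightarrow> ('m \<Rightarrow> 'n) \<Rightarrow> real \<Rightarrow> ('m, 4) matrix_field \<Rightarrow> bool" where
  "adapted_almost_complex_structure A g B j F s J \<longleftrightarrow>
     (\<forall>c\<in>A. \<forall>m\<in>fst c. regular_point A B F m \<longrightarrow>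
        hermitian_structure (g c (snd c m)) (J c (snd c m)) \<and>
        induces_orientation s (J c (snd c m)) \<and>
        (\<forall>d\<in>B. F m \<in> fst d \<longrightarrow>
           differential c F d (snd c m) ** J c (snd c m)
             = j d (snd d (F m)) ** differential c F d (snd c m)))"

end

theory Submission imports Defs begin

text \<open>
Let \<open>a\<close>, \<open>b\<close> be isothermal functions near \<open>F m\<close>: real functions on the surface with
\<open>da \<circ> j = - db\<close> and \<open>db \<circ> j = da\<close>. They are harmonic, so \<open>u = a \<circ> F\<close> and \<open>v = b \<circ> F\<close> are harmonic on
the 4-manifold, and \<open>du \<circ> J = - dv\<close>, \<open>dv \<circ> J = du\<close> for \<open>J = J\<^sub>+\<close> and for \<open>J = J\<^sub>-\<close>. In
particular the gradients of \<open>u\<close> and \<open>v\<close> are orthogonal and have the same length \<open>\<lambda>\<close>.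

The endomorphism \<open>D = \<nabla>\<^sub>T J\<close> is skew and anticommutes with \<open>J\<close>, so \<open>\<parallel>D\<parallel>\<close> is twice the length of
the horizontal part of \<open>D T\<close> when \<open>T\<close> is a unit vertical vector. Differentiating
\<open>du \<circ> J = - dv\<close> and \<open>dv \<circ> J = du\<close> expresses this part by the Hessians of \<open>u\<close> and \<open>v\<close>. On the vertical
plane \<open>J\<^sub>- = - J\<^sub>+\<close>. Writing \<open>p\<close>, \<open>q\<close> for the Hessians of \<open>u\<close>, \<open>v\<close> at \<open>(T, T)\<close> and \<open>r\<close>, \<open>w\<close> for those
at \<open>(T, J\<^sub>+ T)\<close>, this gives
\<open>\<parallel>\<nabla>\<^sub>T J\<^sub>+\<parallel>\<^sup>2 = 4 / \<lambda>\<^sup>2 * ((q + r)\<^sup>2 + (p - w)\<^sup>2)\<close> and \<open>\<parallel>\<nabla>\<^sub>T J\<^sub>-\<parallel>\<^sup>2 = 4 / \<lambda>\<^sup>2 * ((q - r)\<^sup>2 + (p + w)\<^sup>2)\<close>.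
Each factor may be unbounded near the critical points, where \<open>\<lambda>\<close> tends to \<open>0\<close>, but
\<open>((q + r)\<^sup>2 + (p - w)\<^sup>2) * ((q - r)\<^sup>2 + (p + w)\<^sup>2) = (p\<^sup>2 - q\<^sup>2 + r\<^sup>2 - w\<^sup>2)\<^sup>2 + (2 * (p * q + r * w))\<^sup>2\<close>,
and the two terms on the right are, up to constant factors, the squares of the real and imaginary parts
of the trace of the square of the Hessian of \<open>f = u + \<i> v\<close>. Since \<open>f\<close> is harmonic and the complex bilinear square of
\<open>\<nabla>f\<close> vanishes, the Bochner formula (lemmas \<open>bochner\<close>, \<open>null_pair_bochner\<close>) identifies this trace with \<open>- Ric(\<nabla>f, \<nabla>f)\<close>, which is at most a
local constant times \<open>\<lambda>\<^sup>2\<close>. So the factors \<open>\<lambda>\<close> cancel, the product is bounded near every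
point by a bound for the Ricci tensor, and a compact set is covered by finitely many such
neighbourhoods (lemmas \<open>product_le_Ricci\<close> and \<open>compact_locally_bounded\<close>).

The existence of \<open>a\<close> and \<open>b\<close> (lemma \<open>isothermal_pair\<close>) is the theorem on isothermal coordinates. With
\<open>\<zeta> = a + \<i> b\<close> it amounts to a Beltrami equation \<open>\<zeta>\<^sub>x = \<tau> \<zeta>\<^sub>y\<close> with smooth \<open>\<tau>\<close>, \<open>Im \<tau> \<noteq> 0\<close>. After rescaling
and cutting off, \<open>\<tau> - \<tau>(p)\<close> is small and is the sum of an absolutely convergent Fourier series; the
equation for \<open>\<zeta>\<^sub>y\<close> is then solved by a Neumann series (lemma \<open>beltrami_on_torus\<close>), which is written out as a trigonometric series
indexed by words in the frequencies. Regularity \<open>C\<^sup>3\<close> of \<open>\<zeta>\<close> suffices, because the Bochner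
formula uses three derivatives of \<open>u\<close> and \<open>v\<close>.
\<close>

section \<open>Calculus of functions of class \<open>C\<^sup>k\<close>\<close>

text \<open>On an open set the derivatives depend on the values inside the set only; outside, \<open>f\<close> and \<open>g\<close> may differ.\<close>

lemma Ck_on_cong:
  assumes "open S" "Ck_on k f S" "\<And>x. x \<in> S \<Longrightarrow> f x = g x"
  shows "Ck_on k g S"
  using assms(2,3)
proof (induction k arbitrary: f g)
  case 0
  then show ?case using continuous_on_eq by fastforce
next
  case (Suc k)
  have d: "(g has_derivative frechet_derivative f (at x)) (at x)" if "x \<in> S" for x
    using Suc.prems that assms(1) frechet_derivative_works[of f "at x"]
    by (auto intro: has_derivative_transform_within_open)
  then have e: "frechet_derivative f (at x) = frechet_derivative g (at x)" if "x \<in> S" for x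
    using frechet_derivative_at that by blast
  have "Ck_on k (\<lambda>x. frechet_derivative g (at x) v) S" for v
    by (rule Suc.IH[of "\<lambda>x. frechet_derivative f (at x) v"]) (use Suc.prems e in auto)
  then show ?case using d by (auto intro: differentiableI)
qed

text \<open>The class is defined through \<open>frechet_derivative\<close>; this introduction rule accepts any explicit formula for the derivative, and the closure properties below are inductions on \<open>k\<close> that use it.\<close>

lemma Ck_on_SucI:
  assumes "open S" "\<And>x. x \<in> S \<Longrightarrow> (f has_derivative f' x) (at x)" "\<And>v. Ck_on k (\<lambda>x. f' x v) S"
  shows "Ck_on (Suc k) f S"
proof -
  have "f' x = frechet_derivative f (at x)" if "x \<in> S" for x
    using assms(2) frechet_derivative_at that by blast
  then have "Ck_on k (\<lambda>x. frechet_derivative f (at x) v) S" for v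
    using Ck_on_cong[OF assms(1) assms(3)] by simp
  then show ?thesis using assms(2) by (auto intro: differentiableI)
qed

lemma Ck_on_SucD:
  assumes "Ck_on (Suc k) f S" "x \<in> S"
  shows "(f has_derivative frechet_derivative f (at x)) (at x)"
  using assms frechet_derivative_works by auto

lemma Ck_on_SucD2: "Ck_on (Suc k) f S \<Longrightarrow> Ck_on k (\<lambda>x. frechet_derivative f (at x) v) S"
  by simp

lemma Ck_on_Suc_imp: "Ck_on (Suc k) f S \<Longrightarrow> Ck_on k f S"
proof (induction k arbitrary: f)
  case 0
  then show ?case
    by (auto intro!: continuous_at_imp_continuous_on differentiable_imp_continuous_within)
qed auto

lemma Ck_on_le: "Ck_on l f S \<Longrightarrow> k \<le> l \<Longrightarrow> Ck_on k f S"
  by (induction l) (use Ck_on_Suc_imp le_Suc_eq in blast)+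

lemma Ck_on_subset: "Ck_on k f S \<Longrightarrow> T \<subseteq> S \<Longrightarrow> Ck_on k f T"
  by (induction k arbitrary: f) (auto intro: continuous_on_subset)

lemma Ck_on_Un: "open S \<Longrightarrow> open T \<Longrightarrow> Ck_on k f S \<Longrightarrow> Ck_on k f T \<Longrightarrow> Ck_on k f (S \<union> T)"
  by (induction k arbitrary: f) (auto intro: continuous_on_open_Un)

lemma Ck_on_continuous: "Ck_on k f S \<Longrightarrow> continuous_on S f"
  using Ck_on_le[of k f S 0] by simp

declare Ck_on.simps(2) [simp del]

lemma Ck_on_const: "open S \<Longrightarrow> Ck_on k (\<lambda>x. c) S"
  by (induction k arbitrary: c) (auto intro!: Ck_on_SucI has_derivative_const)

lemma Ck_on_bounded_linear:
  assumes "open S" "bounded_linear L" "Ck_on k f S"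
  shows "Ck_on k (\<lambda>x. L (f x)) S"
  using assms(3)
proof (induction k arbitrary: f)
  case 0
  then show ?case using assms(2) by (simp add: bounded_linear.continuous_on)
next
  case (Suc k)
  show ?case
    by (rule Ck_on_SucI[OF assms(1) bounded_linear.has_derivative[OF assms(2) Ck_on_SucD[OF Suc.prems]]])
       (assumption | intro Suc.IH Ck_on_SucD2 Suc.prems)+
qed

lemma Ck_on_ident: "open S \<Longrightarrow> Ck_on k (\<lambda>x. x) S"
  by (cases k) (auto intro!: Ck_on_SucI[where f'="\<lambda>x h. h"] has_derivative_ident Ck_on_const)

lemma Ck_on_linear: "open S \<Longrightarrow> bounded_linear L \<Longrightarrow> Ck_on k L S"
  using Ck_on_bounded_linear Ck_on_ident by blast

lemma Ck_on_add:
  assumes "open S" "Ck_on k f S" "Ck_on k g S"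
  shows "Ck_on k (\<lambda>x. f x + g x) S"
  using assms(2,3)
proof (induction k arbitrary: f g)
  case 0
  then show ?case by (simp add: continuous_on_add)
next
  case (Suc k)
  show ?case
    by (rule Ck_on_SucI[OF assms(1) has_derivative_add[OF Ck_on_SucD[OF Suc.prems(1)] Ck_on_SucD[OF Suc.prems(2)]]])
       (assumption | intro Suc.IH Ck_on_SucD2 Suc.prems)+
qed

text \<open>One product rule covers scalar multiplication, inner products and the products of real and of complex numbers. The induction needs both factors in one class lower as well.\<close>

lemma Ck_on_bilinear:
  assumes "open S" "bounded_bilinear B" "Ck_on k f S" "Ck_on k g S"
  shows "Ck_on k (\<lambda>x. B (f x) (g x)) S"
  using assms(3,4)
proof (induction k arbitrary: f g)
  case 0
  then show ?case using assms(2) by (simp add: bounded_bilinear.continuous_on)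
next
  case (Suc k)
  show ?case
    by (rule Ck_on_SucI[OF assms(1) bounded_bilinear.FDERIV[OF assms(2) Ck_on_SucD[OF Suc.prems(1)] Ck_on_SucD[OF Suc.prems(2)]]])
       (intro Ck_on_add[OF assms(1)] Suc.IH Ck_on_SucD2 Suc.prems Ck_on_Suc_imp[OF Suc.prems(1)] Ck_on_Suc_imp[OF Suc.prems(2)] | assumption)+
qed

lemmas Ck_on_scaleR = Ck_on_bilinear[OF _ bounded_bilinear_scaleR]
lemmas Ck_on_inner = Ck_on_bilinear[OF _ bounded_bilinear_inner]
lemmas Ck_on_mult_real = Ck_on_bilinear[OF _ bounded_bilinear_mult[where 'a=real]]
lemmas Ck_on_mult_complex = Ck_on_bilinear[OF _ bounded_bilinear_mult[where 'a=complex]]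

lemma Ck_on_uminus: "open S \<Longrightarrow> Ck_on k f S \<Longrightarrow> Ck_on k (\<lambda>x. - f x) S"
  using Ck_on_bounded_linear[of S uminus] bounded_linear_minus bounded_linear_ident by blast

lemma Ck_on_diff: "open S \<Longrightarrow> Ck_on k f S \<Longrightarrow> Ck_on k g S \<Longrightarrow> Ck_on k (\<lambda>x. f x - g x) S"
  using Ck_on_add[of S k f "\<lambda>x. - g x"] Ck_on_uminus[of S k g] by simp

lemma Ck_on_sum:
  assumes "open S" "\<And>i. i \<in> I \<Longrightarrow> Ck_on k (f i) S"
  shows "Ck_on k (\<lambda>x. \<Sum>i\<in>I. f i x) S"
  using assms(2)
  by (induction I rule: infinite_finite_induct) (auto intro: Ck_on_const Ck_on_add assms(1))

lemma Ck_on_prod: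
  fixes f :: "'i \<Rightarrow> 'a::euclidean_space \<Rightarrow> real"
  assumes "open S" "\<And>i. i \<in> I \<Longrightarrow> Ck_on k (f i) S"
  shows "Ck_on k (\<lambda>x. \<Prod>i\<in>I. f i x) S"
  using assms(2)
  by (induction I rule: infinite_finite_induct) (auto intro: Ck_on_const Ck_on_mult_real assms(1))

lemma Ck_on_componentwise:
  assumes "open S" "\<And>b. b \<in> Basis \<Longrightarrow> Ck_on k (\<lambda>x. f x \<bullet> b) S"
  shows "Ck_on k f S"
proof -
  have "Ck_on k (\<lambda>x. \<Sum>b\<in>Basis. (f x \<bullet> b) *\<^sub>R b) S"
    by (intro Ck_on_sum Ck_on_scaleR Ck_on_const assms)
  then show ?thesis by (simp add: euclidean_representation)
qed

lemma Ck_on_nth: "open S \<Longrightarrow> Ck_on k f S \<Longrightarrow> Ck_on k (\<lambda>x. f x $ i) S"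
  using Ck_on_bounded_linear[OF _ bounded_linear_vec_nth] by blast

lemma Ck_on_vec:
  fixes f :: "'a::euclidean_space \<Rightarrow> 'b::euclidean_space ^ 'n::finite"
  assumes "open S" "\<And>i. Ck_on k (\<lambda>x. f x $ i) S"
  shows "Ck_on k f S"
proof (rule Ck_on_componentwise[OF assms(1)])
  fix b :: "'b^'n" assume "b \<in> Basis"
  then obtain i u where "b = axis i u" unfolding Basis_vec_def by blast
  then have "(\<lambda>x. f x \<bullet> b) = (\<lambda>x. (f x $ i) \<bullet> u)" by (simp add: inner_axis fun_eq_iff)
  then show "Ck_on k (\<lambda>x. f x \<bullet> b) S"
    using Ck_on_inner[OF assms(1) assms(2) Ck_on_const[OF assms(1)]] by auto
qed

lemma bounded_linear_Basis_expansion: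
  assumes "bounded_linear L"
  shows "L v = (\<Sum>b\<in>Basis. (v \<bullet> b) *\<^sub>R L b)"
  using linear_sum[of L "\<lambda>b. (v \<bullet> b) *\<^sub>R b" Basis] assms
  by (simp add: euclidean_representation bounded_linear.linear linear_cmul)

text \<open>The derivative of the composition is expanded in the finite basis, so that the induction hypothesis applies to each coefficient separately.\<close>

lemma Ck_on_compose:
  assumes "open S" "open T" "g ` S \<subseteq> T" "Ck_on k f T" "Ck_on k g S"
  shows "Ck_on k (\<lambda>x. f (g x)) S"
  using assms(4,5)
proof (induction k arbitrary: f)
  case 0
  then show ?case using assms(3) continuous_on_compose2 by auto
next
  case (Suc k)
  let ?f = "\<lambda>y. frechet_derivative f (at y)" and ?g = "\<lambda>x. frechet_derivative g (at x)"
  have D: "((\<lambda>x. f (g x)) has_derivative (\<lambda>v. ?f (g x) (?g x v))) (at x)" if "x \<in> S" for x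
    using diff_chain_at[OF Ck_on_SucD[OF Suc.prems(2) that] Ck_on_SucD[OF Suc.prems(1), of "g x"]]
      that assms(3) by (auto simp: o_def)
  have "?f (g x) (?g x v) = (\<Sum>b\<in>Basis. (?g x v \<bullet> b) *\<^sub>R ?f (g x) b)" if "x \<in> S" for x v
    by (rule bounded_linear_Basis_expansion)
       (use Ck_on_SucD[OF Suc.prems(1), of "g x"] has_derivative_bounded_linear that assms(3) in blast)
  moreover have "Ck_on k (\<lambda>x. \<Sum>b\<in>Basis. (?g x v \<bullet> b) *\<^sub>R ?f (g x) b) S" for v
    by (intro Ck_on_sum Ck_on_scaleR Ck_on_inner Ck_on_const assms(1) Suc.IH Ck_on_SucD2 Suc.prems
        Ck_on_Suc_imp[OF Suc.prems(2)])
  ultimately have "Ck_on k (\<lambda>x. ?f (g x) (?g x v)) S" for v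
    by (rule Ck_on_cong[OF assms(1) _ sym, rotated])
  then show ?case
    by (intro Ck_on_SucI[OF assms(1), where f'="\<lambda>x v. ?f (g x) (?g x v)"] D) auto
qed

lemma Ck_on_inverse:
  fixes f :: "'a::euclidean_space \<Rightarrow> real"
  assumes "open S" "Ck_on k f S" "\<And>x. x \<in> S \<Longrightarrow> f x \<noteq> 0"
  shows "Ck_on k (\<lambda>x. inverse (f x)) S"
  using assms(2)
proof (induction k)
  case 0
  then show ?case using assms(3) by (simp add: continuous_on_inverse)
next
  case (Suc k)
  show ?case
    by (rule Ck_on_SucI[OF assms(1) Deriv.has_derivative_inverse[OF assms(3) Ck_on_SucD[OF Suc.prems]]])
       (intro Ck_on_uminus Ck_on_mult_real assms(1) Suc.IH Ck_on_SucD2 Suc.prems Ck_on_Suc_imp[OF Suc.prems] | assumption)+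
qed

lemma Ck_on_divide:
  fixes f :: "'a::euclidean_space \<Rightarrow> real"
  assumes "open S" "Ck_on k f S" "Ck_on k g S" "\<And>x. x \<in> S \<Longrightarrow> g x \<noteq> 0"
  shows "Ck_on k (\<lambda>x. f x / g x) S"
  unfolding divide_inverse by (intro Ck_on_mult_real Ck_on_inverse assms)

lemma Ck_on_sqrt:
  fixes f :: "'a::euclidean_space \<Rightarrow> real"
  assumes "open S" "Ck_on k f S" "\<And>x. x \<in> S \<Longrightarrow> 0 < f x"
  shows "Ck_on k (\<lambda>x. sqrt (f x)) S"
  using assms(2)
proof (induction k)
  case 0
  then show ?case by (simp add: continuous_on_real_sqrt)
next
  case (Suc k)
  have S: "(sqrt has_derivative (\<lambda>h. h * (inverse (sqrt y) / 2))) (at y)" if "y > 0" for y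
    using DERIV_real_sqrt[OF that] unfolding has_field_derivative_def
    by (rule has_derivative_eq_rhs) (simp add: fun_eq_iff)
  have "((\<lambda>x. sqrt (f x)) has_derivative (\<lambda>v. frechet_derivative f (at x) v * (inverse (sqrt (f x)) / 2))) (at x)"
    if "x \<in> S" for x
    using diff_chain_at[OF Ck_on_SucD[OF Suc.prems that] S[OF assms(3)[OF that]]] by (simp add: o_def)
  moreover have "Ck_on k (\<lambda>x. frechet_derivative f (at x) v * (inverse (sqrt (f x)) / 2)) S" for v
    unfolding divide_inverse using assms(3)
    by (intro Ck_on_mult_real Ck_on_inverse Ck_on_const assms(1) Suc.IH Ck_on_SucD2 Suc.prems Ck_on_Suc_imp[OF Suc.prems])
       (auto simp: less_imp_neq[symmetric])
  ultimately show ?case by (rule Ck_on_SucI[OF assms(1)])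
qed

lemma Ck_on_det:
  fixes M :: "'a::euclidean_space \<Rightarrow> real^'n^'n"
  assumes "open S" "\<And>i j. Ck_on k (\<lambda>x. M x $ i $ j) S"
  shows "Ck_on k (\<lambda>x. det (M x)) S"
proof -
  have "Ck_on k (\<lambda>x. \<Prod>i\<in>UNIV. M x $ i $ p i) S" for p :: "'n \<Rightarrow> 'n"
    by (rule Ck_on_prod[OF assms(1)]) (rule assms(2))
  then show ?thesis
    unfolding det_def by (auto intro!: Ck_on_sum[OF assms(1)] Ck_on_mult_real[OF assms(1) Ck_on_const[OF assms(1)]])
qed

lemma matrix_inv_works:
  fixes A :: "real^'n^'n"
  assumes "det A \<noteq> 0"
  shows "A ** matrix_inv A = mat 1" "matrix_inv A ** A = mat 1"
proof -
  have "\<exists>B. A ** B = mat 1 \<and> B ** A = mat 1"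
    using assms invertible_det_nz invertible_def by blast
  then have "A ** matrix_inv A = mat 1 \<and> matrix_inv A ** A = mat 1"
    unfolding matrix_inv_def by (rule someI_ex)
  then show "A ** matrix_inv A = mat 1" "matrix_inv A ** A = mat 1" by auto
qed

text \<open>Cramer's rule shows that the inverse depends on the matrix as smoothly as the determinant does.\<close>

lemma matrix_inv_cramer:
  fixes A :: "real^'n^'n"
  assumes "det A \<noteq> 0"
  shows "matrix_inv A $ k $ l = det (\<chi> i j. if j = k then axis l 1 $ i else A $ i $ j) / det A"
proof -
  have "A *v (matrix_inv A *v axis l 1) = axis l 1"
    using matrix_inv_works(1)[OF assms] by (simp add: matrix_vector_mul_assoc)
  then have "matrix_inv A *v axis l 1 = (\<chi> k. det (\<chi> i j. if j = k then axis l 1 $ i else A $ i $ j) / det A)"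
    using cramer[OF assms] by blast
  then have "(matrix_inv A *v axis l 1) $ k = det (\<chi> i j. if j = k then axis l 1 $ i else A $ i $ j) / det A"
    by simp
  then show ?thesis by (simp add: matrix_vector_mult_basis column_def)
qed

lemma Ck_on_matrix_inv:
  fixes M :: "'a::euclidean_space \<Rightarrow> real^'n^'n"
  assumes "open S" "Ck_on k M S" "\<And>x. x \<in> S \<Longrightarrow> det (M x) \<noteq> 0"
  shows "Ck_on k (\<lambda>x. matrix_inv (M x)) S"
proof (rule Ck_on_vec[OF assms(1)], rule Ck_on_vec[OF assms(1)])
  fix a l
  have "Ck_on k (\<lambda>x. (\<chi> i j. if j = a then axis l 1 $ i else M x $ i $ j) $ i $ j) S" for i j
    by (cases "j = a") (auto intro!: Ck_on_const Ck_on_nth assms)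
  then have "Ck_on k (\<lambda>x. det (\<chi> i j. if j = a then axis l 1 $ i else M x $ i $ j)) S"
    by (rule Ck_on_det[OF assms(1)])
  then have "Ck_on k (\<lambda>x. det (\<chi> i j. if j = a then axis l 1 $ i else M x $ i $ j) / det (M x)) S"
    by (intro Ck_on_divide[OF assms(1) _ Ck_on_det] Ck_on_nth assms)
  then show "Ck_on k (\<lambda>x. matrix_inv (M x) $ a $ l) S"
    by (rule Ck_on_cong[OF assms(1)]) (simp add: matrix_inv_cramer assms(3))
qed

text \<open>The second difference is symmetric in \<open>u\<close> and \<open>v\<close>, and two applications of the mean value theorem turn it into a second derivative. This is the classical proof of Schwarz's theorem.\<close>

lemma second_difference_mean_value:
  fixes f :: "'a::euclidean_space \<Rightarrow> real"
  assumes S: "ball x r \<subseteq> S" "Ck_on 2 f S" and h: "0 < h" "h * (norm u + norm v) < r"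
  shows "\<exists>s t. 0 \<le> s \<and> s \<le> h \<and> 0 \<le> t \<and> t \<le> h \<and>
    f (x + h *\<^sub>R u + h *\<^sub>R v) - f (x + h *\<^sub>R u) - f (x + h *\<^sub>R v) + f x
      = h * h * frechet_derivative (\<lambda>y. frechet_derivative f (at y) u) (at (x + s *\<^sub>R u + t *\<^sub>R v)) v"
proof -
  let ?fu = "\<lambda>y. frechet_derivative f (at y) u"
  have in_S: "x + s *\<^sub>R u + t *\<^sub>R v \<in> S" if "0 \<le> s" "s \<le> h" "0 \<le> t" "t \<le> h" for s t
  proof -
    have "norm (s *\<^sub>R u + t *\<^sub>R v) \<le> s * norm u + t * norm v"
      using norm_triangle_ineq[of "s *\<^sub>R u" "t *\<^sub>R v"] that by simp
    also have "\<dots> \<le> h * norm u + h * norm v"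
      using that by (intro add_mono mult_right_mono) auto
    finally have "norm (s *\<^sub>R u + t *\<^sub>R v) < r" using h by (simp add: algebra_simps)
    then have "x + s *\<^sub>R u + t *\<^sub>R v \<in> ball x r"
      using norm_minus_cancel[of "s *\<^sub>R u + t *\<^sub>R v"] by (simp add: dist_norm algebra_simps)
    then show ?thesis using S by auto
  qed
  have f1: "Ck_on (Suc (Suc 0)) f S" using S(2) by (simp add: numeral_2_eq_2)
  have f2: "Ck_on (Suc 0) ?fu S" using f1 by (rule Ck_on_SucD2)
  have D1: "((\<lambda>s. f (x + s *\<^sub>R u + t *\<^sub>R v)) has_real_derivative ?fu (x + s *\<^sub>R u + t *\<^sub>R v)) (at s)"
    if "0 \<le> s" "s \<le> h" "0 \<le> t" "t \<le> h" for s t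
  proof -
    have "((\<lambda>s. x + s *\<^sub>R u + t *\<^sub>R v) has_derivative (\<lambda>k. k *\<^sub>R u)) (at s)"
      by (auto intro!: derivative_eq_intros)
    from diff_chain_at[OF this Ck_on_SucD[OF f1 in_S[OF that]], unfolded o_def]
    show ?thesis
      unfolding has_field_derivative_def
      by (rule has_derivative_eq_rhs)
         (simp add: fun_eq_iff linear_cmul[OF has_derivative_linear[OF Ck_on_SucD[OF f1 in_S[OF that]]]])
  qed
  have D2: "((\<lambda>t. ?fu (x + s *\<^sub>R u + t *\<^sub>R v)) has_real_derivative
     frechet_derivative ?fu (at (x + s *\<^sub>R u + t *\<^sub>R v)) v) (at t)"
    if "0 \<le> s" "s \<le> h" "0 \<le> t" "t \<le> h" for s t
  proof -
    have "((\<lambda>t. x + s *\<^sub>R u + t *\<^sub>R v) has_derivative (\<lambda>k. k *\<^sub>R v)) (at t)"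
      by (auto intro!: derivative_eq_intros)
    from diff_chain_at[OF this Ck_on_SucD[OF f2 in_S[OF that]], unfolded o_def]
    show ?thesis
      unfolding has_field_derivative_def
      by (rule has_derivative_eq_rhs)
         (simp add: fun_eq_iff linear_cmul[OF has_derivative_linear[OF Ck_on_SucD[OF f2 in_S[OF that]]]])
  qed
  have "\<exists>s>0. s < h \<and> (f (x + h *\<^sub>R u + h *\<^sub>R v) - f (x + h *\<^sub>R u + 0 *\<^sub>R v))
        - (f (x + 0 *\<^sub>R u + h *\<^sub>R v) - f (x + 0 *\<^sub>R u + 0 *\<^sub>R v))
      = (h - 0) * (?fu (x + s *\<^sub>R u + h *\<^sub>R v) - ?fu (x + s *\<^sub>R u + 0 *\<^sub>R v))"
    by (rule MVT2) (use h in \<open>auto intro!: DERIV_diff D1 D1[where t=0, simplified]\<close>)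
  then obtain s where s: "0 < s" "s < h" "(f (x + h *\<^sub>R u + h *\<^sub>R v) - f (x + h *\<^sub>R u))
        - (f (x + h *\<^sub>R v) - f x) = h * (?fu (x + s *\<^sub>R u + h *\<^sub>R v) - ?fu (x + s *\<^sub>R u))"
    by auto
  have "\<exists>t>0. t < h \<and> ?fu (x + s *\<^sub>R u + h *\<^sub>R v) - ?fu (x + s *\<^sub>R u + 0 *\<^sub>R v)
      = (h - 0) * frechet_derivative ?fu (at (x + s *\<^sub>R u + t *\<^sub>R v)) v"
    by (rule MVT2) (use h s in \<open>auto intro!: D2\<close>)
  then obtain t where t: "0 < t" "t < h" "?fu (x + s *\<^sub>R u + h *\<^sub>R v) - ?fu (x + s *\<^sub>R u)
      = h * frechet_derivative ?fu (at (x + s *\<^sub>R u + t *\<^sub>R v)) v"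
    by auto
  show ?thesis
    by (rule exI[of _ s], rule exI[of _ t]) (use s t in \<open>auto simp: algebra_simps\<close>)
qed

lemma symmetric_second_derivative_real:
  fixes f :: "'a::euclidean_space \<Rightarrow> real"
  assumes S: "open S" "x \<in> S" "Ck_on 2 f S"
  shows "frechet_derivative (\<lambda>y. frechet_derivative f (at y) u) (at x) v
       = frechet_derivative (\<lambda>y. frechet_derivative f (at y) v) (at x) u" (is "?P x = ?Q x")
proof -
  have le: "\<bar>?P x - ?Q x\<bar> < 2 * e" if "e > 0" for e
  proof -
    have c: "continuous_on S ?P" "continuous_on S ?Q"
      using S(3) by (simp_all add: numeral_2_eq_2 Ck_on.simps)
    then have "isCont ?P x" "isCont ?Q x"
      using S(1,2) by (simp_all add: continuous_on_eq_continuous_at)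
    then have ex: "\<exists>d>0. \<forall>y. dist y x < d \<longrightarrow> dist (?P y) (?P x) < e"
      "\<exists>d>0. \<forall>y. dist y x < d \<longrightarrow> dist (?Q y) (?Q x) < e"
      using that by (simp_all add: continuous_at_eps_delta)
    obtain d1 where d1: "d1 > 0" "\<And>y. dist y x < d1 \<Longrightarrow> dist (?P y) (?P x) < e" using ex(1) by blast
    obtain d2 where d2: "d2 > 0" "\<And>y. dist y x < d2 \<Longrightarrow> dist (?Q y) (?Q x) < e" using ex(2) by blast
    note d = d1 d2
    obtain r where r: "r > 0" "ball x r \<subseteq> S" using S openE by blast
    define \<rho> where "\<rho> = min r (min d1 d2)"
    define h where "h = \<rho> / (2 * (norm u + norm v + 1))"
    have \<rho>: "\<rho> > 0" using r d by (auto simp: \<rho>_def)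
    have n: "norm u + norm v + 1 > 0" by (simp add: add_nonneg_pos)
    have h0: "h > 0" using \<rho> n by (simp add: h_def)
    have "h * (norm u + norm v + 1) = \<rho> / 2" using n unfolding h_def by (simp add: field_simps)
    then have h1: "h * (norm u + norm v) < \<rho>" using h0 \<rho> by (simp add: algebra_simps)
    have near: "dist (x + s *\<^sub>R u + t *\<^sub>R v) x < \<rho>" if "0 \<le> s" "s \<le> h" "0 \<le> t" "t \<le> h" for s t
    proof -
      have "norm (s *\<^sub>R u + t *\<^sub>R v) \<le> s * norm u + t * norm v"
        using norm_triangle_ineq[of "s *\<^sub>R u" "t *\<^sub>R v"] that by simp
      also have "\<dots> \<le> h * norm u + h * norm v"
        using that by (intro add_mono mult_right_mono) auto
      finally show ?thesis using h1 by (simp add: dist_norm algebra_simps)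
    qed
    obtain s t where st: "0 \<le> s" "s \<le> h" "0 \<le> t" "t \<le> h"
      "f (x + h *\<^sub>R u + h *\<^sub>R v) - f (x + h *\<^sub>R u) - f (x + h *\<^sub>R v) + f x = h * h * ?P (x + s *\<^sub>R u + t *\<^sub>R v)"
      using second_difference_mean_value[OF r(2) S(3) h0, of u v] h1 by (auto simp: \<rho>_def)
    obtain s' t' where st': "0 \<le> s'" "s' \<le> h" "0 \<le> t'" "t' \<le> h"
      "f (x + h *\<^sub>R v + h *\<^sub>R u) - f (x + h *\<^sub>R v) - f (x + h *\<^sub>R u) + f x = h * h * ?Q (x + s' *\<^sub>R v + t' *\<^sub>R u)"
      using second_difference_mean_value[OF r(2) S(3) h0, of v u] h1 by (auto simp: \<rho>_def add.commute)
    have "h * h * ?P (x + s *\<^sub>R u + t *\<^sub>R v) = h * h * ?Q (x + s' *\<^sub>R v + t' *\<^sub>R u)"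
      using st(5) st'(5) by (simp add: algebra_simps)
    then have "?P (x + s *\<^sub>R u + t *\<^sub>R v) = ?Q (x + s' *\<^sub>R v + t' *\<^sub>R u)" using h0 by simp
    moreover have "dist (?P (x + s *\<^sub>R u + t *\<^sub>R v)) (?P x) < e"
      using near[OF st(1-4)] by (intro d(2)) (simp add: \<rho>_def)
    moreover have "dist (?Q (x + s' *\<^sub>R v + t' *\<^sub>R u)) (?Q x) < e"
      using near[OF st'(3,4,1,2)] by (intro d(4)) (simp add: \<rho>_def algebra_simps)
    ultimately show ?thesis by (simp add: dist_real_def)
  qed
  show ?thesis
  proof (rule ccontr)
    assume "?P x \<noteq> ?Q x"
    then show False using le[of "\<bar>?P x - ?Q x\<bar> / 2"] by simp
  qed
qed

lemma frechet_derivative_bounded_linear: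
  assumes "bounded_linear L" "f differentiable at x"
  shows "frechet_derivative (\<lambda>y. L (f y)) (at x) v = L (frechet_derivative f (at x) v)"
  by (rule fun_cong[OF frechet_derivative_at[OF bounded_linear.has_derivative[OF assms(1)
    assms(2)[unfolded frechet_derivative_works]]], symmetric])

lemma symmetric_second_derivative:
  fixes f :: "'a::euclidean_space \<Rightarrow> 'b::euclidean_space"
  assumes S: "open S" "x \<in> S" "Ck_on 2 f S"
  shows "frechet_derivative (\<lambda>y. frechet_derivative f (at y) u) (at x) v
       = frechet_derivative (\<lambda>y. frechet_derivative f (at y) v) (at x) u"
proof (rule euclidean_eqI)
  fix b :: 'b
  let ?L = "\<lambda>z. z \<bullet> b"
  have L: "bounded_linear ?L" by (rule bounded_linear_inner_left)
  have bounded_linear_diff: "(\<lambda>y. ?L (h y)) differentiable at y" if "h differentiable at y" for h y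
    using that bounded_linear.has_derivative[OF L] unfolding differentiable_def by blast
  have 2: "Ck_on (Suc (Suc 0)) f S" using S(3) by (simp add: numeral_2_eq_2)
  have "frechet_derivative (\<lambda>y. frechet_derivative (\<lambda>y. ?L (f y)) (at y) u) (at x) v
      = ?L (frechet_derivative (\<lambda>y. frechet_derivative f (at y) u) (at x) v)" for u v
  proof -
    have d: "(\<lambda>y. frechet_derivative f (at y) u) differentiable at x" using 2 S by (simp add: Ck_on.simps)
    have "frechet_derivative (\<lambda>y. frechet_derivative (\<lambda>y. ?L (f y)) (at y) u) (at x)
       = frechet_derivative (\<lambda>y. ?L (frechet_derivative f (at y) u)) (at x)"
      by (rule sym, rule frechet_derivative_transform_within_open[OF _ S(1,2)])
         (use frechet_derivative_bounded_linear[OF L, of f] 2 in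
           \<open>auto intro!: bounded_linear_diff d simp: Ck_on.simps\<close>)
    then show ?thesis using frechet_derivative_bounded_linear[OF L d] by simp
  qed
  then show "frechet_derivative (\<lambda>y. frechet_derivative f (at y) u) (at x) v \<bullet> b
       = frechet_derivative (\<lambda>y. frechet_derivative f (at y) v) (at x) u \<bullet> b"
    using symmetric_second_derivative_real[OF S(1,2) Ck_on_bounded_linear[OF S(1) L S(3)], of u v] by simp
qed

section \<open>Trigonometric series\<close>

lemma cis_has_vector_derivative: "(cis has_vector_derivative \<i> * cis t) (at t within T)"
  unfolding has_vector_derivative_def
  by (rule has_derivative_eq_rhs, rule has_derivative_cis, rule has_derivative_ident)
     (auto simp: fun_eq_iff scaleR_conv_of_real)

lemma norm_cis_diff_le: "norm (cis b - cis a) \<le> \<bar>b - a\<bar>"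
proof -
  have "onorm (\<lambda>h. h *\<^sub>R (\<i> * cis t)) \<le> 1" for t
    by (rule onorm_le) (simp add: norm_mult)
  then have "norm (cis b - cis a) \<le> 1 * norm (b - a)"
    using cis_has_vector_derivative
    by (intro differentiable_bound[of UNIV cis "\<lambda>t h. h *\<^sub>R (\<i> * cis t)"])
       (auto simp: has_vector_derivative_def)
  then show ?thesis by simp
qed

lemma norm_cis_linearization_le: "norm (cis (a + t) - cis a - t * \<i> * cis a) \<le> t\<^sup>2"
proof -
  have "norm (cis (a + t) - cis a - ((a + t) - a) *\<^sub>R (\<i> * cis a)) \<le> norm ((a + t) - a) * \<bar>t\<bar>"
  proof (rule vector_differentiable_bound_linearization[where S = "closed_segment a (a + t)"])
    fix x assume x: "x \<in> closed_segment a (a + t)"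
    have "norm (\<i> * cis x - \<i> * cis a) = norm (cis x - cis a)"
      by (simp add: norm_mult flip: right_diff_distrib)
    also have "\<dots> \<le> \<bar>x - a\<bar>" by (rule norm_cis_diff_le)
    also have "\<dots> \<le> \<bar>t\<bar>"
      using segment_bound(1)[OF x] by simp
    finally show "norm (\<i> * cis x - \<i> * cis a) \<le> \<bar>t\<bar>" .
  qed (auto intro: cis_has_vector_derivative)
  then show ?thesis by (simp add: scaleR_conv_of_real power2_eq_square mult.assoc)
qed

lemma has_sum_minus:
  fixes f g :: "'i \<Rightarrow> 'b::real_normed_vector"
  assumes "(f has_sum a) I" "(g has_sum b) I"
  shows "((\<lambda>i. f i - g i) has_sum (a - b)) I"
  using has_sum_add[OF assms(1), of "\<lambda>i. - g i" "- b"] assms(2) by (simp add: has_sum_uminus)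

text \<open>The index set is arbitrary and the frequencies \<open>\<kappa>\<close> need not be distinct: the solution of the Beltrami equation is a series indexed by words, in which every frequency occurs infinitely often.\<close>

definition trig_series :: "('i \<Rightarrow> complex) \<Rightarrow> ('i \<Rightarrow> 'a::euclidean_space) \<Rightarrow> 'i set \<Rightarrow> 'a \<Rightarrow> complex" where
  "trig_series c \<kappa> I y = (\<Sum>\<^sub>\<infinity>i\<in>I. c i * cis (\<kappa> i \<bullet> y))"

lemma trig_summable:
  assumes "(\<lambda>i. norm (c i)) summable_on I"
  shows "(\<lambda>i. norm (c i * cis (\<kappa> i \<bullet> y))) summable_on I" "(\<lambda>i. c i * cis (\<kappa> i \<bullet> y)) summable_on I"
proof -
  show "(\<lambda>i. norm (c i * cis (\<kappa> i \<bullet> y))) summable_on I" using assms by (simp add: norm_mult)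
  then show "(\<lambda>i. c i * cis (\<kappa> i \<bullet> y)) summable_on I" by (rule abs_summable_summable)
qed

lemma trig_has_sum:
  assumes "(\<lambda>i. norm (c i)) summable_on I"
  shows "((\<lambda>i. c i * cis (\<kappa> i \<bullet> y)) has_sum trig_series c \<kappa> I y) I"
  unfolding trig_series_def using trig_summable(2)[OF assms] by (rule has_sum_infsum)

lemma weight_summable_mono:
  fixes c :: "'i \<Rightarrow> complex" and \<kappa> :: "'i \<Rightarrow> 'a::real_normed_vector"
  assumes "(\<lambda>i. norm (c i) * (1 + norm (\<kappa> i)) ^ n) summable_on I" "m \<le> n"
  shows "(\<lambda>i. norm (c i) * (1 + norm (\<kappa> i)) ^ m) summable_on I"
  using assms(1)
  by (rule summable_on_comparison_test) (auto intro!: mult_left_mono power_increasing assms(2))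

text \<open>Termwise differentiation: the linearization error of each term is at most quadratic in the increment, with the square of the frequency as a constant, so a weight of order two makes the error summable.\<close>

lemma trig_series_has_derivative:
  fixes \<kappa> :: "'i \<Rightarrow> 'a::euclidean_space"
  assumes "(\<lambda>i. norm (c i) * (1 + norm (\<kappa> i)) ^ 2) summable_on I"
  shows "(trig_series c \<kappa> I has_derivative (\<lambda>v. trig_series (\<lambda>i. c i * \<i> * (\<kappa> i \<bullet> v)) \<kappa> I y)) (at y)"
proof -
  let ?L = "\<lambda>v. trig_series (\<lambda>i. c i * \<i> * (\<kappa> i \<bullet> v)) \<kappa> I y"
  define C where "C = (\<Sum>\<^sub>\<infinity>i\<in>I. norm (c i) * (1 + norm (\<kappa> i)) ^ 2)"
  have C: "((\<lambda>i. norm (c i) * (1 + norm (\<kappa> i)) ^ 2) has_sum C) I"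
    unfolding C_def using assms by (rule has_sum_infsum)
  have s0: "(\<lambda>i. norm (c i)) summable_on I"
    using weight_summable_mono[OF assms, of 0] by simp
  have le: "norm (\<kappa> i) \<le> (1 + norm (\<kappa> i)) ^ 2" "(norm (\<kappa> i))\<^sup>2 \<le> (1 + norm (\<kappa> i)) ^ 2" for i
    by (auto simp: power2_eq_square algebra_simps)
  have s1: "(\<lambda>i. norm (c i * \<i> * (\<kappa> i \<bullet> v))) summable_on I" for v
  proof (rule summable_on_comparison_test)
    show "(\<lambda>i. norm v * (norm (c i) * (1 + norm (\<kappa> i)) ^ 2)) summable_on I"
      by (rule summable_on_cmult_right) (rule assms)
    show "norm (c i * \<i> * (\<kappa> i \<bullet> v)) \<le> norm v * (norm (c i) * (1 + norm (\<kappa> i)) ^ 2)" for i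
    proof -
      have "\<bar>\<kappa> i \<bullet> v\<bar> \<le> norm (\<kappa> i) * norm v" by (rule Cauchy_Schwarz_ineq2)
      also have "\<dots> \<le> (1 + norm (\<kappa> i)) ^ 2 * norm v" using le by (intro mult_right_mono) auto
      finally have "norm (c i) * \<bar>\<kappa> i \<bullet> v\<bar> \<le> norm (c i) * ((1 + norm (\<kappa> i)) ^ 2 * norm v)"
        by (intro mult_left_mono) auto
      then show ?thesis by (simp add: norm_mult mult_ac)
    qed
  qed auto
  have t1: "((\<lambda>i. (c i * \<i> * (\<kappa> i \<bullet> v)) * cis (\<kappa> i \<bullet> y)) has_sum ?L v) I" for v
    by (rule trig_has_sum[OF s1])
  show ?thesis
  proof (rule has_derivativeI_sandwich[where e = 1 and H = "\<lambda>z. C * norm (z - y)"])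
    show "bounded_linear ?L"
    proof (rule bounded_linear_intro[where K = C])
      fix v w :: 'a and r :: real
      have "((\<lambda>i. (c i * \<i> * (\<kappa> i \<bullet> (v + w))) * cis (\<kappa> i \<bullet> y)) has_sum ?L v + ?L w) I"
        using has_sum_add[OF t1[of v] t1[of w]] by (simp add: algebra_simps inner_add_right)
      then show "?L (v + w) = ?L v + ?L w" using t1[of "v + w"] has_sum_unique by blast
      have "((\<lambda>i. (c i * \<i> * (\<kappa> i \<bullet> (r *\<^sub>R v))) * cis (\<kappa> i \<bullet> y)) has_sum r *\<^sub>R ?L v) I"
        using has_sum_cmult_right[OF t1[of v], of r] by (simp add: scaleR_conv_of_real mult_ac)
      then show "?L (r *\<^sub>R v) = r *\<^sub>R ?L v" using t1[of "r *\<^sub>R v"] has_sum_unique by blast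
      have "norm (?L v) \<le> norm v * C"
      proof (rule norm_infsum_le[OF t1 has_sum_cmult_right[OF C]])
        fix i
        have "\<bar>\<kappa> i \<bullet> v\<bar> \<le> norm (\<kappa> i) * norm v" by (rule Cauchy_Schwarz_ineq2)
        also have "\<dots> \<le> (1 + norm (\<kappa> i)) ^ 2 * norm v" using le by (intro mult_right_mono) auto
        finally have "norm (c i) * \<bar>\<kappa> i \<bullet> v\<bar> \<le> norm (c i) * ((1 + norm (\<kappa> i)) ^ 2 * norm v)"
          by (intro mult_left_mono) auto
        then show "norm (c i * \<i> * (\<kappa> i \<bullet> v) * cis (\<kappa> i \<bullet> y)) \<le> norm v * (norm (c i) * (1 + norm (\<kappa> i)) ^ 2)"
          by (simp add: norm_mult mult_ac)
      qed
      then show "norm (?L v) \<le> norm v * C" .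
    qed
    fix z assume "z \<noteq> y"
    have "((\<lambda>i. c i * cis (\<kappa> i \<bullet> z) - c i * cis (\<kappa> i \<bullet> y) - c i * \<i> * (\<kappa> i \<bullet> (z - y)) * cis (\<kappa> i \<bullet> y))
       has_sum (trig_series c \<kappa> I z - trig_series c \<kappa> I y - ?L (z - y))) I"
      by (intro has_sum_minus trig_has_sum s0 t1)
    moreover have "((\<lambda>i. (norm (z - y))\<^sup>2 * (norm (c i) * (1 + norm (\<kappa> i)) ^ 2)) has_sum (norm (z - y))\<^sup>2 * C) I"
      by (rule has_sum_cmult_right[OF C])
    ultimately have "norm (trig_series c \<kappa> I z - trig_series c \<kappa> I y - ?L (z - y)) \<le> (norm (z - y))\<^sup>2 * C"
    proof (rule norm_infsum_le)
      fix i
      let ?t = "\<kappa> i \<bullet> (z - y)"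
      have "norm (c i * cis (\<kappa> i \<bullet> z) - c i * cis (\<kappa> i \<bullet> y) - c i * \<i> * ?t * cis (\<kappa> i \<bullet> y))
        = norm (c i) * norm (cis (\<kappa> i \<bullet> y + ?t) - cis (\<kappa> i \<bullet> y) - ?t * \<i> * cis (\<kappa> i \<bullet> y))"
        by (simp add: inner_diff_right algebra_simps flip: norm_mult)
      also have "\<dots> \<le> norm (c i) * ?t\<^sup>2"
        by (intro mult_left_mono norm_cis_linearization_le) auto
      also have "\<dots> \<le> norm (c i) * ((norm (\<kappa> i))\<^sup>2 * (norm (z - y))\<^sup>2)"
      proof -
        have "?t\<^sup>2 = \<bar>?t\<bar>\<^sup>2" by simp
        also have "\<dots> \<le> (norm (\<kappa> i) * norm (z - y))\<^sup>2"
          by (rule power_mono[OF Cauchy_Schwarz_ineq2]) simp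
        finally have "?t\<^sup>2 \<le> (norm (\<kappa> i) * norm (z - y))\<^sup>2" .
        then show ?thesis by (intro mult_left_mono) (auto simp: power_mult_distrib)
      qed
      also have "\<dots> \<le> norm (c i) * ((1 + norm (\<kappa> i)) ^ 2 * (norm (z - y))\<^sup>2)"
        using le by (intro mult_left_mono mult_right_mono) auto
      finally show "norm (c i * cis (\<kappa> i \<bullet> z) - c i * cis (\<kappa> i \<bullet> y) - c i * \<i> * ?t * cis (\<kappa> i \<bullet> y))
        \<le> (norm (z - y))\<^sup>2 * (norm (c i) * (1 + norm (\<kappa> i)) ^ 2)" by (simp add: mult_ac)
    qed
    then show "norm (trig_series c \<kappa> I z - trig_series c \<kappa> I y - ?L (z - y)) / norm (z - y) \<le> C * norm (z - y)"
      using \<open>z \<noteq> y\<close> by (simp add: field_simps power2_eq_square)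
  next
    show "((\<lambda>z. C * norm (z - y)) \<longlongrightarrow> 0) (at y)"
      by (auto intro!: tendsto_eq_intros)
  qed auto
qed

text \<open>Every derivative multiplies the coefficients by a frequency; two more orders of the weight make the differentiated series converge with its error terms.\<close>

lemma trig_series_Ck:
  fixes \<kappa> :: "'i \<Rightarrow> 'a::euclidean_space"
  assumes "(\<lambda>i. norm (c i) * (1 + norm (\<kappa> i)) ^ (n + 2)) summable_on I"
  shows "Ck_on n (trig_series c \<kappa> I) UNIV"
  using assms
proof (induction n arbitrary: c)
  case 0
  then have "(\<lambda>i. norm (c i) * (1 + norm (\<kappa> i)) ^ 2) summable_on I" by (simp only: add_0_left)
  then show ?case
    by (auto intro!: continuous_at_imp_continuous_on has_derivative_continuous[OF trig_series_has_derivative])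
next
  case (Suc n)
  show ?case
  proof (rule Ck_on_SucI[OF _ trig_series_has_derivative])
    show "(\<lambda>i. norm (c i) * (1 + norm (\<kappa> i)) ^ 2) summable_on I"
      using weight_summable_mono[OF Suc.prems, of 2] by simp
    fix v
    show "Ck_on n (\<lambda>y. trig_series (\<lambda>i. c i * \<i> * (\<kappa> i \<bullet> v)) \<kappa> I y) UNIV"
    proof (rule Suc.IH, rule summable_on_comparison_test)
      show "(\<lambda>i. norm v * (norm (c i) * (1 + norm (\<kappa> i)) ^ (Suc n + 2))) summable_on I"
        by (rule summable_on_cmult_right) (rule Suc.prems)
      fix i
      have "\<bar>\<kappa> i \<bullet> v\<bar> \<le> norm (\<kappa> i) * norm v" by (rule Cauchy_Schwarz_ineq2)
      also have "\<dots> \<le> (1 + norm (\<kappa> i)) * norm v" by (intro mult_right_mono) auto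
      finally have "norm (c i) * \<bar>\<kappa> i \<bullet> v\<bar> * (1 + norm (\<kappa> i)) ^ (n + 2)
         \<le> norm (c i) * ((1 + norm (\<kappa> i)) * norm v) * (1 + norm (\<kappa> i)) ^ (n + 2)"
        by (intro mult_left_mono mult_right_mono) auto
      then show "norm (c i * \<i> * (\<kappa> i \<bullet> v)) * (1 + norm (\<kappa> i)) ^ (n + 2)
         \<le> norm v * (norm (c i) * (1 + norm (\<kappa> i)) ^ (Suc n + 2))"
        by (simp add: norm_mult mult_ac)
    qed auto
  qed auto
qed

section \<open>Fourier coefficients of doubly periodic functions\<close>

abbreviation period_box :: "(real \<times> real) set" where
  "period_box \<equiv> cbox (-pi, -pi) (pi, pi)"

definition freq :: "int \<times> int \<Rightarrow> real \<times> real" where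
  "freq k = (of_int (fst k), of_int (snd k))"

text \<open>The integral over a period, without dividing by the area of the period box.\<close>

definition fcoef :: "(real \<times> real \<Rightarrow> complex) \<Rightarrow> int \<times> int \<Rightarrow> complex" where
  "fcoef g k = integral period_box (\<lambda>z. g z * cis (- (freq k \<bullet> z)))"

abbreviation dird :: "'a::euclidean_space \<Rightarrow> ('a \<Rightarrow> 'b::euclidean_space) \<Rightarrow> 'a \<Rightarrow> 'b" where
  "dird v g \<equiv> (\<lambda>z. frechet_derivative g (at z) v)"

lemma has_vector_derivative_along_line:
  fixes h :: "'a::euclidean_space \<Rightarrow> 'b::euclidean_space"
  assumes C: "Ck_on (Suc 0) h UNIV" and \<gamma>: "(\<gamma> has_vector_derivative v) (at t)"
  shows "((\<lambda>t. h (\<gamma> t)) has_vector_derivative dird v h (\<gamma> t)) (at t within T)"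
proof -
  note D = Ck_on_SucD[OF C UNIV_I, of "\<gamma> t"]
  have "((\<lambda>t. h (\<gamma> t)) has_derivative (\<lambda>s. frechet_derivative h (at (\<gamma> t)) (s *\<^sub>R v))) (at t)"
    using diff_chain_at[OF \<gamma>[unfolded has_vector_derivative_def] D] by (simp add: o_def)
  then show ?thesis
    unfolding has_vector_derivative_def linear_cmul[OF has_derivative_linear[OF D]] by (rule has_derivative_at_withinI)
qed

text \<open>The boundary terms of the fundamental theorem of calculus cancel by periodicity.\<close>

lemma integral_dird_1_eq_0:
  fixes h :: "real \<times> real \<Rightarrow> complex"
  assumes "Ck_on 1 h UNIV" "\<And>y. h (pi, y) = h (- pi, y)"
  shows "integral period_box (dird (1,0) h) = 0"
proof -
  let ?F = "dird (1,0) h"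
  have C: "Ck_on (Suc 0) h UNIV" using assms(1) by simp
  have c': "continuous_on (cbox (-pi,-pi) (pi,pi)) (\<lambda>(x,y). ?F (x,y))"
    using continuous_on_subset[OF Ck_on_continuous[OF Ck_on_SucD2[OF C]] subset_UNIV] by (simp add: case_prod_unfold)
  have "integral {-pi..pi} (\<lambda>x. ?F (x,y)) = 0" for y
  proof -
    have "((\<lambda>x. h (x,y)) has_vector_derivative ?F (x,y)) (at x within {-pi..pi})" for x
      by (rule has_vector_derivative_along_line[OF C])
         (auto simp: has_vector_derivative_def intro!: derivative_eq_intros)
    then have "((\<lambda>x. ?F (x,y)) has_integral (h (pi,y) - h (-pi,y))) {-pi..pi}"
      by (intro fundamental_theorem_of_calculus) auto
    then show ?thesis using assms(2)[of y] by (simp add: integral_unique)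
  qed
  then have "integral (cbox (-pi) pi) (\<lambda>y. integral (cbox (-pi) pi) (\<lambda>x. ?F (x,y))) = 0" by simp
  then have "integral (cbox (-pi) pi) (\<lambda>x. integral (cbox (-pi) pi) (\<lambda>y. ?F (x,y))) = 0"
    using integral_swap_continuous[OF c'] by simp
  then show ?thesis using integral_prod_continuous[of "-pi" "-pi" pi pi ?F] c'
    by (simp add: case_prod_unfold)
qed

lemma integral_dird_2_eq_0:
  fixes h :: "real \<times> real \<Rightarrow> complex"
  assumes "Ck_on 1 h UNIV" "\<And>x. h (x, pi) = h (x, - pi)"
  shows "integral period_box (dird (0,1) h) = 0"
proof -
  let ?F = "dird (0,1) h"
  have C: "Ck_on (Suc 0) h UNIV" using assms(1) by simp
  have c': "continuous_on (cbox (-pi,-pi) (pi,pi)) (\<lambda>(x,y). ?F (x,y))"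
    using continuous_on_subset[OF Ck_on_continuous[OF Ck_on_SucD2[OF C]] subset_UNIV] by (simp add: case_prod_unfold)
  have "integral {-pi..pi} (\<lambda>y. ?F (x,y)) = 0" for x
  proof -
    have "((\<lambda>y. h (x,y)) has_vector_derivative ?F (x,y)) (at y within {-pi..pi})" for y
      by (rule has_vector_derivative_along_line[OF C])
         (auto simp: has_vector_derivative_def intro!: derivative_eq_intros)
    then have "((\<lambda>y. ?F (x,y)) has_integral (h (x,pi) - h (x,-pi))) {-pi..pi}"
      by (intro fundamental_theorem_of_calculus) auto
    then show ?thesis using assms(2)[of x] by (simp add: integral_unique)
  qed
  then show ?thesis using integral_prod_continuous[of "-pi" "-pi" pi pi ?F] c'
    by (simp add: case_prod_unfold)
qed

lemma cis_linear_has_derivative: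
  "((\<lambda>z. cis (a \<bullet> z)) has_derivative (\<lambda>v. (a \<bullet> v) *\<^sub>R (\<i> * cis (a \<bullet> z)))) (at z)"
  by (auto intro!: derivative_eq_intros)

lemma cis_linear_Ck: "Ck_on n (\<lambda>z. c * cis (a \<bullet> z)) UNIV"
proof (induction n arbitrary: c)
  case 0
  then show ?case by (auto intro!: continuous_intros)
next
  case (Suc n)
  show ?case
  proof (rule Ck_on_SucI[OF _ bounded_linear.has_derivative[OF bounded_linear_mult_right cis_linear_has_derivative]])
    fix v
    have "(\<lambda>z. c * (a \<bullet> v) *\<^sub>R (\<i> * cis (a \<bullet> z))) = (\<lambda>z. (c * (a \<bullet> v) * \<i>) * cis (a \<bullet> z))"
      by (simp add: fun_eq_iff scaleR_conv_of_real)
    then show "Ck_on n (\<lambda>z. c * (a \<bullet> v) *\<^sub>R (\<i> * cis (a \<bullet> z))) UNIV" using Suc.IH by simp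
  qed simp
qed

lemma product_cis_dird:
  fixes g :: "'a::euclidean_space \<Rightarrow> complex"
  assumes "Ck_on 1 g UNIV"
  shows "Ck_on 1 (\<lambda>z. g z * cis (- (a \<bullet> z))) UNIV"
    and "dird v (\<lambda>z. g z * cis (- (a \<bullet> z))) = (\<lambda>z. dird v g z * cis (- (a \<bullet> z)) - \<i> * (a \<bullet> v) * (g z * cis (- (a \<bullet> z))))"
proof -
  have C: "Ck_on 1 (\<lambda>z. cis (- (a \<bullet> z))) UNIV" using cis_linear_Ck[of 1 1 "- a"] by simp
  show "Ck_on 1 (\<lambda>z. g z * cis (- (a \<bullet> z))) UNIV"
    using Ck_on_mult_complex[OF _ assms C] by simp
  have "((\<lambda>z. g z * cis ((- a) \<bullet> z)) has_derivative
    (\<lambda>v. g z * ((- a) \<bullet> v) *\<^sub>R (\<i> * cis ((- a) \<bullet> z)) + dird v g z * cis ((- a) \<bullet> z))) (at z)" for z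
    by (rule has_derivative_mult[OF _ cis_linear_has_derivative]) (use Ck_on_SucD[of 0 g UNIV z] assms in simp)
  then have "frechet_derivative (\<lambda>z. g z * cis ((- a) \<bullet> z)) (at z) v
    = g z * ((- a) \<bullet> v) *\<^sub>R (\<i> * cis ((- a) \<bullet> z)) + dird v g z * cis ((- a) \<bullet> z)" for z
    by (rule fun_cong[OF frechet_derivative_at[symmetric]])
  then show "dird v (\<lambda>z. g z * cis (- (a \<bullet> z)))
    = (\<lambda>z. dird v g z * cis (- (a \<bullet> z)) - \<i> * (a \<bullet> v) * (g z * cis (- (a \<bullet> z))))"
    by (intro ext) (simp add: scaleR_conv_of_real algebra_simps)
qed

lemma integrable_on_period_box:
  fixes f :: "real \<times> real \<Rightarrow> complex"
  shows "continuous_on UNIV f \<Longrightarrow> f integrable_on period_box"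
  by (rule integrable_continuous[OF continuous_on_subset[OF _ subset_UNIV]])

text \<open>Integration by parts. The function vanishes on the boundary of the period box, so there are no boundary terms.\<close>

lemma fcoef_dird:
  assumes C: "Ck_on 1 g UNIV" and v: "v = (1,0) \<or> v = (0,1)"
    and per: "\<And>x. g (x, pi) = 0 \<and> g (x, - pi) = 0 \<and> g (pi, x) = 0 \<and> g (- pi, x) = 0"
  shows "fcoef (dird v g) k = \<i> * (freq k \<bullet> v) * fcoef g k"
proof -
  let ?h = "\<lambda>z. g z * cis (- (freq k \<bullet> z))"
  have h: "Ck_on 1 ?h UNIV" by (rule product_cis_dird(1)[OF C])
  have "integral period_box (dird v ?h) = 0"
    using v integral_dird_1_eq_0[OF h] integral_dird_2_eq_0[OF h] per by (elim disjE) simp_all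
  moreover have c: "continuous_on UNIV (dird v g)" "continuous_on UNIV g"
    using C Ck_on_SucD2[of 0 g UNIV v] Ck_on_continuous[OF C] by simp_all
  have "(\<lambda>z. dird v g z * cis (- (freq k \<bullet> z))) integrable_on period_box"
    "(\<lambda>z. \<i> * (freq k \<bullet> v) * ?h z) integrable_on period_box"
    by (intro integrable_on_period_box continuous_intros c)+
  then have "integral period_box (\<lambda>z. dird v g z * cis (- (freq k \<bullet> z)) - \<i> * (freq k \<bullet> v) * ?h z)
    = fcoef (dird v g) k - \<i> * (freq k \<bullet> v) * fcoef g k"
    unfolding fcoef_def by (simp add: Henstock_Kurzweil_Integration.integral_diff)
  ultimately show ?thesis unfolding product_cis_dird(2)[OF C] by simp
qed

lemma integral_period_box_norm_le:
  fixes f :: "real \<times> real \<Rightarrow> complex"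
  assumes "continuous_on UNIV f" "\<And>z. z \<in> period_box \<Longrightarrow> norm (f z) \<le> B"
  shows "norm (integral period_box f) \<le> B * measure lborel period_box"
proof (rule has_integral_bound)
  have "(0,0) \<in> period_box" by (auto simp: cbox_Pair_eq)
  then show "0 \<le> B" using assms(2) norm_ge_zero order_trans by blast
qed (use assms integrable_on_period_box in \<open>auto simp: has_integral_integral\<close>)

lemma Ck_on_funpow_dird: "Ck_on (n + m) g S \<Longrightarrow> Ck_on m ((dird v ^^ n) g) S"
proof (induction n arbitrary: m)
  case (Suc n)
  then have "Ck_on (Suc m) ((dird v ^^ n) g) S" by simp
  then show ?case by (simp add: Ck_on_SucD2)
qed simp

lemma dird_eq_0_outside:
  fixes g :: "'a::euclidean_space \<Rightarrow> 'b::euclidean_space"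
  assumes "\<And>z. r < norm z \<Longrightarrow> g z = 0" "r < norm z"
  shows "dird v g z = 0"
proof -
  have "(g has_derivative (\<lambda>v. 0)) (at z)"
    by (rule has_derivative_transform_within_open[of "\<lambda>z. 0" _ z UNIV "{z. r < norm z}"])
       (use assms in \<open>auto intro: open_Collect_less continuous_intros\<close>)
  then show ?thesis by (rule fun_cong[OF frechet_derivative_at[symmetric]])
qed

lemma funpow_dird_eq_0_outside:
  assumes "\<And>z. r < norm z \<Longrightarrow> g z = 0" "r < norm z"
  shows "(dird v ^^ n) g z = 0"
  using assms(2) by (induction n arbitrary: z) (auto intro: dird_eq_0_outside assms(1))

text \<open>The radius \<open>3/2\<close> is chosen so that the support lies inside the period box; it exceeds the radius \<open>sqrt 2\<close> of the support of the cutoff function and is less than \<open>pi / 2\<close>.\<close>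

lemma boundary_outside: "3/2 < norm (x, pi)" "3/2 < norm (x, - pi)" "3/2 < norm (pi, x)" "3/2 < norm (- pi, x)"
proof -
  have "3/2 < pi" using pi_gt3 by simp
  then show "3/2 < norm (x, pi)" "3/2 < norm (x, - pi)" "3/2 < norm (pi, x)" "3/2 < norm (- pi, x)"
    using norm_snd_le[of "pi" x] norm_snd_le[of "-pi" x] norm_fst_le[of "pi" x] norm_fst_le[of "-pi" x]
    by auto
qed

lemma fcoef_funpow_dird:
  assumes "Ck_on n g UNIV" "\<And>z. 3/2 < norm z \<Longrightarrow> g z = 0" "v = (1,0) \<or> v = (0,1)"
  shows "fcoef ((dird v ^^ n) g) k = (\<i> * (freq k \<bullet> v)) ^ n * fcoef g k"
  using assms(1)
proof (induction n)
  case (Suc n)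
  have "Ck_on 1 ((dird v ^^ n) g) UNIV" using Suc.prems by (intro Ck_on_funpow_dird) simp
  moreover have "(dird v ^^ n) g z = 0" if "3/2 < norm z" for z
    using funpow_dird_eq_0_outside[of "3/2"] assms(2) that by blast
  ultimately have "fcoef (dird v ((dird v ^^ n) g)) k = \<i> * (freq k \<bullet> v) * fcoef ((dird v ^^ n) g) k"
    by (intro fcoef_dird assms(3)) (simp_all only: boundary_outside simp_thms)
  then show ?case using Suc.IH[OF Ck_on_Suc_imp[OF Suc.prems]] by simp
qed simp

lemma power_one_plus_le: "0 \<le> a \<Longrightarrow> (1 + a) ^ n \<le> 2 ^ n * (1 + a ^ n)" for a :: real
proof -
  assume a: "0 \<le> a"
  have "(1 + a) ^ n \<le> (2 * max 1 a) ^ n" using a by (intro power_mono) auto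
  also have "\<dots> = 2 ^ n * max 1 a ^ n" by (simp add: power_mult_distrib)
  also have "max 1 a ^ n \<le> 1 + a ^ n" using a by (auto simp: max_def)
  finally show ?thesis by simp
qed

text \<open>The four combinations of \<open>0\<close> or \<open>n\<close> derivatives in each variable control the product weight, because \<open>(1 + a)^n\<close> is at most a constant times \<open>1 + a^n\<close>. The bound is linear in the size \<open>\<eta>\<close> of the derivatives, which is what makes the Fourier series of a small function small.\<close>

lemma fcoef_decay:
  assumes C: "Ck_on (n + n) g UNIV" and supp: "\<And>z. 3/2 < norm z \<Longrightarrow> g z = 0"
    and bound: "\<And>i j z. i \<in> {0, n} \<Longrightarrow> j \<in> {0, n} \<Longrightarrow> norm ((dird (0,1) ^^ j) ((dird (1,0) ^^ i) g) z) \<le> \<eta>"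
  shows "norm (fcoef g k) * ((1 + \<bar>of_int (fst k)\<bar>) ^ n * (1 + \<bar>of_int (snd k)\<bar>) ^ n)
    \<le> 4 ^ n * (4 * \<eta> * measure lborel period_box)"
proof -
  let ?a = "\<bar>of_int (fst k)\<bar> :: real" and ?b = "\<bar>of_int (snd k)\<bar> :: real" and ?c = "norm (fcoef g k)"
  have *: "?a ^ i * ?b ^ j * ?c \<le> \<eta> * measure lborel period_box" if ij: "i \<in> {0, n}" "j \<in> {0, n}" for i j
  proof -
    let ?g = "(dird (1,0) ^^ i) g"
    have g: "Ck_on j ?g UNIV" using C ij by (intro Ck_on_funpow_dird Ck_on_le[OF C]) auto
    have "fcoef ((dird (0,1) ^^ j) ?g) k = (\<i> * (freq k \<bullet> (0,1))) ^ j * fcoef ?g k"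
      by (rule fcoef_funpow_dird[OF g]) (use funpow_dird_eq_0_outside[of "3/2" g] supp in auto)
    also have "fcoef ?g k = (\<i> * (freq k \<bullet> (1,0))) ^ i * fcoef g k"
      by (rule fcoef_funpow_dird) (use supp Ck_on_le[OF C] ij in auto)
    finally have "?a ^ i * ?b ^ j * ?c = norm (fcoef ((dird (0,1) ^^ j) ?g) k)"
      by (simp add: norm_mult norm_power freq_def)
    also have "\<dots> \<le> \<eta> * measure lborel period_box"
      unfolding fcoef_def
    proof (rule integral_period_box_norm_le)
      have "continuous_on UNIV ((dird (0,1) ^^ j) ?g)"
        using Ck_on_funpow_dird[of j 0 ?g] g by simp
      then show "continuous_on UNIV (\<lambda>z. (dird (0,1) ^^ j) ?g z * cis (- (freq k \<bullet> z)))"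
        by (intro continuous_intros)
    qed (use bound[OF ij] in \<open>simp add: norm_mult\<close>)
    finally show ?thesis .
  qed
  have "?c * ((1 + ?a) ^ n * (1 + ?b) ^ n) \<le> ?c * ((2 ^ n * (1 + ?a ^ n)) * (2 ^ n * (1 + ?b ^ n)))"
    by (intro mult_left_mono mult_mono power_one_plus_le) auto
  also have "\<dots> = (2 ^ n * 2 ^ n) * (?c + ?a ^ n * ?c + ?b ^ n * ?c + ?a ^ n * ?b ^ n * ?c)"
    by (simp add: algebra_simps)
  also have "(2::real) ^ n * 2 ^ n = 4 ^ n" by (simp flip: power_mult_distrib)
  also have "4 ^ n * (?c + ?a ^ n * ?c + ?b ^ n * ?c + ?a ^ n * ?b ^ n * ?c)
    \<le> 4 ^ n * (4 * \<eta> * measure lborel period_box)"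
  proof (rule mult_left_mono)
    have "?c \<le> \<eta> * measure lborel period_box" "?a ^ n * ?c \<le> \<eta> * measure lborel period_box"
      "?b ^ n * ?c \<le> \<eta> * measure lborel period_box" "?a ^ n * ?b ^ n * ?c \<le> \<eta> * measure lborel period_box"
      using *[of 0 0] *[of n 0] *[of 0 n] *[of n n] by simp_all
    then show "?c + ?a ^ n * ?c + ?b ^ n * ?c + ?a ^ n * ?b ^ n * ?c \<le> 4 * \<eta> * measure lborel period_box"
      by linarith
  qed simp
  finally show ?thesis .
qed

section \<open>Fourier inversion\<close>

lemma freq_simps [simp]: "freq 0 = 0" "freq (k + l) = freq k + freq l" "freq (- k) = - freq k" "freq (k - l) = freq k - freq l"
  by (auto simp: freq_def zero_prod_def plus_prod_def)

lemma period_box_area_pos: "0 < measure lborel period_box"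
  by (simp add: content_Pair)

lemma integral_cis_freq: "integral period_box (\<lambda>z. cis (freq k \<bullet> z)) = (if k = 0 then measure lborel period_box else 0)"
proof (cases "k = 0")
  case True
  then show ?thesis by (simp add: scaleR_conv_of_real)
next
  case False
  define v :: "real \<times> real" where "v = (if fst k \<noteq> 0 then (1,0) else (0,1))"
  have v: "v = (1,0) \<or> v = (0,1)" and nz: "freq k \<bullet> v \<noteq> 0"
    using False by (auto simp: v_def freq_def prod_eq_iff)
  let ?h = "\<lambda>z. cis (freq k \<bullet> z)"
  have C: "Ck_on 1 ?h UNIV" using cis_linear_Ck[of 1 1 "freq k"] by simp
  have per: "cis (of_int n * pi + t) = cis (- (of_int n * pi) + t)" for n t
  proof -
    have "cis (of_int n * pi + t) = cis (2 * pi * of_int n) * cis (- (of_int n * pi) + t)"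
      unfolding cis_mult by (rule arg_cong[of _ _ cis]) simp
    then show ?thesis by simp
  qed
  have p1: "?h (pi, y) = ?h (- pi, y)" for y
    using per[of "fst k" "of_int (snd k) * y"] by (simp add: freq_def)
  have p2: "?h (x, pi) = ?h (x, - pi)" for x
    using per[of "snd k" "of_int (fst k) * x"] by (simp add: freq_def add.commute)
  have "integral period_box (dird v ?h) = 0"
    using v integral_dird_1_eq_0[OF C p1] integral_dird_2_eq_0[OF C p2] by (elim disjE) simp_all
  moreover have "dird v ?h = (\<lambda>z. (\<i> * (freq k \<bullet> v)) * ?h z)"
    by (intro ext) (simp add: frechet_derivative_at[OF cis_linear_has_derivative, symmetric] scaleR_conv_of_real)
  ultimately have "(\<i> * (freq k \<bullet> v)) * integral period_box ?h = 0"
    by (simp only: Henstock_Kurzweil_Integration.integral_mult_right)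
  then show ?thesis using nz False by simp
qed

text \<open>These functions form a module over the trigonometric polynomials. Fourier inversion amounts to the statement that they vanish on the period box, and the module structure is what the density argument uses.\<close>

definition vanishing_coefs :: "(real \<times> real \<Rightarrow> complex) \<Rightarrow> bool" where
  "vanishing_coefs h \<longleftrightarrow> continuous_on UNIV h \<and> (\<forall>k. fcoef h k = 0)"

lemma fcoef_add:
  assumes "continuous_on UNIV f" "continuous_on UNIV g"
  shows "fcoef (\<lambda>z. f z + g z) k = fcoef f k + fcoef g k"
proof -
  have "(\<lambda>z. f z * cis (- (freq k \<bullet> z))) integrable_on period_box"
    "(\<lambda>z. g z * cis (- (freq k \<bullet> z))) integrable_on period_box"
    by (intro integrable_on_period_box continuous_intros assms)+
  then show ?thesis
    unfolding fcoef_def distrib_right by (rule Henstock_Kurzweil_Integration.integral_add)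
qed

lemma fcoef_cmult: "fcoef (\<lambda>z. c * f z) k = c * fcoef f k"
  unfolding fcoef_def by (simp only: mult.assoc Henstock_Kurzweil_Integration.integral_mult_right)

lemma fcoef_shift: "fcoef (\<lambda>z. f z * cis (freq l \<bullet> z)) k = fcoef f (k - l)"
proof -
  have "f z * cis (freq l \<bullet> z) * cis (- (freq k \<bullet> z)) = f z * cis (- (freq (k - l) \<bullet> z))" for z
    by (simp add: mult.assoc cis_mult inner_diff_left)
  then show ?thesis unfolding fcoef_def by (simp only:)
qed

lemma vanishing_coefs_add: "vanishing_coefs f \<Longrightarrow> vanishing_coefs g \<Longrightarrow> vanishing_coefs (\<lambda>z. f z + g z)"
  by (auto simp: vanishing_coefs_def fcoef_add intro!: continuous_intros)

lemma vanishing_coefs_cmult: "vanishing_coefs f \<Longrightarrow> vanishing_coefs (\<lambda>z. c * f z)"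
  by (auto simp: vanishing_coefs_def fcoef_cmult intro!: continuous_intros)

lemma vanishing_coefs_shift: "vanishing_coefs f \<Longrightarrow> vanishing_coefs (\<lambda>z. f z * cis (freq l \<bullet> z))"
  unfolding vanishing_coefs_def
  by (intro conjI allI continuous_intros) (simp_all only: fcoef_shift simp_thms)

lemma vanishing_coefs_integral: "vanishing_coefs h \<Longrightarrow> integral period_box h = 0"
  using fcoef_def[of h 0] by (simp del: split_paired_All add: vanishing_coefs_def)

definition torus_point :: "real \<times> real \<Rightarrow> complex \<times> complex" where
  "torus_point z = (cis (fst z), cis (snd z))"

text \<open>A polynomial in \<open>cos\<close> and \<open>sin\<close> of the two variables is built from exponentials, and multiplication by an exponential shifts the Fourier coefficients. The induction follows the construction of polynomial functions.\<close>

lemma vanishing_coefs_polynomial: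
  assumes "real_polynomial_function p" "vanishing_coefs h"
  shows "vanishing_coefs (\<lambda>z. h z * of_real (p (torus_point z)))"
  using assms
proof (induction p arbitrary: h rule: real_polynomial_function.induct)
  case (linear p)
  let ?e = "\<lambda>a b z. cis (freq (a, b) \<bullet> z)"
  have lin: "linear p" using linear by (simp add: bounded_linear.linear)
  have "h z * of_real (p (torus_point z)) = of_real (p (1,0)) / 2 * (h z * ?e 1 0 z) + of_real (p (1,0)) / 2 * (h z * ?e (-1) 0 z)
    + (- (\<i> / 2) * of_real (p (\<i>,0))) * (h z * ?e 1 0 z) + (\<i> / 2 * of_real (p (\<i>,0))) * (h z * ?e (-1) 0 z)
    + of_real (p (0,1)) / 2 * (h z * ?e 0 1 z) + of_real (p (0,1)) / 2 * (h z * ?e 0 (-1) z)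
    + (- (\<i> / 2) * of_real (p (0,\<i>))) * (h z * ?e 0 1 z) + (\<i> / 2 * of_real (p (0,\<i>))) * (h z * ?e 0 (-1) z)" for z
  proof -
    obtain x y where z: "z = (x, y)" by (cases z)
    have dec: "torus_point z = cos x *\<^sub>R (1,0) + sin x *\<^sub>R (\<i>,0) + cos y *\<^sub>R (0,1) + sin y *\<^sub>R (0,\<i>)"
      by (simp add: torus_point_def z complex_eq_iff)
    have "p (torus_point z) = cos x * p (1,0) + sin x * p (\<i>,0) + cos y * p (0,1) + sin y * p (0,\<i>)"
      unfolding dec by (simp only: linear_add[OF lin] linear_cmul[OF lin] real_scaleR_def)
    then show ?thesis
      by (simp add: z freq_def complex_eq_iff field_simps)
  qed
  then show ?case
    by (simp only:) (intro vanishing_coefs_add vanishing_coefs_cmult vanishing_coefs_shift linear)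
next
  case (const c)
  then show ?case using vanishing_coefs_cmult[of h "of_real c"] by (simp add: mult.commute)
next
  case (add f g)
  then show ?case
    using vanishing_coefs_add[of "\<lambda>z. h z * of_real (f (torus_point z))" "\<lambda>z. h z * of_real (g (torus_point z))"]
    by (simp add: algebra_simps)
next
  case (mult f g)
  have "vanishing_coefs (\<lambda>z. (h z * of_real (f (torus_point z))) * of_real (g (torus_point z)))"
    by (intro mult.IH mult.prems)
  then show ?case by (simp add: mult.assoc)
qed

text \<open>The Stone-Weierstrass theorem on the product of two unit circles. A function with support near the origin of the period box is continuous on the torus, since it vanishes near the cut of \<open>Arg\<close>.\<close>

lemma approximation_on_torus:
  fixes b :: "real \<times> real \<Rightarrow> complex"
  assumes cont: "continuous_on UNIV b" and supp: "\<And>z. 3/2 < norm z \<Longrightarrow> b z = 0" and e: "0 < \<epsilon>"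
  shows "\<exists>G. continuous_on UNIV G \<and> (\<forall>z\<in>period_box. norm (b z - G z) < \<epsilon>)
    \<and> (\<forall>h. vanishing_coefs h \<longrightarrow> vanishing_coefs (\<lambda>z. h z * G z))"
proof -
  let ?S = "sphere 0 1 \<times> sphere 0 1 :: (complex \<times> complex) set"
  \<comment> \<open>The function transported to the torus. \<open>Arg\<close> is discontinuous on the negative real axis only, where \<open>B\<close> is zero.\<close>
  define B where "B = (\<lambda>(z, w). b (Arg z, Arg w))"
  have out: "b (s, t) = 0" if "pi / 2 \<le> \<bar>s\<bar> \<or> pi / 2 \<le> \<bar>t\<bar>" for s t
  proof (rule supp)
    have "3/2 < pi/2" using pi_gt3 by simp
    then show "3/2 < norm (s, t)"
      using that norm_fst_le[of s t] norm_snd_le[of t s] by auto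
  qed
  have "continuous_on ?S B"
  proof (rule continuous_at_imp_continuous_on, rule ballI)
    fix p assume p: "p \<in> ?S"
    obtain z w where zw: "p = (z, w)" by (cases p)
    show "isCont B p"
    proof (cases "Re z < 0 \<or> Re w < 0")
      case True
      let ?U = "{p :: complex \<times> complex. Re (fst p) < 0} \<union> {p. Re (snd p) < 0}"
      have U: "open ?U" by (intro open_Un open_Collect_less continuous_intros)
      have Arg_ge: "pi / 2 \<le> \<bar>Arg u\<bar>" if "Re u < 0" for u
        using that Arg_Re_nonneg[of u] Arg_Re_pos[of u] by linarith
      have "B q = 0" if "q \<in> ?U" for q
        using that Arg_ge out by (auto simp: B_def split: prod.splits)
      then have "continuous_on ?U B \<longleftrightarrow> continuous_on ?U (\<lambda>_. 0 :: complex)"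
        by (intro continuous_on_cong) auto
      then have "\<forall>q\<in>?U. isCont B q"
        using continuous_on_eq_continuous_at[OF U, of B] by simp
      moreover have "p \<in> ?U" using True zw by auto
      ultimately show ?thesis by blast
    next
      case False
      have nr: "u \<notin> \<real>\<^sub>\<le>\<^sub>0" if "\<not> Re u < 0" "norm u = 1" for u
        using that by (auto simp: complex_nonpos_Reals_iff cmod_def)
      have "fst p \<notin> \<real>\<^sub>\<le>\<^sub>0" "snd p \<notin> \<real>\<^sub>\<le>\<^sub>0"
        using False p zw nr[of z] nr[of w] by simp_all
      then have "isCont (\<lambda>q. (Arg (fst q), Arg (snd q))) p"
        by (intro continuous_Pair isCont_o2[OF _ continuous_at_Arg] continuous_fst continuous_snd continuous_ident)
      moreover have "isCont b (Arg (fst p), Arg (snd p))"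
        using cont by (simp add: continuous_on_eq_continuous_at)
      ultimately show ?thesis
        unfolding B_def case_prod_unfold by (rule isCont_o2)
    qed
  qed
  moreover have "compact ?S" by (intro compact_Times compact_sphere)
  ultimately obtain g where g: "polynomial_function g" "\<And>q. q \<in> ?S \<Longrightarrow> norm (B q - g q) < \<epsilon>"
    using Stone_Weierstrass_polynomial_function[of ?S B \<epsilon>] e by blast
  have gr: "real_polynomial_function (\<lambda>q. Re (g q))" "real_polynomial_function (\<lambda>q. Im (g q))"
    using g(1) unfolding polynomial_function_def by (auto simp: o_def bounded_linear_Re bounded_linear_Im)
  show ?thesis
  proof (intro exI conjI ballI allI impI)
    let ?G = "\<lambda>z. g (torus_point z)"
    have "continuous_on UNIV g" using g(1) continuous_on_polymonial_function by blast
    then show "continuous_on UNIV ?G"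
      by (rule continuous_on_compose2) (auto simp: torus_point_def intro!: continuous_intros)
    fix z :: "real \<times> real" assume z: "z \<in> period_box"
    \<comment> \<open>The principal value of the argument excludes \<open>- pi\<close>, which is replaced by \<open>pi\<close>; both lie outside the support.\<close>
    have reduce: "\<exists>s. s \<in> {-pi<..pi} \<and> cis s = cis t \<and> (s = t \<or> pi / 2 \<le> \<bar>s\<bar> \<and> pi / 2 \<le> \<bar>t\<bar>)"
      if "-pi \<le> t" "t \<le> pi" for t
    proof (cases "t = - pi")
      case True
      then show ?thesis by (intro exI[of _ pi]) (auto simp: complex_eq_iff)
    next
      case False
      then show ?thesis using that by (intro exI[of _ t]) auto
    qed
    obtain x y where xy: "z = (x, y)" by (cases z)
    obtain s t where st: "s \<in> {-pi<..pi}" "cis s = cis x" "s = x \<or> pi / 2 \<le> \<bar>s\<bar> \<and> pi / 2 \<le> \<bar>x\<bar>"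
      "t \<in> {-pi<..pi}" "cis t = cis y" "t = y \<or> pi / 2 \<le> \<bar>t\<bar> \<and> pi / 2 \<le> \<bar>y\<bar>"
      using reduce[of x] reduce[of y] z xy by (auto simp: cbox_Pair_eq)
    have "B (torus_point z) = b (s, t)"
      using Arg_cis[OF st(1)] Arg_cis[OF st(4)] st(2,5) by (simp add: B_def torus_point_def xy)
    also have "\<dots> = b z" using st(3,6) out xy by metis
    finally show "norm (b z - g (torus_point z)) < \<epsilon>"
      using g(2)[of "torus_point z"] by (simp add: torus_point_def)
  next
    fix h assume h: "vanishing_coefs h"
    have "vanishing_coefs (\<lambda>z. h z * of_real (Re (g (torus_point z))) + \<i> * (h z * of_real (Im (g (torus_point z)))))"
      using vanishing_coefs_polynomial[OF gr(1) h] vanishing_coefs_polynomial[OF gr(2) h]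
      by (intro vanishing_coefs_add vanishing_coefs_cmult)
    moreover have "h z * of_real (Re w) + \<i> * (h z * of_real (Im w)) = h z * w" for z w
      by (simp add: complex_eq_iff algebra_simps)
    ultimately show "vanishing_coefs (\<lambda>z. h z * g (torus_point z))" by simp
  qed
qed

lemma trig_partial_sums:
  assumes "(\<lambda>k. norm (c k)) summable_on UNIV" "0 < \<epsilon>"
  shows "\<exists>A0. finite A0 \<and> (\<forall>A z. finite A \<longrightarrow> A0 \<subseteq> A \<longrightarrow>
    norm (trig_series c \<kappa> UNIV z - (\<Sum>k\<in>A. c k * cis (\<kappa> k \<bullet> z))) \<le> \<epsilon>)"
proof -
  define S where "S = (\<Sum>\<^sub>\<infinity>k. norm (c k))"
  have S: "((\<lambda>k. norm (c k)) has_sum S) UNIV" unfolding S_def using assms(1) by (rule has_sum_infsum)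
  obtain A0 where A0: "finite A0" "dist (\<Sum>k\<in>A0. norm (c k)) S \<le> \<epsilon>"
    using infsum_finite_approximation[OF assms] unfolding S_def by blast
  have "norm (trig_series c \<kappa> UNIV z - (\<Sum>k\<in>A. c k * cis (\<kappa> k \<bullet> z))) \<le> \<epsilon>"
    if A: "finite A" "A0 \<subseteq> A" for A z
  proof -
    have "((\<lambda>k. c k * cis (\<kappa> k \<bullet> z)) has_sum (trig_series c \<kappa> UNIV z - (\<Sum>k\<in>A. c k * cis (\<kappa> k \<bullet> z)))) (UNIV - A)"
      by (intro has_sum_Diff trig_has_sum[OF assms(1)] has_sum_finite A) simp
    moreover have "((\<lambda>k. norm (c k)) has_sum (S - (\<Sum>k\<in>A. norm (c k)))) (UNIV - A)"
      by (intro has_sum_Diff S has_sum_finite A) simp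
    ultimately have "norm (trig_series c \<kappa> UNIV z - (\<Sum>k\<in>A. c k * cis (\<kappa> k \<bullet> z))) \<le> S - (\<Sum>k\<in>A. norm (c k))"
      by (rule norm_infsum_le) (simp add: norm_mult)
    also have "(\<Sum>k\<in>A0. norm (c k)) \<le> (\<Sum>k\<in>A. norm (c k))" using A by (intro sum_mono2) auto
    then have "S - (\<Sum>k\<in>A. norm (c k)) \<le> \<epsilon>" using A0(2) by (auto simp: dist_real_def)
    finally show ?thesis .
  qed
  then show ?thesis using A0(1) by blast
qed

lemma fcoef_trig_polynomial:
  assumes "finite A"
  shows "fcoef (\<lambda>z. \<Sum>k\<in>A. c k * cis (freq k \<bullet> z)) l = (if l \<in> A then c l * measure lborel period_box else 0)"
  using assms
proof (induction A)
  case empty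
  then show ?case by (simp add: fcoef_def)
next
  case (insert k A)
  have "fcoef (\<lambda>z. 1 * cis (freq k \<bullet> z)) l = (if l = k then measure lborel period_box else 0)"
  proof -
    have "(\<lambda>z. 1 * cis (- (freq (l - k) \<bullet> z))) = (\<lambda>z. cis (freq (k - l) \<bullet> z))"
      by (simp add: inner_diff_left)
    then show ?thesis
      unfolding fcoef_shift fcoef_def by (simp only: integral_cis_freq) auto
  qed
  then have "fcoef (\<lambda>z. c k * cis (freq k \<bullet> z)) l = (if l = k then c k * measure lborel period_box else 0)"
    using fcoef_cmult[of "c k" "\<lambda>z. cis (freq k \<bullet> z)"] by simp
  moreover have "fcoef (\<lambda>z. c k * cis (freq k \<bullet> z) + (\<Sum>k\<in>A. c k * cis (freq k \<bullet> z))) l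
     = fcoef (\<lambda>z. c k * cis (freq k \<bullet> z)) l + fcoef (\<lambda>z. \<Sum>k\<in>A. c k * cis (freq k \<bullet> z)) l"
    by (intro fcoef_add continuous_intros)
  ultimately show ?case using insert by auto
qed

lemma norm_fcoef_le:
  assumes "continuous_on UNIV f" "\<And>z. z \<in> period_box \<Longrightarrow> norm (f z) \<le> B"
  shows "norm (fcoef f k) \<le> B * measure lborel period_box"
  unfolding fcoef_def
  by (rule integral_period_box_norm_le) (auto intro!: continuous_intros assms simp: norm_mult)

lemma vanishing_coefs_cnj_trig_polynomial:
  assumes "finite A" "vanishing_coefs h"
  shows "vanishing_coefs (\<lambda>z. h z * cnj (\<Sum>k\<in>A. c k * cis (freq k \<bullet> z)))"
  using assms(1)
proof (induction A)
  case empty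
  then show ?case by (simp add: vanishing_coefs_def fcoef_def)
next
  case (insert k A)
  have "h z * cnj (\<Sum>k\<in>insert k A. c k * cis (freq k \<bullet> z))
    = cnj (c k) * (h z * cis (freq (- k) \<bullet> z)) + h z * cnj (\<Sum>k\<in>A. c k * cis (freq k \<bullet> z))" for z
    using insert by (simp add: cis_cnj algebra_simps)
  then show ?case
    by (simp only:) (intro vanishing_coefs_add vanishing_coefs_cmult vanishing_coefs_shift assms insert.IH)
qed

text \<open>The difference \<open>h\<close> of the function and its Fourier series has vanishing coefficients, so it is orthogonal to every trigonometric polynomial. As \<open>cnj h\<close> is a uniform limit of functions to which \<open>h\<close> is orthogonal, the integral of \<open>\<bar>h\<bar>\<^sup>2\<close> is zero.\<close>

lemma fourier_inversion:
  assumes cont: "continuous_on UNIV b" and supp: "\<And>z. 3/2 < norm z \<Longrightarrow> b z = 0"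
    and sum: "(\<lambda>k. norm (fcoef b k) * (1 + norm (freq k)) ^ 2) summable_on UNIV"
    and z: "z \<in> period_box"
  shows "b z = trig_series (\<lambda>k. fcoef b k / measure lborel period_box) freq UNIV z"
proof -
  let ?V = "measure lborel period_box"
  define c where "c = (\<lambda>k. fcoef b k / ?V)"
  define s where "s = trig_series c freq UNIV"
  define h where "h z = b z + (- 1) * s z" for z
  have cs2: "(\<lambda>k. norm (c k) * (1 + norm (freq k)) ^ (0 + 2)) summable_on UNIV"
  proof -
    have "norm (c k) * (1 + norm (freq k)) ^ (0 + 2) = norm (fcoef b k) * (1 + norm (freq k)) ^ 2 * inverse ?V" for k
      using period_box_area_pos by (simp add: c_def norm_divide power2_eq_square field_simps)
    then show ?thesis using summable_on_cmult_left[OF sum, of "inverse ?V"] by (simp only:)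
  qed
  have cs: "(\<lambda>k. norm (c k)) summable_on UNIV"
    using weight_summable_mono[OF cs2, of 0] by simp
  have s: "continuous_on UNIV s"
    using trig_series_Ck[OF cs2] by (simp add: s_def)
  have hc: "continuous_on UNIV h" unfolding h_def by (intro continuous_intros cont s)
  have "fcoef h l = 0" for l
  proof -
    have "norm (fcoef h l) \<le> e" if "e > 0" for e
    proof -
      obtain A0 where A0: "finite A0" "\<And>A z. finite A \<Longrightarrow> A0 \<subseteq> A \<Longrightarrow>
          norm (s z - (\<Sum>k\<in>A. c k * cis (freq k \<bullet> z))) \<le> e / ?V"
        using trig_partial_sums[OF cs, of "e / ?V" freq] \<open>e > 0\<close> period_box_area_pos unfolding s_def by auto
      define A where "A = insert l A0"
      let ?p = "\<lambda>z. \<Sum>k\<in>A. c k * cis (freq k \<bullet> z)"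
      have p: "continuous_on UNIV ?p" by (intro continuous_intros)
      have "fcoef ?p l = fcoef b l"
        using fcoef_trig_polynomial[of A c l] A0(1) period_box_area_pos by (simp add: A_def c_def)
      then have "fcoef (\<lambda>z. (s z + (-1) * ?p z)) l = fcoef s l - fcoef b l"
        using fcoef_add[of s "\<lambda>z. (-1) * ?p z"] s p fcoef_cmult[of "-1" ?p] by (simp add: continuous_intros)
      moreover have "norm (fcoef (\<lambda>z. (s z + (-1) * ?p z)) l) \<le> e / ?V * ?V"
      proof (rule norm_fcoef_le)
        show "norm (s z + (-1) * ?p z) \<le> e / ?V" for z
          using A0(2)[of A z] A0(1) by (simp add: A_def subset_insertI)
      qed (intro continuous_intros s)
      moreover have "fcoef h l = fcoef b l - fcoef s l"
        unfolding h_def using fcoef_add[of b "\<lambda>z. (-1) * s z"] cont s fcoef_cmult[of "-1" s]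
        by (simp add: continuous_intros)
      ultimately show ?thesis using period_box_area_pos by (simp add: norm_minus_commute)
    qed
    then have "norm (fcoef h l) \<le> 0" by (rule field_le_epsilon[of _ 0, simplified])
    then show ?thesis by simp
  qed
  then have h: "vanishing_coefs h" using hc by (simp add: vanishing_coefs_def)
  have "compact (h ` period_box)"
    by (intro compact_continuous_image continuous_on_subset[OF hc] compact_cbox) auto
  then obtain M where M: "\<And>z. z \<in> period_box \<Longrightarrow> norm (h z) \<le> M"
    using compact_imp_bounded bounded_iff by (metis image_eqI)
  have "norm (h z) \<le> max M 1" if "z \<in> period_box" for z using M[OF that] by simp
  then obtain M where M: "\<And>z. z \<in> period_box \<Longrightarrow> norm (h z) \<le> M" "M > 0"
    by (meson less_max_iff_disj zero_less_one)
  have "norm (integral period_box (\<lambda>z. h z * cnj (h z))) \<le> e" if "e > 0" for e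
  proof -
    define d where "d = e / (2 * M * ?V)"
    have d: "d > 0" using that M(2) period_box_area_pos by (simp add: d_def)
    have "continuous_on UNIV (\<lambda>z. cnj (b z))" by (intro continuous_intros cont)
    then obtain G where G: "continuous_on UNIV G" "\<And>z. z \<in> period_box \<Longrightarrow> norm (cnj (b z) - G z) < d"
      "\<And>h. vanishing_coefs h \<Longrightarrow> vanishing_coefs (\<lambda>z. h z * G z)"
      using approximation_on_torus[of "\<lambda>z. cnj (b z)" d] supp d by auto
    obtain A where A: "finite A" "\<And>z. norm (s z - (\<Sum>k\<in>A. c k * cis (freq k \<bullet> z))) \<le> d"
      using trig_partial_sums[OF cs d, of freq] unfolding s_def by blast
    let ?p = "\<lambda>z. \<Sum>k\<in>A. c k * cis (freq k \<bullet> z)"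
    let ?P = "\<lambda>z. G z + (-1) * cnj (?p z)"
    have P: "continuous_on UNIV ?P" by (intro continuous_intros G)
    have "vanishing_coefs (\<lambda>z. h z * G z + (-1) * (h z * cnj (?p z)))"
      by (intro vanishing_coefs_add vanishing_coefs_cmult vanishing_coefs_cnj_trig_polynomial G A h)
    then have v: "integral period_box (\<lambda>z. h z * ?P z) = 0"
      using vanishing_coefs_integral by (simp add: algebra_simps)
    have "integral period_box (\<lambda>z. h z * (cnj (h z) - ?P z)) = integral period_box (\<lambda>z. h z * cnj (h z)) - integral period_box (\<lambda>z. h z * ?P z)"
      unfolding right_diff_distrib
      by (rule Henstock_Kurzweil_Integration.integral_diff; intro integrable_on_period_box continuous_intros hc P)
    then have "integral period_box (\<lambda>z. h z * cnj (h z)) = integral period_box (\<lambda>z. h z * (cnj (h z) - ?P z))"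
      using v by simp
    also have "norm \<dots> \<le> (M * (2 * d)) * ?V"
    proof (rule integral_period_box_norm_le)
      fix z assume z: "z \<in> period_box"
      have "cnj (h z) - ?P z = (cnj (b z) - G z) - cnj (s z - ?p z)" by (simp add: h_def)
      also have "norm \<dots> \<le> norm (cnj (b z) - G z) + norm (cnj (s z - ?p z))" by (rule norm_triangle_ineq4)
      also have "\<dots> \<le> 2 * d" using G(2)[OF z] A(2)[of z] by (simp only: complex_mod_cnj)
      finally show "norm (h z * (cnj (h z) - ?P z)) \<le> M * (2 * d)"
        unfolding norm_mult by (intro mult_mono M z) (use M(2) in auto)
    qed (intro continuous_intros hc P)
    also have "\<dots> = e" using M(2) period_box_area_pos by (simp add: d_def field_simps)
    finally show ?thesis .
  qed
  then have "norm (integral period_box (\<lambda>z. h z * cnj (h z))) \<le> 0" by (rule field_le_epsilon[of _ 0, simplified])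
  then have I0: "integral period_box (\<lambda>z. h z * cnj (h z)) = 0" by simp
  have "(\<lambda>z. h z * cnj (h z)) integrable_on period_box"
    by (intro integrable_on_period_box continuous_intros hc)
  from integral_linear[OF this bounded_linear_Re]
  have "integral period_box (\<lambda>z. (norm (h z))\<^sup>2) = 0"
    using I0 by (simp add: o_def cmod_power2 flip: power2_eq_square)
  moreover have "continuous_on period_box (\<lambda>z. (norm (h z))\<^sup>2)"
    by (intro continuous_intros continuous_on_subset[OF hc]) auto
  moreover have "box (-pi,-pi) (pi,pi) \<noteq> {}" by (auto simp: box_ne_empty Basis_prod_def)
  ultimately have "\<forall>z\<in>period_box. (norm (h z))\<^sup>2 = 0"
    using integral_cbox_eq_0_iff[of "(-pi,-pi)" "(pi,pi)" "\<lambda>z. (norm (h z))\<^sup>2"] zero_le_power2 by blast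
  then have "h z = 0" using z by auto
  then show ?thesis by (simp add: h_def s_def c_def)
qed

section \<open>Fourier expansions, cutoff functions and sums over words\<close>

lemma summable_inverse_square_int: "(\<lambda>k::int. 1 / (1 + \<bar>of_int k\<bar>) ^ 2 :: real) summable_on UNIV"
proof -
  let ?f = "\<lambda>k::int. 1 / (1 + \<bar>of_int k\<bar>) ^ 2 :: real"
  have "summable (\<lambda>n. 1 / (1 + real n) ^ 2)"
    using summable_Suc_iff[of "\<lambda>n. inverse (real n ^ 2)"] inverse_power_summable[of 2, where 'a=real]
    by (simp add: divide_inverse add.commute)
  then have 1: "(\<lambda>n. 1 / (1 + real n) ^ 2) summable_on UNIV"
    by (intro norm_summable_imp_summable_on) simp
  have 2: "?f summable_on range int"
    using 1 by (subst summable_on_reindex) (auto simp: o_def)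
  have 3: "?f summable_on range (\<lambda>n. - int n)"
    using 1 by (subst summable_on_reindex) (auto simp: o_def inj_on_def)
  have "UNIV = range int \<union> (range (\<lambda>n. - int n) - range int)"
    by (auto simp: image_iff) (metis int_cases2)
  then show ?thesis
    using summable_on_Un_disjoint[OF 2 summable_on_subset_banach[OF 3, of "range (\<lambda>n. - int n) - range int"]]
    by auto
qed

lemma summable_inverse_square_int_pairs:
  "(\<lambda>k. 1 / ((1 + \<bar>of_int (fst k)\<bar>) ^ 2 * (1 + \<bar>of_int (snd k)\<bar>) ^ 2) :: real) summable_on (UNIV :: (int \<times> int) set)"
proof -
  let ?g = "\<lambda>k::int. 1 / (1 + \<bar>of_int k\<bar>) ^ 2 :: real"
  have "(\<lambda>(a, b). ?g a * ?g b) summable_on (UNIV \<times> UNIV)"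
  proof (rule summable_on_SigmaI)
    fix a
    show "((\<lambda>b. case (a, b) of (a, b) \<Rightarrow> ?g a * ?g b) has_sum ?g a * infsum ?g UNIV) UNIV"
      using has_sum_cmult_right[OF has_sum_infsum[OF summable_inverse_square_int], of "?g a"] by simp
    show "(\<lambda>a. ?g a * infsum ?g UNIV) summable_on UNIV"
      by (rule summable_on_cmult_left[OF summable_inverse_square_int])
  qed auto
  then show ?thesis by (simp add: case_prod_unfold)
qed

lemma norm_freq_le: "1 + norm (freq k) \<le> (1 + \<bar>of_int (fst k)\<bar>) * (1 + \<bar>of_int (snd k)\<bar>)"
proof -
  have "norm (freq k) \<le> \<bar>of_int (fst k)\<bar> + \<bar>of_int (snd k)\<bar>"
    using norm_Pair_le[of "of_int (fst k) :: real" "of_int (snd k) :: real"] by (simp add: freq_def)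
  then have "1 + norm (freq k) \<le> 1 + \<bar>of_int (fst k)\<bar> + \<bar>of_int (snd k)\<bar> + \<bar>of_int (fst k)\<bar> * \<bar>of_int (snd k)\<bar>"
    using mult_nonneg_nonneg[OF abs_ge_zero abs_ge_zero, of "of_int (fst k) :: real" "of_int (snd k) :: real"]
    by linarith
  then show ?thesis by (simp add: algebra_simps)
qed

text \<open>The constant \<open>K\<close> is the same for all \<open>b\<close>, so small derivatives give a small series. Seven derivatives in each variable give a weight of order five, which is what a solution of class \<open>C\<^sup>3\<close> needs, and leave a factor with exponent two in each variable that is summable over the frequencies.\<close>

lemma fourier_expansion:
  obtains K :: real where "K > 0"
    "\<And>(b :: real \<times> real \<Rightarrow> complex) \<eta>. \<lbrakk>Ck_on 14 b UNIV; \<And>z. 3/2 < norm z \<Longrightarrow> b z = 0;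
        \<And>i j z. i \<in> {0, 7} \<Longrightarrow> j \<in> {0, 7} \<Longrightarrow> norm ((dird (0,1) ^^ j) ((dird (1,0) ^^ i) b) z) \<le> \<eta>\<rbrakk> \<Longrightarrow>
      \<exists>c q. ((\<lambda>k. norm (c k) * (1 + norm (freq k)) ^ 5) has_sum q) UNIV \<and> q \<le> K * \<eta> \<and>
        (\<forall>z\<in>period_box. b z = trig_series c freq UNIV z)"
proof -
  let ?V = "measure lborel period_box"
  let ?g = "\<lambda>k. 1 / ((1 + \<bar>of_int (fst k)\<bar>) ^ 2 * (1 + \<bar>of_int (snd k)\<bar>) ^ 2) :: real"
  define K0 where "K0 = infsum ?g (UNIV :: (int \<times> int) set)"
  have K0: "(?g has_sum K0) UNIV"
    unfolding K0_def using summable_inverse_square_int_pairs by (rule has_sum_infsum)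
  have "0 \<le> K0" using K0 by (rule has_sum_nonneg) simp
  show ?thesis
  proof (rule that)
    show "0 < 4 ^ 8 * K0 + 1" using \<open>0 \<le> K0\<close> by simp
    fix b :: "real \<times> real \<Rightarrow> complex" and \<eta> :: real
    assume C: "Ck_on 14 b UNIV" and supp: "\<And>z. 3/2 < norm z \<Longrightarrow> b z = 0"
      and bd: "\<And>i j z. i \<in> {0, 7} \<Longrightarrow> j \<in> {0, 7} \<Longrightarrow> norm ((dird (0,1) ^^ j) ((dird (1,0) ^^ i) b) z) \<le> \<eta>"
    define c where "c = (\<lambda>k. fcoef b k / ?V)"
    have "0 \<le> norm ((dird (0,1) ^^ 0) ((dird (1,0) ^^ 0) b) 0)" by simp
    also have "\<dots> \<le> \<eta>" by (rule bd) auto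
    finally have \<eta>: "0 \<le> \<eta>" .
    have dec: "norm (c k) * (1 + norm (freq k)) ^ 5 \<le> 4 ^ 8 * \<eta> * ?g k" for k
    proof -
      let ?a = "1 + \<bar>of_int (fst k)\<bar> :: real" and ?b = "1 + \<bar>of_int (snd k)\<bar> :: real"
      have pos: "?a > 0" "?b > 0" by auto
      have "Ck_on (7 + 7) b UNIV" using C by simp
      from fcoef_decay[OF this supp bd, of k]
      have "norm (fcoef b k) * (?a ^ 7 * ?b ^ 7) \<le> 4 ^ 7 * (4 * \<eta> * ?V)" by simp
      then have "norm (c k) * (?a ^ 7 * ?b ^ 7) \<le> 4 ^ 8 * \<eta>"
        using period_box_area_pos by (simp add: c_def norm_divide field_simps)
      moreover have "?a ^ 7 * ?b ^ 7 = (?a * ?b) ^ 5 * (?a ^ 2 * ?b ^ 2)"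
        by (simp add: power_mult_distrib mult_ac flip: power_add)
      ultimately have "norm (c k) * (?a * ?b) ^ 5 \<le> 4 ^ 8 * \<eta> * ?g k"
        using pos by (simp add: field_simps)
      moreover have "norm (c k) * (1 + norm (freq k)) ^ 5 \<le> norm (c k) * (?a * ?b) ^ 5"
        by (intro mult_left_mono power_mono norm_freq_le) auto
      ultimately show ?thesis by linarith
    qed
    have gs: "((\<lambda>k. 4 ^ 8 * \<eta> * ?g k) has_sum 4 ^ 8 * \<eta> * K0) UNIV"
      by (rule has_sum_cmult_right[OF K0])
    have cs: "(\<lambda>k. norm (c k) * (1 + norm (freq k)) ^ 5) summable_on UNIV"
      by (rule summable_on_comparison_test[OF has_sum_imp_summable[OF gs] dec]) simp
    define q where "q = (\<Sum>\<^sub>\<infinity>k. norm (c k) * (1 + norm (freq k)) ^ 5)"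
    have q: "((\<lambda>k. norm (c k) * (1 + norm (freq k)) ^ 5) has_sum q) UNIV"
      unfolding q_def using cs by (rule has_sum_infsum)
    have "q \<le> 4 ^ 8 * \<eta> * K0" by (rule has_sum_mono[OF q gs dec])
    then have "q \<le> (4 ^ 8 * K0 + 1) * \<eta>" using \<eta> by (simp add: algebra_simps)
    moreover have "b z = trig_series c freq UNIV z" if "z \<in> period_box" for z
      unfolding c_def
    proof (rule fourier_inversion[OF _ supp _ that])
      show "continuous_on UNIV b" using C by (rule Ck_on_continuous)
      have "norm (fcoef b k) * (1 + norm (freq k)) ^ 2 = norm (c k) * (1 + norm (freq k)) ^ 2 * ?V" for k
        using period_box_area_pos by (simp add: c_def norm_divide)
      then show "(\<lambda>k. norm (fcoef b k) * (1 + norm (freq k)) ^ 2) summable_on UNIV"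
        using summable_on_cmult_left[OF weight_summable_mono[OF cs, of 2], of ?V] by (simp only:)
    qed auto
    ultimately show "\<exists>c q. ((\<lambda>k. norm (c k) * (1 + norm (freq k)) ^ 5) has_sum q) UNIV \<and> q \<le> (4 ^ 8 * K0 + 1) * \<eta> \<and>
        (\<forall>z\<in>period_box. b z = trig_series c freq UNIV z)"
      using q by blast
  qed
qed

lemma truncated_power_Ck: "Ck_on n (\<lambda>t::real. max 0 t ^ Suc n) UNIV"
proof (induction n)
  case 0
  then show ?case by (auto intro!: continuous_intros)
next
  case (Suc n)
  have D: "((\<lambda>t::real. max 0 t ^ Suc (Suc n)) has_derivative (\<lambda>h. (real (Suc (Suc n)) * h) *\<^sub>R max 0 t ^ Suc n)) (at t)" for t
  proof (cases t "0::real" rule: linorder_cases)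
    case less
    have "((\<lambda>t::real. max 0 t ^ Suc (Suc n)) has_derivative (\<lambda>h. 0)) (at t)"
      by (rule has_derivative_transform_within_open[of "\<lambda>t. 0" _ t UNIV "{..<0}"]) (use less in auto)
    then show ?thesis using less by simp
  next
    case equal
    show ?thesis
      unfolding equal
    proof (rule has_derivativeI_sandwich[where e = 1 and H = "\<lambda>y. \<bar>y\<bar>"])
      fix y :: real assume y: "y \<noteq> 0" "dist y 0 < 1"
      have "max 0 y ^ Suc (Suc n) \<le> \<bar>y\<bar> ^ Suc (Suc n)" by (intro power_mono) auto
      also have "\<dots> \<le> \<bar>y\<bar> ^ 2" using y by (intro power_decreasing) auto
      finally show "norm (max 0 y ^ Suc (Suc n) - max 0 0 ^ Suc (Suc n) - (real (Suc (Suc n)) * (y - 0)) *\<^sub>R max 0 0 ^ Suc n) / norm (y - 0) \<le> \<bar>y\<bar>"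
        using y by (simp add: field_simps power2_eq_square)
    next
      show "((\<lambda>y::real. \<bar>y\<bar>) \<longlongrightarrow> 0) (at 0)" by (auto intro!: tendsto_eq_intros)
    qed auto
  next
    case greater
    have "((\<lambda>t::real. t ^ Suc (Suc n)) has_derivative (\<lambda>h. (real (Suc (Suc n)) * h) *\<^sub>R t ^ Suc n)) (at t)"
      by (rule has_derivative_eq_rhs[OF DERIV_pow[of "Suc (Suc n)", unfolded has_field_derivative_def]])
         (simp add: fun_eq_iff)
    then have "((\<lambda>t::real. max 0 t ^ Suc (Suc n)) has_derivative (\<lambda>h. (real (Suc (Suc n)) * h) *\<^sub>R t ^ Suc n)) (at t)"
      by (rule has_derivative_transform_within_open[of _ _ t UNIV "{0<..}"]) (use greater in auto)
    then show ?thesis using greater by simp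
  qed
  show ?case
    by (rule Ck_on_SucI[OF _ D]) (auto intro!: Ck_on_mult_real Ck_on_const Suc.IH[unfolded power_Suc] simp: mult.assoc)
qed

text \<open>Finite differentiability is enough, so truncated powers replace the usual smooth bump functions: the quotient \<open>A(2 - t) / (A(2 - t) + A(t - 1))\<close> at \<open>t = z \<bullet> z\<close> is \<open>1\<close> for \<open>t \<le> 1\<close> and \<open>0\<close> for \<open>t \<ge> 2\<close>.\<close>

lemma cutoff_exists:
  "\<exists>\<psi> :: 'a::euclidean_space \<Rightarrow> real. Ck_on n \<psi> UNIV \<and> (\<forall>z. norm z \<le> 1 \<longrightarrow> \<psi> z = 1) \<and> (\<forall>z. 2 < (norm z)\<^sup>2 \<longrightarrow> \<psi> z = 0)"
proof -
  let ?A = "\<lambda>t::real. max 0 t ^ Suc n"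
  let ?\<psi> = "\<lambda>z::'a. ?A (2 - z \<bullet> z) / (?A (2 - z \<bullet> z) + ?A (z \<bullet> z - 1))"
  have pos: "?A (2 - t) + ?A (t - 1) \<noteq> 0" for t
  proof -
    have "0 \<le> ?A (2 - t)" "0 \<le> ?A (t - 1)" by auto
    moreover have "0 < ?A (2 - t) \<or> 0 < ?A (t - 1)"
      by (cases "t < 2") (auto intro!: zero_less_power simp del: power_Suc)
    ultimately show ?thesis by linarith
  qed
  have i: "Ck_on n (\<lambda>z::'a. z \<bullet> z) UNIV" by (intro Ck_on_inner Ck_on_ident open_UNIV)
  have 1: "Ck_on n (\<lambda>z::'a. ?A (2 - z \<bullet> z)) UNIV" "Ck_on n (\<lambda>z::'a. ?A (z \<bullet> z - 1)) UNIV"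
    using Ck_on_compose[OF open_UNIV open_UNIV _ truncated_power_Ck Ck_on_diff[OF open_UNIV Ck_on_const[OF open_UNIV] i]]
      Ck_on_compose[OF open_UNIV open_UNIV _ truncated_power_Ck Ck_on_diff[OF open_UNIV i Ck_on_const[OF open_UNIV]]]
    by simp_all
  have "Ck_on n ?\<psi> UNIV" by (intro Ck_on_divide Ck_on_add 1 open_UNIV pos)
  moreover have "?\<psi> z = 1" if "norm z \<le> 1" for z
  proof -
    have "z \<bullet> z \<le> 1" using that by (simp add: dot_square_norm power_le_one)
    then have "?A (z \<bullet> z - 1) = 0" by simp
    then show ?thesis using pos[of "z \<bullet> z"] by simp
  qed
  moreover have "?\<psi> z = 0" if "2 < (norm z)\<^sup>2" for z
    using that by (simp add: dot_square_norm max_def)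
  ultimately show ?thesis by blast
qed

text \<open>The words of length \<open>n\<close> contribute \<open>q ^ n\<close>; this is the geometric series that makes the Neumann series converge.\<close>

lemma summable_prod_lists:
  fixes \<beta> :: "'k \<Rightarrow> real"
  assumes nn: "\<And>k. 0 \<le> \<beta> k" and q: "(\<beta> has_sum q) UNIV" "q < 1"
  shows "(\<lambda>w. prod_list (map \<beta> w)) summable_on UNIV" "(\<Sum>\<^sub>\<infinity>w. prod_list (map \<beta> w)) \<le> 1 / (1 - q)"
proof -
  let ?f = "\<lambda>w. prod_list (map \<beta> w)"
  have f0: "0 \<le> ?f w" for w by (induction w) (auto simp: nn)
  have words: "sum ?f {w. set w \<subseteq> A \<and> length w \<le> N} \<le> 1 / (1 - q)" if A: "finite A" for A N
  proof (induction N)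
    case 0
    have "{w. set w \<subseteq> A \<and> length w \<le> 0} = {[]}" by auto
    moreover have "0 \<le> q" using q(1) nn by (rule has_sum_nonneg)
    ultimately show ?case using q(2) by simp
  next
    case (Suc N)
    let ?W = "{w. set w \<subseteq> A \<and> length w \<le> N}"
    have "{w. set w \<subseteq> A \<and> length w \<le> Suc N} = insert [] ((\<lambda>(k, w). k # w) ` (A \<times> ?W))"
    proof (intro equalityI subsetI)
      fix w assume "w \<in> {w. set w \<subseteq> A \<and> length w \<le> Suc N}"
      then show "w \<in> insert [] ((\<lambda>(k, w). k # w) ` (A \<times> ?W))"
        by (cases w) auto
    qed auto
    moreover have "finite ?W" using A by (rule finite_lists_length_le)
    ultimately have "sum ?f {w. set w \<subseteq> A \<and> length w \<le> Suc N} = 1 + sum ?f ((\<lambda>(k, w). k # w) ` (A \<times> ?W))"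
      using A by (simp add: image_iff case_prod_unfold)
    also have "sum ?f ((\<lambda>(k, w). k # w) ` (A \<times> ?W)) = (\<Sum>(k, w)\<in>A \<times> ?W. \<beta> k * ?f w)"
      by (subst sum.reindex) (auto simp: inj_on_def o_def case_prod_unfold)
    also have "\<dots> = sum \<beta> A * sum ?f ?W"
      by (simp add: sum_product sum.cartesian_product)
    also have "1 + sum \<beta> A * sum ?f ?W \<le> 1 + q * (1 / (1 - q))"
      using finite_sum_le_has_sum[OF q(1), of A] A nn
      by (intro add_left_mono mult_mono Suc.IH) (auto intro!: sum_nonneg f0 has_sum_nonneg[OF q(1)])
    also have "\<dots> = 1 / (1 - q)" using q(2) by (simp add: field_simps)
    finally show ?case .
  qed
  have bd: "sum ?f F \<le> 1 / (1 - q)" if F: "finite F" for F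
  proof -
    have "sum ?f F \<le> sum ?f {w. set w \<subseteq> (\<Union>w\<in>F. set w) \<and> length w \<le> Max (length ` F)}"
      using F by (intro sum_mono2 finite_lists_length_le f0) auto
    also have "\<dots> \<le> 1 / (1 - q)" using F by (intro words) auto
    finally show ?thesis .
  qed
  show s: "?f summable_on UNIV"
    by (rule nonneg_bdd_above_summable_on) (use f0 bd in \<open>auto intro!: bdd_aboveI2\<close>)
  show "infsum ?f UNIV \<le> 1 / (1 - q)"
    by (rule infsum_le_finite_sums[OF s]) (use bd in auto)
qed

section \<open>The Beltrami equation\<close>

lemma one_plus_norm_add_le: "1 + norm (a + b) \<le> (1 + norm a) * (1 + norm b)"
proof -
  have "(1 + norm a) * (1 + norm b) = 1 + norm a + norm b + norm a * norm b" by (simp add: algebra_simps)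
  then show ?thesis
    using norm_triangle_ineq[of a b] mult_nonneg_nonneg[OF norm_ge_zero norm_ge_zero, of a b] by linarith
qed

text \<open>For a Fourier series with coefficients \<open>c\<close> and the Fourier multiplier \<open>M\<close>, the fixed point equation \<open>V = 1 + M(c V)\<close> is solved by the trigonometric series whose term at the word \<open>w\<close> has the coefficient \<open>word_coef M c w\<close> and the frequency \<open>sum_list w\<close>: prefixing the letter \<open>k\<close> multiplies by the \<open>k\<close>-th term of the series and applies \<open>M\<close> at the resulting frequency.\<close>

fun word_coef :: "(int \<times> int \<Rightarrow> complex) \<Rightarrow> (int \<times> int \<Rightarrow> complex) \<Rightarrow> (int \<times> int) list \<Rightarrow> complex" where
  "word_coef M c [] = 1"
| "word_coef M c (k # w) = M (k + sum_list w) * c k * word_coef M c w"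

lemma word_coef_bound:
  assumes M: "\<And>l. norm (M l) \<le> C"
  shows "norm (word_coef M c w) * (1 + norm (freq (sum_list w))) ^ n
    \<le> prod_list (map (\<lambda>k. C * (norm (c k) * (1 + norm (freq k)) ^ n)) w)"
proof (induction w)
  case (Cons k w)
  have C: "0 \<le> C" using M[of 0] norm_ge_zero order_trans by blast
  have "1 + norm (freq (k + sum_list w)) \<le> (1 + norm (freq k)) * (1 + norm (freq (sum_list w)))"
    unfolding freq_simps by (rule one_plus_norm_add_le)
  then have "(1 + norm (freq (k + sum_list w))) ^ n \<le> (1 + norm (freq k)) ^ n * (1 + norm (freq (sum_list w))) ^ n"
    unfolding power_mult_distrib[symmetric] by (intro power_mono) auto
  then have "norm (M (k + sum_list w)) * norm (c k) * norm (word_coef M c w) * (1 + norm (freq (k + sum_list w))) ^ n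
    \<le> C * norm (c k) * norm (word_coef M c w) * ((1 + norm (freq k)) ^ n * (1 + norm (freq (sum_list w))) ^ n)"
    by (intro mult_mono M) (auto simp: C)
  also have "\<dots> = (C * (norm (c k) * (1 + norm (freq k)) ^ n)) * (norm (word_coef M c w) * (1 + norm (freq (sum_list w))) ^ n)"
    by (simp add: mult_ac)
  also have "\<dots> \<le> (C * (norm (c k) * (1 + norm (freq k)) ^ n)) * prod_list (map (\<lambda>k. C * (norm (c k) * (1 + norm (freq k)) ^ n)) w)"
    by (intro mult_left_mono Cons.IH) (auto simp: C)
  finally show ?case by (simp add: norm_mult)
qed simp

text \<open>With \<open>\<beta> = \<tau> - \<tau>0\<close> periodic, let \<open>V = \<zeta>\<^sub>y\<close>. The compatibility condition \<open>V\<^sub>x = ((\<tau>0 + \<beta>) V)\<^sub>y\<close> reads, at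
frequency \<open>l \<noteq> 0\<close>, \<open>(l\<^sub>1 - \<tau>0 l\<^sub>2) V\<^sub>l = l\<^sub>2 (\<beta> V)\<^sub>l\<close>. The multiplier \<open>l\<^sub>2 / (l\<^sub>1 - \<tau>0 l\<^sub>2)\<close> is bounded by
\<open>1 / \<bar>Im \<tau>0\<bar>\<close>, so a small \<open>\<beta>\<close> makes the Neumann series for \<open>V\<close> converge, with \<open>\<bar>V - 1\<bar> < 1\<close>. A primitive
\<open>Z\<close> is then written down term by term; the terms of frequency \<open>0\<close> in \<open>\<beta> V\<close> integrate to a linear function.\<close>

lemma beltrami_on_torus:
  fixes \<tau>0 :: complex
  assumes im: "Im \<tau>0 \<noteq> 0"
    and cq: "((\<lambda>k. norm (c k) * (1 + norm (freq k)) ^ 5) has_sum q) UNIV" and small: "q / \<bar>Im \<tau>0\<bar> < 1/2"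
  shows "\<exists>Z. Ck_on 3 Z UNIV \<and> (\<forall>y. dird (0,1) Z y \<noteq> 0 \<and>
    dird (1,0) Z y = (\<tau>0 + trig_series c freq UNIV y) * dird (0,1) Z y)"
proof -
  \<comment> \<open>The symbol \<open>l\<^sub>1 - \<tau>0 l\<^sub>2\<close> of the constant coefficient operator and the multiplier of the fixed point equation.\<close>
  define den where "den l = of_int (fst l) - \<tau>0 * of_int (snd l)" for l :: "int \<times> int"
  define M where "M l = (if l = 0 then 0 else of_int (snd l) / den l)" for l
  define m where "m = min 1 \<bar>Im \<tau>0\<bar>"
  have m: "0 < m" using im by (simp add: m_def)
  have den1: "\<bar>of_int (snd l)\<bar> * \<bar>Im \<tau>0\<bar> \<le> norm (den l)" for l
    using abs_Im_le_cmod[of "den l"] by (simp add: den_def abs_mult mult.commute)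
  have den2: "m \<le> norm (den l)" if "l \<noteq> 0" for l
  proof (cases "snd l = 0")
    case True
    then have "fst l \<noteq> 0" using that by (simp add: prod_eq_iff)
    then have "1 \<le> \<bar>fst l\<bar>" by simp
    then have "1 \<le> \<bar>real_of_int (fst l)\<bar>" by linarith
    then show ?thesis using True by (simp add: den_def m_def)
  next
    case False
    then have "1 \<le> \<bar>snd l\<bar>" by simp
    then have "1 \<le> \<bar>real_of_int (snd l)\<bar>" by linarith
    then have "1 * \<bar>Im \<tau>0\<bar> \<le> \<bar>of_int (snd l)\<bar> * \<bar>Im \<tau>0\<bar>" by (intro mult_right_mono) auto
    then show ?thesis using den1[of l] by (simp add: m_def)
  qed
  have den0: "den l \<noteq> 0" if "l \<noteq> 0" for l using den2[OF that] m by auto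
  have M: "norm (M l) \<le> 1 / \<bar>Im \<tau>0\<bar>" for l
    using den1[of l] den0[of l] im by (auto simp: M_def norm_divide field_simps)
  define V where "V = word_coef M c"
  define \<beta> where "\<beta> k = 1 / \<bar>Im \<tau>0\<bar> * (norm (c k) * (1 + norm (freq k)) ^ 5)" for k
  define Q where "Q = q / \<bar>Im \<tau>0\<bar>"
  have \<beta>: "(\<beta> has_sum Q) UNIV" "\<And>k. 0 \<le> \<beta> k"
    using has_sum_cmult_right[OF cq, of "1 / \<bar>Im \<tau>0\<bar>"] by (auto simp: \<beta>_def[abs_def] Q_def)
  have Q12: "Q < 1/2" using small by (simp only: Q_def)
  then have Q: "Q < 1/2" "Q < 1" by linarith+
  have bV: "norm (V w) * (1 + norm (freq (sum_list w))) ^ 5 \<le> prod_list (map \<beta> w)" for w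
    unfolding V_def \<beta>_def[abs_def] by (rule word_coef_bound[OF M])
  note sp = summable_prod_lists[OF \<beta>(2) \<beta>(1) Q(2)]
  have W5: "(\<lambda>w. norm (V w) * (1 + norm (freq (sum_list w))) ^ 5) summable_on UNIV"
    by (rule summable_on_comparison_test[OF sp(1) bV]) auto
  have W0: "(\<lambda>w. norm (V w)) summable_on UNIV" using weight_summable_mono[OF W5, of 0] by simp
  have bV0: "norm (V w) \<le> prod_list (map \<beta> w)" for w
  proof -
    have "norm (V w) * 1 \<le> norm (V w) * (1 + norm (freq (sum_list w))) ^ 5"
      by (intro mult_left_mono one_le_power) auto
    then show ?thesis using bV[of w] by simp
  qed
  define S where "S = (\<Sum>\<^sub>\<infinity>w. norm (V w))"
  have S: "((\<lambda>w. norm (V w)) has_sum S) UNIV" unfolding S_def using W0 by (rule has_sum_infsum)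
  have "S \<le> 1 / (1 - Q)"
    using infsum_mono[OF W0 sp(1) bV0] sp(2) unfolding S_def by linarith
  also have "\<dots> < 2" using Q by (simp add: field_simps)
  finally have S2: "S < 2" .
  let ?K = "\<lambda>w. freq (sum_list w)"
  define v where "v = trig_series V ?K UNIV"
  have v: "((\<lambda>w. V w * cis (?K w \<bullet> y)) has_sum v y) UNIV" for y
    unfolding v_def by (rule trig_has_sum[OF W0])
  have v_nz: "v y \<noteq> 0" for y
  proof -
    have "((\<lambda>w. V w * cis (?K w \<bullet> y)) has_sum (v y - 1)) (UNIV - {[]})"
      using has_sum_Diff[OF v[of y] has_sum_finite[of "{[]}"]] by (simp add: V_def)
    moreover have "((\<lambda>w. norm (V w)) has_sum (S - 1)) (UNIV - {[]})"
      using has_sum_Diff[OF S has_sum_finite[of "{[]}"]] by (simp add: V_def)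
    ultimately have "norm (v y - 1) \<le> S - 1" by (rule norm_infsum_le) (simp add: norm_mult)
    then show ?thesis using S2 by auto
  qed
  \<comment> \<open>The product of the series with coefficients \<open>c\<close> and the solution \<open>v\<close>, indexed by pairs of a letter and a word.\<close>
  define d where "d p = c (fst p) * V (snd p)" for p :: "(int \<times> int) \<times> (int \<times> int) list"
  define \<Lambda> where "\<Lambda> p = fst p + sum_list (snd p)" for p :: "(int \<times> int) \<times> (int \<times> int) list"
  have c0: "(\<lambda>k. norm (c k)) summable_on UNIV"
    using weight_summable_mono[OF has_sum_imp_summable[OF cq], of 0] by simp
  have d5: "(\<lambda>p. norm (d p) * (1 + norm (freq (\<Lambda> p))) ^ 5) summable_on UNIV"
  proof -
    let ?a = "\<lambda>k. norm (c k) * (1 + norm (freq k)) ^ 5" and ?b = "\<lambda>w. norm (V w) * (1 + norm (?K w)) ^ 5"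
    have "(\<lambda>(k, w). ?a k * ?b w) summable_on (UNIV \<times> UNIV)"
    proof (rule summable_on_SigmaI)
      fix k
      show "((\<lambda>w. case (k, w) of (k, w) \<Rightarrow> ?a k * ?b w) has_sum ?a k * infsum ?b UNIV) UNIV"
        using has_sum_cmult_right[OF has_sum_infsum[OF W5], of "?a k"] by simp
      show "(\<lambda>k. ?a k * infsum ?b UNIV) summable_on UNIV"
        by (rule summable_on_cmult_left[OF has_sum_imp_summable[OF cq]])
    qed auto
    then have ab: "(\<lambda>(k, w). ?a k * ?b w) summable_on UNIV" by simp
    show ?thesis
    proof (rule summable_on_comparison_test[OF ab])
      fix p :: "(int \<times> int) \<times> (int \<times> int) list"
      obtain k w where p: "p = (k, w)" by (cases p)
      have "1 + norm (freq (k + sum_list w)) \<le> (1 + norm (freq k)) * (1 + norm (?K w))"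
        unfolding freq_simps by (rule one_plus_norm_add_le)
      then have "(1 + norm (freq (k + sum_list w))) ^ 5 \<le> (1 + norm (freq k)) ^ 5 * (1 + norm (?K w)) ^ 5"
        unfolding power_mult_distrib[symmetric] by (intro power_mono) auto
      then have "norm (c k) * norm (V w) * (1 + norm (freq (k + sum_list w))) ^ 5
        \<le> norm (c k) * norm (V w) * ((1 + norm (freq k)) ^ 5 * (1 + norm (?K w)) ^ 5)"
        by (intro mult_left_mono) auto
      then show "norm (d p) * (1 + norm (freq (\<Lambda> p))) ^ 5 \<le> (case p of (k, w) \<Rightarrow> ?a k * ?b w)"
        by (simp add: p d_def \<Lambda>_def norm_mult mult_ac)
    qed auto
  qed
  have d0: "(\<lambda>p. norm (d p)) summable_on UNIV" using weight_summable_mono[OF d5, of 0] by simp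
  let ?L = "\<lambda>p. freq (\<Lambda> p)"
  have dS: "((\<lambda>p. d p * cis (?L p \<bullet> y)) has_sum trig_series d ?L UNIV y) UNIV" for y
    by (rule trig_has_sum[OF d0])
  have prod: "trig_series c freq UNIV y * v y = trig_series d ?L UNIV y" for y
  proof -
    have s: "(\<lambda>(k, w). c k * cis (freq k \<bullet> y) * (V w * cis (?K w \<bullet> y))) summable_on (UNIV \<times> UNIV)"
      and e: "infsum (\<lambda>(k, w). c k * cis (freq k \<bullet> y) * (V w * cis (?K w \<bullet> y))) (UNIV \<times> UNIV) = trig_series d ?L UNIV y"
    proof -
      have eq: "(\<lambda>(k, w). c k * cis (freq k \<bullet> y) * (V w * cis (?K w \<bullet> y))) = (\<lambda>p. d p * cis (?L p \<bullet> y))"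
        by (simp add: fun_eq_iff d_def \<Lambda>_def inner_add_left mult_ac flip: cis_mult)
      show "(\<lambda>(k, w). c k * cis (freq k \<bullet> y) * (V w * cis (?K w \<bullet> y))) summable_on (UNIV \<times> UNIV)"
        unfolding eq using has_sum_imp_summable[OF dS[of y]] by simp
      show "infsum (\<lambda>(k, w). c k * cis (freq k \<bullet> y) * (V w * cis (?K w \<bullet> y))) (UNIV \<times> UNIV) = trig_series d ?L UNIV y"
        unfolding eq by (simp add: trig_series_def)
    qed
    have "infsum (\<lambda>k. infsum (\<lambda>w. c k * cis (freq k \<bullet> y) * (V w * cis (?K w \<bullet> y))) UNIV) UNIV = trig_series d ?L UNIV y"
      using infsum_Sigma_banach[OF s] e by simp
    moreover have "infsum (\<lambda>w. c k * cis (freq k \<bullet> y) * (V w * cis (?K w \<bullet> y))) UNIV = c k * cis (freq k \<bullet> y) * v y" for k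
      by (simp add: infsum_cmult_right' v_def trig_series_def)
    ultimately show ?thesis
      by (simp add: infsum_cmult_left' trig_series_def)
  qed
  have Md0: "(\<lambda>p. norm (M (\<Lambda> p) * d p)) summable_on UNIV"
  proof (rule summable_on_comparison_test)
    show "(\<lambda>p. 1 / \<bar>Im \<tau>0\<bar> * norm (d p)) summable_on UNIV" by (rule summable_on_cmult_right[OF d0])
    show "norm (M (\<Lambda> p) * d p) \<le> 1 / \<bar>Im \<tau>0\<bar> * norm (d p)" for p
      unfolding norm_mult by (intro mult_right_mono M) auto
  qed auto
  \<comment> \<open>Every non-empty word is a letter followed by a word, so the series for \<open>v\<close> satisfies the fixed point equation.\<close>
  have split: "v y = 1 + trig_series (\<lambda>p. M (\<Lambda> p) * d p) ?L UNIV y" for y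
  proof -
    have "((\<lambda>w. V w * cis (?K w \<bullet> y)) has_sum (v y - 1)) (UNIV - {[]})"
      using has_sum_Diff[OF v[of y] has_sum_finite[of "{[]}"]] by (simp add: V_def)
    moreover have "UNIV - {[]} = range (\<lambda>p :: (int \<times> int) \<times> (int \<times> int) list. fst p # snd p)"
    proof (intro equalityI subsetI)
      fix w :: "(int \<times> int) list" assume "w \<in> UNIV - {[]}"
      then show "w \<in> range (\<lambda>p. fst p # snd p)" by (cases w) (auto simp: image_iff)
    qed auto
    ultimately have "((\<lambda>w. V w * cis (?K w \<bullet> y)) has_sum (v y - 1)) (range (\<lambda>p :: (int \<times> int) \<times> (int \<times> int) list. fst p # snd p))"
      by (simp only:)
    moreover have inj: "inj (\<lambda>p :: (int \<times> int) \<times> (int \<times> int) list. fst p # snd p)"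
      by (auto simp: inj_on_def prod_eq_iff)
    ultimately have "((\<lambda>p. V (fst p # snd p) * cis (?K (fst p # snd p) \<bullet> y)) has_sum (v y - 1)) UNIV"
      using has_sum_reindex[OF inj, of "\<lambda>w. V w * cis (?K w \<bullet> y)" "v y - 1"] by (simp only: o_def)
    moreover have "(\<lambda>p. V (fst p # snd p) * cis (?K (fst p # snd p) \<bullet> y)) = (\<lambda>p. M (\<Lambda> p) * d p * cis (?L p \<bullet> y))"
      by (simp add: V_def d_def \<Lambda>_def mult.assoc)
    ultimately show ?thesis using trig_has_sum[OF Md0, of ?L y] has_sum_unique by fastforce
  qed
  \<comment> \<open>The primitive: terms of non-zero frequency are divided by the symbol, the others contribute the constant \<open>D0\<close> to the linear part of \<open>Z\<close>.\<close>
  define E where "E p = (if \<Lambda> p = 0 then 0 else d p / (\<i> * den (\<Lambda> p)))" for p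
  define d' where "d' p = (if \<Lambda> p = 0 then d p else 0)" for p
  define D0 where "D0 = infsum d' UNIV"
  have "(\<lambda>p. norm (d' p)) summable_on UNIV"
    by (rule summable_on_comparison_test[OF d0]) (auto simp: d'_def)
  then have D0: "(d' has_sum D0) UNIV"
    unfolding D0_def using abs_summable_summable has_sum_infsum by blast
  have nE: "norm (E p) \<le> 1 / m * norm (d p)" for p
  proof (cases "\<Lambda> p = 0")
    case False
    have "norm (d p) * m \<le> norm (d p) * norm (den (\<Lambda> p))" by (intro mult_left_mono den2 False) auto
    then show ?thesis using False den0[OF False] m by (simp add: E_def norm_divide norm_mult field_simps)
  qed (use m in \<open>simp add: E_def\<close>)
  have E5: "(\<lambda>p. norm (E p) * (1 + norm (?L p)) ^ (3 + 2)) summable_on UNIV"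
  proof (rule summable_on_comparison_test)
    show "(\<lambda>p. 1 / m * (norm (d p) * (1 + norm (?L p)) ^ 5)) summable_on UNIV"
      by (rule summable_on_cmult_right[OF d5])
    show "norm (E p) * (1 + norm (?L p)) ^ (3 + 2) \<le> 1 / m * (norm (d p) * (1 + norm (?L p)) ^ 5)" for p
      using mult_right_mono[OF nE[of p], of "(1 + norm (?L p)) ^ 5"] by simp
  qed auto
  define Z where "Z y = ((\<tau>0 + D0) * of_real (fst y) + of_real (snd y)) + trig_series E ?L UNIV y" for y
  have bl: "bounded_linear (\<lambda>y :: real \<times> real. (\<tau>0 + D0) * of_real (fst y) + of_real (snd y))"
    by (intro bounded_linear_add bounded_linear_compose[OF bounded_linear_mult_right]
        bounded_linear_compose[OF bounded_linear_of_real] bounded_linear_fst bounded_linear_snd)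
  have C: "Ck_on 3 Z UNIV"
    unfolding Z_def by (rule Ck_on_add[OF open_UNIV Ck_on_linear[OF open_UNIV bl] trig_series_Ck[OF E5]])
  have E2: "(\<lambda>p. norm (E p) * (1 + norm (?L p)) ^ 2) summable_on UNIV"
    using weight_summable_mono[OF E5, of 2] by simp
  have "(Z has_derivative (\<lambda>h. ((\<tau>0 + D0) * of_real (fst h) + of_real (snd h))
      + trig_series (\<lambda>p. E p * \<i> * (?L p \<bullet> h)) ?L UNIV y)) (at y)" for y
    unfolding Z_def
    by (rule has_derivative_add[OF bounded_linear_imp_has_derivative[OF bl] trig_series_has_derivative[OF E2]])
  from frechet_derivative_at[OF this, symmetric]
  have DZ: "dird h Z y = ((\<tau>0 + D0) * of_real (fst h) + of_real (snd h))
      + trig_series (\<lambda>p. E p * \<i> * (?L p \<bullet> h)) ?L UNIV y" for h y by (simp only:)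
  have "dird (0,1) Z y = 1 + trig_series (\<lambda>p. E p * \<i> * (?L p \<bullet> (0,1))) ?L UNIV y" for y
    unfolding DZ by simp
  moreover have "(\<lambda>p. E p * \<i> * (?L p \<bullet> (0,1))) = (\<lambda>p. M (\<Lambda> p) * d p)"
    by (auto simp: fun_eq_iff E_def M_def freq_def)
  ultimately have Z2: "dird (0,1) Z y = v y" for y using split by simp
  have Z1: "dird (1,0) Z y = (\<tau>0 + trig_series c freq UNIV y) * dird (0,1) Z y" for y
  proof -
    let ?F = "\<lambda>p. E p * \<i> * (?L p \<bullet> (1,0))"
    let ?T = "trig_series (\<lambda>p. M (\<Lambda> p) * d p) ?L UNIV y"
    have F: "((\<lambda>p. ?F p * cis (?L p \<bullet> y)) has_sum trig_series ?F ?L UNIV y) UNIV"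
    proof (rule trig_has_sum, rule summable_on_comparison_test)
      show "(\<lambda>p. norm (E p) * (1 + norm (?L p)) ^ 2) summable_on UNIV" by (rule E2)
      fix p
      have "\<bar>?L p \<bullet> (1,0)\<bar> \<le> norm (?L p)" using Cauchy_Schwarz_ineq2[of "?L p" "(1,0)"] by simp
      also have "\<dots> \<le> (1 + norm (?L p)) ^ 2" by (simp add: power2_eq_square algebra_simps)
      finally show "norm (?F p) \<le> norm (E p) * (1 + norm (?L p)) ^ 2"
        by (simp add: norm_mult mult_left_mono)
    qed auto
    have "((\<lambda>p. d' p + ?F p * cis (?L p \<bullet> y)) has_sum (D0 + trig_series ?F ?L UNIV y)) UNIV"
      by (intro has_sum_add D0 F)
    moreover have "((\<lambda>p. \<tau>0 * (M (\<Lambda> p) * d p * cis (?L p \<bullet> y)) + d p * cis (?L p \<bullet> y)) has_sum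
        (\<tau>0 * ?T + trig_series d ?L UNIV y)) UNIV"
      by (intro has_sum_add has_sum_cmult_right trig_has_sum Md0 d0)
    moreover have "d' p + ?F p * cis (?L p \<bullet> y) = \<tau>0 * (M (\<Lambda> p) * d p * cis (?L p \<bullet> y)) + d p * cis (?L p \<bullet> y)" for p
    proof (cases "\<Lambda> p = 0")
      case True
      then show ?thesis by (simp add: d'_def E_def M_def)
    next
      case False
      have "?F p = d p * of_int (fst (\<Lambda> p)) / den (\<Lambda> p)"
        using False by (simp add: E_def freq_def)
      also have "of_int (fst (\<Lambda> p)) = den (\<Lambda> p) + \<tau>0 * of_int (snd (\<Lambda> p))" by (simp add: den_def)
      also have "d p * (den (\<Lambda> p) + \<tau>0 * of_int (snd (\<Lambda> p))) / den (\<Lambda> p) = d p + \<tau>0 * (M (\<Lambda> p) * d p)"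
        using False den0[OF False] by (simp add: M_def field_simps)
      finally have "?F p = d p + \<tau>0 * (M (\<Lambda> p) * d p)" .
      then show ?thesis using False by (simp add: d'_def algebra_simps)
    qed
    ultimately have "D0 + trig_series ?F ?L UNIV y = \<tau>0 * ?T + trig_series d ?L UNIV y"
      using has_sum_unique by (metis (no_types, lifting) has_sum_cong)
    then have "dird (1,0) Z y = \<tau>0 + (\<tau>0 * ?T + trig_series d ?L UNIV y)"
      unfolding DZ by simp
    also have "\<dots> = \<tau>0 * v y + trig_series c freq UNIV y * v y"
      unfolding prod using split[of y] by (simp add: algebra_simps)
    finally show ?thesis unfolding Z2 by (simp add: algebra_simps)
  qed
  show ?thesis using C Z1 Z2 v_nz by metis
qed

text \<open>Freezing the first variable commutes with derivatives in the second. The scaling parameter of the local solution below is such a frozen variable, and uniform continuity in both variables gives smallness.\<close>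

lemma dird_slice:
  fixes H :: "'a::euclidean_space \<times> 'b::euclidean_space \<Rightarrow> 'c::euclidean_space"
  assumes "Ck_on (Suc 0) H S" "(e, y) \<in> S"
  shows "dird v (\<lambda>y. H (e, y)) y = dird (0, v) H (e, y)"
proof -
  have "((\<lambda>y. (e, y)) has_derivative (\<lambda>h. (0, h))) (at y)"
    by (auto intro!: derivative_eq_intros)
  from frechet_derivative_at[OF diff_chain_at[OF this Ck_on_SucD[OF assms]], symmetric]
  show ?thesis by (simp add: o_def)
qed

lemma funpow_dird_slice:
  fixes H :: "'a::euclidean_space \<times> 'b::euclidean_space \<Rightarrow> 'c::euclidean_space"
  assumes "Ck_on n H (I \<times> UNIV)" "e \<in> I"
  shows "(dird v ^^ n) (\<lambda>y. H (e, y)) = (\<lambda>y. (dird (0, v) ^^ n) H (e, y))"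
  using assms(1)
proof (induction n)
  case (Suc n)
  have "Ck_on (Suc 0) ((dird (0, v) ^^ n) H) (I \<times> UNIV)"
    using Suc.prems by (intro Ck_on_funpow_dird) simp
  from dird_slice[OF this] have "dird v (\<lambda>y. (dird (0, v) ^^ n) H (e, y)) = (\<lambda>y. dird (0, v) ((dird (0, v) ^^ n) H) (e, y))"
    using assms(2) by auto
  then show ?case using Suc.IH[OF Ck_on_Suc_imp[OF Suc.prems]] by simp
qed simp

lemma funpow_dird_zero:
  assumes "\<And>z. g z = 0"
  shows "(dird v ^^ n) g z = 0"
proof (rule funpow_dird_eq_0_outside[of "-1"])
  show "-1 < norm z" by (rule less_le_trans[OF _ norm_ge_zero]) simp
qed (rule assms)

lemma unit_ball_in_period_box:
  assumes "norm z < 1"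
  shows "z \<in> period_box"
proof -
  obtain a b where z: "z = (a, b)" by (cases z)
  have "\<bar>a\<bar> < pi" "\<bar>b\<bar> < pi"
    using assms norm_fst_le[of a b] norm_snd_le[of b a] pi_gt3 unfolding z real_norm_def by linarith+
  then show ?thesis by (auto simp: z cbox_Pair_eq)
qed

text \<open>Zooming in at \<open>p\<close> by a factor \<open>e\<close> and cutting off turns \<open>\<tau> - \<tau> p\<close> into \<open>B (e, \<cdot>)\<close>. This family is of class
\<open>C^14\<close> jointly in \<open>e\<close> and the point, and vanishes for \<open>e = 0\<close>, so its derivatives are small for small \<open>e\<close>. The
solution on the torus is pulled back to the ball on which the cutoff is \<open>1\<close>.\<close>

lemma beltrami_local:
  fixes \<tau> :: "real \<times> real \<Rightarrow> complex"
  assumes U: "open U" "p \<in> U" and C: "Ck_on 14 \<tau> U" and im: "Im (\<tau> p) \<noteq> 0"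
  shows "\<exists>r \<zeta>. 0 < r \<and> ball p r \<subseteq> U \<and> Ck_on 3 \<zeta> (ball p r) \<and>
    (\<forall>x\<in>ball p r. dird (0,1) \<zeta> x \<noteq> 0 \<and> dird (1,0) \<zeta> x = \<tau> x * dird (0,1) \<zeta> x)"
proof -
  obtain r0 where r0: "0 < r0" "ball p r0 \<subseteq> U" using U openE by blast
  obtain \<psi> :: "real \<times> real \<Rightarrow> real" where \<psi>: "Ck_on 14 \<psi> UNIV" "\<And>z. norm z \<le> 1 \<Longrightarrow> \<psi> z = 1"
    "\<And>z. 2 < (norm z)\<^sup>2 \<Longrightarrow> \<psi> z = 0"
    using cutoff_exists by metis
  define I where "I = {e::real. \<bar>e\<bar> < r0 / 2}"
  define B where "B q = \<psi> (snd q) *\<^sub>R (\<tau> (p + fst q *\<^sub>R snd q) - \<tau> p)" for q :: "real \<times> (real \<times> real)"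
  have B_out: "B (e, y) = 0" if "3/2 < norm y" for e y
  proof -
    have "(3/2)\<^sup>2 < (norm y)\<^sup>2" using that by (intro power_strict_mono) auto
    then have "2 < (norm y)\<^sup>2" by (simp add: power2_eq_square)
    then show ?thesis using \<psi>(3) by (simp add: B_def)
  qed
  have CB: "Ck_on 14 B (I \<times> UNIV)"
  proof -
    \<comment> \<open>The two open sets overlap: on the first one the formula for \<open>B\<close> makes sense, on the second one \<open>B\<close> is zero.\<close>
    let ?S1 = "{q :: real \<times> (real \<times> real). \<bar>fst q\<bar> < r0 / 2} \<inter> {q. norm (snd q) < 2}"
    let ?S2 = "{q :: real \<times> (real \<times> real). 2 < (norm (snd q))\<^sup>2}"
    have S: "open ?S1" "open ?S2"
      by (intro open_Int open_Collect_less continuous_intros)+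
    have im1: "(\<lambda>q. p + fst q *\<^sub>R snd q) ` ?S1 \<subseteq> U"
    proof
      fix x assume "x \<in> (\<lambda>q. p + fst q *\<^sub>R snd q) ` ?S1"
      then obtain e y where x: "x = p + e *\<^sub>R y" "\<bar>e\<bar> < r0 / 2" "norm y < 2" by auto
      have "\<bar>e\<bar> * norm y \<le> \<bar>e\<bar> * 2" using x by (intro mult_left_mono) auto
      then have "x \<in> ball p r0" using x by (simp add: dist_norm)
      then show "x \<in> U" using r0 by auto
    qed
    have "Ck_on 14 B ?S1"
      unfolding B_def
    proof (intro Ck_on_scaleR S Ck_on_diff Ck_on_const)
      show "Ck_on 14 (\<lambda>q. \<psi> (snd q)) ?S1"
        by (rule Ck_on_compose[OF S(1) open_UNIV _ \<psi>(1) Ck_on_linear[OF S(1) bounded_linear_snd]]) simp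
      have "Ck_on 14 (\<lambda>q. p + fst q *\<^sub>R snd q) ?S1"
        by (intro Ck_on_add S Ck_on_const Ck_on_scaleR Ck_on_linear bounded_linear_fst bounded_linear_snd)
      then show "Ck_on 14 (\<lambda>q. \<tau> (p + fst q *\<^sub>R snd q)) ?S1"
        by (rule Ck_on_compose[OF S(1) U(1) im1 C])
    qed
    moreover have "Ck_on 14 B ?S2"
      by (rule Ck_on_cong[OF S(2) Ck_on_const[OF S(2), of 14 0]]) (simp add: B_def \<psi>(3))
    ultimately have "Ck_on 14 B (?S1 \<union> ?S2)" using S by (intro Ck_on_Un)
    moreover have "I \<times> UNIV \<subseteq> ?S1 \<union> ?S2"
    proof
      fix q assume q: "q \<in> I \<times> (UNIV :: (real \<times> real) set)"
      show "q \<in> ?S1 \<union> ?S2"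
      proof (cases "norm (snd q) < 2")
        case False
        then have "2\<^sup>2 \<le> (norm (snd q))\<^sup>2" by (intro power_mono) auto
        then show ?thesis by simp
      qed (use q in \<open>auto simp: I_def\<close>)
    qed
    ultimately show ?thesis by (rule Ck_on_subset)
  qed
  let ?D = "\<lambda>i j. (dird (0, (0,1)) ^^ j) ((dird (0, (1,0)) ^^ i) B)"
  let ?d = "\<lambda>i j e. (dird (0,1) ^^ j) ((dird (1,0) ^^ i) (\<lambda>y. B (e, y)))"
  have CI: "Ck_on 7 ((dird (0, (1,0)) ^^ i) B) (I \<times> UNIV)" if "i \<in> {0, 7}" for i
    using that CB Ck_on_le[OF CB, of 7] Ck_on_funpow_dird[of 7 7 B "I \<times> UNIV" "(0, (1,0))"] by auto
  have slice: "?d i j e = (\<lambda>y. ?D i j (e, y))" if ij: "i \<in> {0, 7}" "j \<in> {0, 7}" and e: "e \<in> I" for i j e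
  proof -
    have "(dird (1,0) ^^ i) (\<lambda>y. B (e, y)) = (\<lambda>y. (dird (0, (1,0)) ^^ i) B (e, y))"
      using ij by (intro funpow_dird_slice[OF _ e] Ck_on_le[OF CB]) auto
    moreover have "(dird (0,1) ^^ j) (\<lambda>y. (dird (0, (1,0)) ^^ i) B (e, y)) = (\<lambda>y. ?D i j (e, y))"
      using ij by (intro funpow_dird_slice[OF _ e] Ck_on_le[OF CI]) auto
    ultimately show ?thesis by simp
  qed
  obtain K where K: "K > 0" "\<And>(b :: real \<times> real \<Rightarrow> complex) \<eta>. \<lbrakk>Ck_on 14 b UNIV; \<And>z. 3/2 < norm z \<Longrightarrow> b z = 0;
        \<And>i j z. i \<in> {0, 7} \<Longrightarrow> j \<in> {0, 7} \<Longrightarrow> norm ((dird (0,1) ^^ j) ((dird (1,0) ^^ i) b) z) \<le> \<eta>\<rbrakk> \<Longrightarrow>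
      \<exists>c q. ((\<lambda>k. norm (c k) * (1 + norm (freq k)) ^ 5) has_sum q) UNIV \<and> q \<le> K * \<eta> \<and>
        (\<forall>z\<in>period_box. b z = trig_series c freq UNIV z)"
    using fourier_expansion by blast
  \<comment> \<open>The factor \<open>3\<close> leaves room for the strict bound \<open>1/2\<close> required by the solution on the torus.\<close>
  define \<eta> where "\<eta> = \<bar>Im (\<tau> p)\<bar> / (3 * K)"
  have \<eta>: "\<eta> > 0" using im K by (simp add: \<eta>_def)
  have unif: "\<exists>\<delta>>0. \<forall>e y. \<bar>e\<bar> < \<delta> \<longrightarrow> norm (?d i j e y) \<le> \<eta>" if ij: "i \<in> {0, 7}" "j \<in> {0, 7}" for i j
  proof -
    let ?K = "cball 0 (r0 / 4) \<times> cball 0 (3/2) :: (real \<times> (real \<times> real)) set"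
    have sub: "?K \<subseteq> I \<times> UNIV" using r0 by (auto simp: I_def)
    have "Ck_on 0 (?D i j) (I \<times> UNIV)"
      by (rule Ck_on_funpow_dird) (use CI[OF ij(1)] Ck_on_le[OF CI[OF ij(1)], of j] ij in auto)
    then have "continuous_on ?K (?D i j)" using continuous_on_subset[OF _ sub] by simp
    moreover have "compact ?K" by (intro compact_Times compact_cball)
    ultimately have "uniformly_continuous_on ?K (?D i j)" by (rule compact_uniformly_continuous)
    then obtain \<delta> where \<delta>: "\<delta> > 0" "\<And>q q'. q \<in> ?K \<Longrightarrow> q' \<in> ?K \<Longrightarrow> dist q' q < \<delta> \<Longrightarrow> dist (?D i j q') (?D i j q) < \<eta>"
      unfolding uniformly_continuous_on_def using \<eta> by metis
    have D0: "?D i j (0, y) = 0" for y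
    proof -
      have "?d i j 0 y = 0" by (intro funpow_dird_zero) (simp add: B_def)
      then show ?thesis using slice[OF ij, of 0] r0 by (simp add: I_def)
    qed
    have "norm (?d i j e y) \<le> \<eta>" if e: "\<bar>e\<bar> < min \<delta> (r0 / 4)" for e y
    proof (cases "3/2 < norm y")
      case True
      have "?d i j e y = 0"
        by (intro funpow_dird_eq_0_outside[of "3/2"] True B_out)
      then show ?thesis using \<eta> by simp
    next
      case False
      have "dist (?D i j (e, y)) (?D i j (0, y)) < \<eta>"
        by (rule \<delta>(2)) (use e False r0 in \<open>auto simp: dist_Pair_Pair\<close>)
      then show ?thesis using slice[OF ij, of e] e r0 D0 by (simp add: I_def)
    qed
    then show ?thesis using \<delta>(1) r0 by (intro exI[of _ "min \<delta> (r0 / 4)"]) auto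
  qed
  have "\<exists>\<delta>. \<forall>i\<in>{0, 7}. \<forall>j\<in>{0, 7}. 0 < \<delta> i j \<and> (\<forall>e y. \<bar>e\<bar> < \<delta> i j \<longrightarrow> norm (?d i j e y) \<le> \<eta>)"
    by (rule exI[of _ "\<lambda>i j. SOME \<delta>. 0 < \<delta> \<and> (\<forall>e y. \<bar>e\<bar> < \<delta> \<longrightarrow> norm (?d i j e y) \<le> \<eta>)"], intro ballI)
       (rule someI_ex[OF unif])
  then obtain \<delta> where \<delta>': "\<forall>i\<in>{0, 7}. \<forall>j\<in>{0, 7}. 0 < \<delta> i j \<and> (\<forall>e y. \<bar>e\<bar> < \<delta> i j \<longrightarrow> norm (?d i j e y) \<le> \<eta>)"
    by (rule exE)
  have \<delta>: "\<delta> i j > (0::real)" "\<bar>e\<bar> < \<delta> i j \<Longrightarrow> norm (?d i j e y) \<le> \<eta>"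
    if "i \<in> {0, 7}" "j \<in> {0, 7}" for i j e y
    using \<delta>'[rule_format, OF that] by blast+
  define e where "e = min (r0 / 3) (Min ((\<lambda>(i, j). \<delta> i j / 2) ` ({0, 7} \<times> {0, 7})))"
  have e0: "e > 0" using r0 \<delta>(1) by (auto simp: e_def)
  have eI: "e \<in> I" using e0 r0 by (auto simp: I_def e_def)
  have e\<delta>: "\<bar>e\<bar> < \<delta> i j" if "i \<in> {0, 7}" "j \<in> {0, 7}" for i j
  proof -
    have "e \<le> Min ((\<lambda>(i, j). \<delta> i j / 2) ` ({0, 7} \<times> {0, 7}))"
      unfolding e_def by (rule min.cobounded2)
    also have "\<dots> \<le> \<delta> i j / 2" using that by (intro Min_le) auto
    also have "\<dots> < \<delta> i j" using \<delta>(1)[OF that] by simp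
    finally show ?thesis using e0 by simp
  qed
  have Cb: "Ck_on 14 (\<lambda>y. B (e, y)) UNIV"
  proof (rule Ck_on_compose[OF open_UNIV _ _ CB])
    show "open (I \<times> (UNIV :: (real \<times> real) set))"
      unfolding I_def by (intro open_Times open_Collect_less continuous_intros open_UNIV)
    have "Ck_on 14 (\<lambda>y :: real \<times> real. (e, 0) + (0, y)) UNIV"
      by (intro Ck_on_add open_UNIV Ck_on_const Ck_on_linear bounded_linear_Pair bounded_linear_zero bounded_linear_ident)
    then show "Ck_on 14 (Pair e :: real \<times> real \<Rightarrow> _) UNIV" by simp
  qed (use eI in auto)
  obtain c q where cq: "((\<lambda>k. norm (c k) * (1 + norm (freq k)) ^ 5) has_sum q) UNIV" "q \<le> K * \<eta>"
    "\<And>z. z \<in> period_box \<Longrightarrow> B (e, z) = trig_series c freq UNIV z"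
    using K(2)[OF Cb B_out \<delta>(2)[OF _ _ e\<delta>]] by blast
  have "K * \<eta> = \<bar>Im (\<tau> p)\<bar> / 3" using K by (simp add: \<eta>_def)
  then have "q / \<bar>Im (\<tau> p)\<bar> < 1/2" using cq(2) im by (simp add: divide_simps)
  from beltrami_on_torus[OF im cq(1) this] obtain Z where Z: "Ck_on 3 Z UNIV" "\<And>y. dird (0,1) Z y \<noteq> 0"
    "\<And>y. dird (1,0) Z y = (\<tau> p + trig_series c freq UNIV y) * dird (0,1) Z y" by blast
  define \<zeta> where "\<zeta> x = Z ((1 / e) *\<^sub>R (x - p))" for x
  have lin: "Ck_on 3 (\<lambda>x. (1 / e) *\<^sub>R (x - p)) (ball p e)"
    by (intro Ck_on_scaleR Ck_on_const Ck_on_diff Ck_on_ident open_ball)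
  have D\<zeta>: "dird v \<zeta> x = (1 / e) *\<^sub>R dird v Z ((1 / e) *\<^sub>R (x - p))" for v x
  proof -
    have Z1: "Ck_on (Suc 2) Z UNIV" using Z(1) by (simp add: eval_nat_numeral)
    have "((\<lambda>x. (1 / e) *\<^sub>R (x - p)) has_derivative (\<lambda>h. (1 / e) *\<^sub>R h)) (at x)"
      by (auto intro!: derivative_eq_intros)
    from frechet_derivative_at[OF diff_chain_at[OF this Ck_on_SucD[OF Z1 UNIV_I]], symmetric]
    have "dird v \<zeta> x = dird ((1 / e) *\<^sub>R v) Z ((1 / e) *\<^sub>R (x - p))" by (simp add: o_def \<zeta>_def[abs_def])
    then show ?thesis
      using linear_cmul[OF has_derivative_linear[OF Ck_on_SucD[OF Z1 UNIV_I]], of "(1 / e) *\<^sub>R (x - p)" "1 / e" v] by simp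
  qed
  have \<zeta>eq: "dird (0,1) \<zeta> x \<noteq> 0 \<and> dird (1,0) \<zeta> x = \<tau> x * dird (0,1) \<zeta> x" if x: "x \<in> ball p e" for x
  proof -
    let ?y = "(1 / e) *\<^sub>R (x - p)"
    have "norm ?y < 1" using x e0 by (simp add: dist_norm norm_minus_commute)
    moreover from this have "?y \<in> period_box" by (rule unit_ball_in_period_box)
    ultimately have "trig_series c freq UNIV ?y = \<tau> x - \<tau> p"
      using cq(3)[of ?y] \<psi>(2)[of ?y] e0 by (simp add: B_def)
    then show ?thesis unfolding D\<zeta> using Z(2,3)[of ?y] e0 by simp
  qed
  have "ball p e \<subseteq> U" using r0 e0 by (auto simp: e_def)
  moreover have "Ck_on 3 \<zeta> (ball p e)"
    unfolding \<zeta>_def by (rule Ck_on_compose[OF open_ball open_UNIV _ Z(1) lin]) simp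
  ultimately show ?thesis using e0 \<zeta>eq by blast
qed

section \<open>The Levi-Civita connection in a chart\<close>

lemma bounded_bilinear_matrix_vector: "bounded_bilinear (\<lambda>(A :: real^'n^'m) x. A *v x)"
  unfolding bilinear_conv_bounded_bilinear[symmetric] bilinear_def
  by (auto intro!: linearI simp: matrix_vector_mult_def vec_eq_iff algebra_simps sum.distrib sum_distrib_left)

lemma bounded_bilinear_matrix_matrix: "bounded_bilinear (\<lambda>(A :: real^'n^'m) (B :: real^'k^'n). A ** B)"
  unfolding bilinear_conv_bounded_bilinear[symmetric] bilinear_def
  by (auto intro!: linearI simp: matrix_matrix_mult_def vec_eq_iff algebra_simps sum.distrib sum_distrib_left)

lemma bounded_linear_transpose: "bounded_linear (transpose :: real^'n^'m \<Rightarrow> _)"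
  unfolding linear_conv_bounded_linear[symmetric]
  by (auto intro!: linearI simp: transpose_def vec_eq_iff)

lemma bounded_linear_entry: "bounded_linear (\<lambda>A :: real^'n^'m. A $ i $ j)"
  unfolding linear_conv_bounded_linear[symmetric] by (auto intro!: linearI)

lemma inner_matrix_vector: "x \<bullet> (A *v y) = (transpose A *v x) \<bullet> (y :: real^'n)" for A :: "real^'n^'m"
  by (simp add: dot_lmul_matrix transpose_matrix_vector)

lemma ip_simps:
  "ip G (u + v) w = ip G u w + ip G v w" "ip G w (u + v) = ip G w u + ip G w v"
  "ip G (u - v) w = ip G u w - ip G v w" "ip G w (u - v) = ip G w u - ip G w v"
  "ip G (c *\<^sub>R u) w = c * ip G u w" "ip G w (c *\<^sub>R u) = c * ip G w u"
  "ip G (- u) w = - ip G u w" "ip G w (- u) = - ip G w u" "ip G 0 w = 0" "ip G w 0 = 0"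
  by (simp_all add: ip_def inner_add_left inner_diff_left inner_add_right inner_diff_right
      matrix_vector_right_distrib matrix_vector_mult_diff_distrib
      matrix_vector_mult_scaleR linear_neg[OF matrix_vector_mul_linear])

definition cov_deriv :: "(real^'n \<Rightarrow> real^'n^'n) \<Rightarrow> (real^'n \<Rightarrow> real^'n) \<Rightarrow> real^'n \<Rightarrow> real^'n \<Rightarrow> real^'n::finite" where
  "cov_deriv G a x X = frechet_derivative a (at x) X + connection_matrix G x X *v a x"

definition hess :: "(real^'n \<Rightarrow> real^'n^'n) \<Rightarrow> (real^'n \<Rightarrow> real) \<Rightarrow> real^'n \<Rightarrow> real^'n \<Rightarrow> real^'n::finite \<Rightarrow> real" where
  "hess G f x X Y = frechet_derivative (\<lambda>y. frechet_derivative f (at y) Y) (at x) X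
     - frechet_derivative f (at x) (connection_matrix G x X *v Y)"

definition grad :: "(real^'n \<Rightarrow> real^'n^'n) \<Rightarrow> (real^'n \<Rightarrow> real) \<Rightarrow> real^'n \<Rightarrow> real^'n::finite" where
  "grad G f x = matrix_inv (G x) *v (\<chi> k. pd k f x)"

definition diverg :: "(real^'n \<Rightarrow> real^'n^'n) \<Rightarrow> (real^'n \<Rightarrow> real^'n) \<Rightarrow> real^'n::finite \<Rightarrow> real" where
  "diverg G a x = (\<Sum>k\<in>UNIV. cov_deriv G a x (axis k 1) $ k)"

text \<open>A Riemannian metric in one chart; \<open>S\<close> is the image of the chart.\<close>

locale local_metric =
  fixes G :: "real^'n \<Rightarrow> real^'n^'n::finite" and S
  assumes open_S: "open S"
    and Ck_G: "Ck_on k G S"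
    and sym_G: "x \<in> S \<Longrightarrow> transpose (G x) = G x"
    and pos_G: "x \<in> S \<Longrightarrow> v \<noteq> 0 \<Longrightarrow> 0 < ip (G x) v v"
begin

lemma ip_commute: "x \<in> S \<Longrightarrow> ip (G x) u v = ip (G x) v u"
  using inner_matrix_vector[of u "G x" v] sym_G[of x] by (simp add: ip_def inner_commute)

lemma ip_eqI: "x \<in> S \<Longrightarrow> (\<And>w. ip (G x) u w = ip (G x) v w) \<Longrightarrow> u = v"
  using pos_G[of x "u - v"] by (force simp: ip_simps)

lemma det_G: assumes "x \<in> S" shows "det (G x) \<noteq> 0"
proof -
  have "v = 0" if "G x *v v = 0" for v using pos_G[OF assms, of v] that by (auto simp: ip_def)
  then have "inj ((*v) (G x))" by (simp add: linear_injective_0 matrix_vector_mul_linear)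
  then show ?thesis
    using det_nz_iff_inj[OF matrix_vector_mul_linear[of "G x"]] by (simp add: matrix_of_matrix_vector_mul)
qed

lemma G_inv: assumes "x \<in> S"
  shows "G x ** matrix_inv (G x) = mat 1" "matrix_inv (G x) ** G x = mat 1"
    "G x *v (matrix_inv (G x) *v v) = v" "matrix_inv (G x) *v (G x *v v) = v"
  using matrix_inv_works[OF det_G[OF assms]] by (auto simp: matrix_vector_mul_assoc)

lemma Ck_G_inv: "Ck_on k (\<lambda>x. matrix_inv (G x)) S"
  by (intro Ck_on_matrix_inv open_S Ck_G det_G)

abbreviation dG where "dG x \<equiv> frechet_derivative G (at x)"
abbreviation Gam where "Gam x X Y \<equiv> connection_matrix G x X *v Y"

lemma has_derivative_G: "x \<in> S \<Longrightarrow> (G has_derivative dG x) (at x)"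
  using Ck_on_SucD[OF Ck_G[of "Suc 0"]] .

lemma linear_dG: "x \<in> S \<Longrightarrow> linear (dG x)"
  using has_derivative_G has_derivative_linear by blast

lemma dG_entry: "x \<in> S \<Longrightarrow> frechet_derivative (\<lambda>y. G y $ i $ j) (at x) X = dG x X $ i $ j"
  using frechet_derivative_bounded_linear[OF bounded_linear_entry, of G x i j X] has_derivative_G
  by (auto simp: differentiable_def)

lemma dG_symmetric: assumes x: "x \<in> S" shows "transpose (dG x X) = dG x X"
proof -
  have "((\<lambda>y. transpose (G y)) has_derivative (\<lambda>X. transpose (dG x X))) (at x)"
    by (rule bounded_linear.has_derivative[OF bounded_linear_transpose has_derivative_G[OF x]])
  then have "(G has_derivative (\<lambda>X. transpose (dG x X))) (at x)"
    by (rule has_derivative_transform_within_open[OF _ open_S x]) (simp add: sym_G)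
  then show ?thesis using has_derivative_unique[OF has_derivative_G[OF x]] by metis
qed

text \<open>The formula that characterizes the Levi-Civita connection, in the coordinate-free form that makes symmetry, compatibility with the metric and the behaviour under isometries immediate.\<close>

lemma koszul:
  assumes x: "x \<in> S"
  shows "2 * ip (G x) (Gam x X Y) Z = Y \<bullet> (dG x X *v Z) + X \<bullet> (dG x Y *v Z) - X \<bullet> (dG x Z *v Y)"
proof -
  \<comment> \<open>The covector on the right hand side of the formula, so that \<open>2 \<Gamma>(X, Y) = G^(-1) P\<close>.\<close>
  define P where "P = (\<chi> l. Y \<bullet> (dG x X *v axis l 1) + X \<bullet> (dG x Y *v axis l 1) - X \<bullet> (dG x (axis l 1) *v Y))"
  have exp: "dG x V = (\<Sum>i\<in>UNIV. V $ i *\<^sub>R dG x (axis i 1))" for V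
  proof -
    have "V = (\<Sum>i\<in>UNIV. V $ i *\<^sub>R axis i 1)" using basis_expansion[of V] by (simp add: scalar_mult_eq_scaleR)
    then have "dG x V = dG x (\<Sum>i\<in>UNIV. V $ i *\<^sub>R axis i 1)" by simp
    then show ?thesis by (simp add: linear_sum[OF linear_dG[OF x]] linear_cmul[OF linear_dG[OF x]])
  qed
  have Pl: "P $ l = (\<Sum>j\<in>UNIV. \<Sum>i\<in>UNIV. X $ i * Y $ j *
      (dG x (axis i 1) $ j $ l + dG x (axis j 1) $ i $ l - dG x (axis l 1) $ i $ j))" for l
  proof -
    have a: "U \<bullet> (dG x V *v axis l 1) = (\<Sum>j\<in>UNIV. \<Sum>i\<in>UNIV. U $ j * (V $ i * dG x (axis i 1) $ j $ l))" for U V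
      unfolding inner_vec_def matrix_vector_mult_basis column_def
      by (subst exp) (simp add: sum_distrib_left)
    have "X \<bullet> (dG x (axis l 1) *v Y) = (\<Sum>i\<in>UNIV. \<Sum>j\<in>UNIV. X $ i * (dG x (axis l 1) $ i $ j * Y $ j))"
      by (simp add: inner_vec_def matrix_vector_mult_def sum_distrib_left)
    also have "\<dots> = (\<Sum>j\<in>UNIV. \<Sum>i\<in>UNIV. X $ i * (dG x (axis l 1) $ i $ j * Y $ j))"
      by (rule sum.swap)
    finally have c: "X \<bullet> (dG x (axis l 1) *v Y) = (\<Sum>j\<in>UNIV. \<Sum>i\<in>UNIV. X $ i * (dG x (axis l 1) $ i $ j * Y $ j))" .
    have b: "X \<bullet> (dG x Y *v axis l 1) = (\<Sum>j\<in>UNIV. \<Sum>i\<in>UNIV. X $ i * (Y $ j * dG x (axis j 1) $ i $ l))"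
      unfolding a by (rule sum.swap)
    show ?thesis
      unfolding P_def by (simp add: a[of Y X] b c flip: sum.distrib sum_subtractf) (simp add: algebra_simps)
  qed
  have "Gam x X Y = (1/2) *\<^sub>R (matrix_inv (G x) *v P)"
  proof (rule vec_eq_iff[THEN iffD2], rule allI)
    fix k
    have "Gam x X Y $ k = (\<Sum>j\<in>UNIV. \<Sum>i\<in>UNIV. \<Sum>l\<in>UNIV. matrix_inv (G x) $ k $ l * (X $ i * Y $ j *
      (dG x (axis i 1) $ j $ l + dG x (axis j 1) $ i $ l - dG x (axis l 1) $ i $ j)) / 2)"
      unfolding matrix_vector_mult_def connection_matrix_def christoffel_def pd_def dG_entry[OF x]
      by (simp add: sum_distrib_left sum_distrib_right mult_ac)
    also have "\<dots> = (\<Sum>l\<in>UNIV. \<Sum>j\<in>UNIV. \<Sum>i\<in>UNIV. matrix_inv (G x) $ k $ l * (X $ i * Y $ j *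
      (dG x (axis i 1) $ j $ l + dG x (axis j 1) $ i $ l - dG x (axis l 1) $ i $ j)) / 2)"
      by (subst (2) sum.swap, subst sum.swap) (rule refl)
    also have "\<dots> = ((1/2) *\<^sub>R (matrix_inv (G x) *v P)) $ k"
      by (simp add: matrix_vector_mult_def Pl sum_distrib_left sum_divide_distrib)
    finally show "Gam x X Y $ k = ((1/2) *\<^sub>R (matrix_inv (G x) *v P)) $ k" .
  qed
  then have "2 * ip (G x) (Gam x X Y) Z = ip (G x) (matrix_inv (G x) *v P) Z" by (simp add: ip_simps)
  also have "\<dots> = P \<bullet> Z"
    using inner_matrix_vector[of "matrix_inv (G x) *v P" "G x" Z] sym_G[OF x] by (simp add: ip_def G_inv[OF x])
  also have "P \<bullet> Z = (\<Sum>l\<in>UNIV. Z $ l * (Y \<bullet> (dG x X *v axis l 1) + X \<bullet> (dG x Y *v axis l 1) - X \<bullet> (dG x (axis l 1) *v Y)))"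
    by (simp add: inner_vec_def P_def mult.commute)
  also have "\<dots> = Y \<bullet> (dG x X *v Z) + X \<bullet> (dG x Y *v Z) - X \<bullet> (dG x Z *v Y)"
  proof -
    have Z: "Z = (\<Sum>l\<in>UNIV. Z $ l *\<^sub>R axis l 1)" using basis_expansion[of Z] by (simp add: scalar_mult_eq_scaleR)
    define L where "L Z = Y \<bullet> (dG x X *v Z) + X \<bullet> (dG x Y *v Z) - X \<bullet> (dG x Z *v Y)" for Z
    have "linear L"
      unfolding L_def
      by (intro linearI) (simp_all add: linear_add[OF linear_dG[OF x]] linear_cmul[OF linear_dG[OF x]]
          matrix_vector_right_distrib matrix_vector_mult_add_rdistrib inner_add_right matrix_vector_mult_scaleR
          scaleR_matrix_vector_assoc[symmetric] algebra_simps)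
    then have "L (\<Sum>l\<in>UNIV. Z $ l *\<^sub>R axis l 1) = (\<Sum>l\<in>UNIV. Z $ l * L (axis l 1))"
      by (simp add: linear_sum linear_cmul)
    then show ?thesis using Z unfolding L_def by simp
  qed
  finally show ?thesis .
qed

lemma inner_dG_commute: "x \<in> S \<Longrightarrow> Y \<bullet> (dG x X *v Z) = Z \<bullet> (dG x X *v Y)"
  using inner_matrix_vector[of Y "dG x X" Z] dG_symmetric[of x X] by (simp add: inner_commute)

lemma Gam_commute:
  assumes "x \<in> S"
  shows "Gam x X Y = Gam x Y X"
proof (rule ip_eqI[OF assms])
  fix Z
  show "ip (G x) (Gam x X Y) Z = ip (G x) (Gam x Y X) Z"
    using koszul[OF assms, of X Y Z] koszul[OF assms, of Y X Z] inner_dG_commute[OF assms, of X Z Y] by simp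
qed

lemma metric_compatible:
  assumes "x \<in> S"
  shows "Y \<bullet> (dG x X *v Z) = ip (G x) (Gam x X Y) Z + ip (G x) Y (Gam x X Z)"
  using koszul[OF assms, of X Y Z] koszul[OF assms, of X Z Y] inner_dG_commute[OF assms, of Y X Z]
    ip_commute[OF assms, of Y "Gam x X Z"]
  by linarith

lemma Gam_add_left: "x \<in> S \<Longrightarrow> Gam x (X + Y) Z = Gam x X Z + Gam x Y Z"
  using Gam_commute[of x "X + Y" Z] Gam_commute[of x X Z] Gam_commute[of x Y Z]
  by (simp only: matrix_vector_right_distrib)

lemma Gam_scale_left: "x \<in> S \<Longrightarrow> Gam x (c *\<^sub>R X) Z = c *\<^sub>R Gam x X Z"
  using Gam_commute[of x "c *\<^sub>R X" Z] Gam_commute[of x X Z]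
  by (simp only: matrix_vector_mult_scaleR)

lemma Gam_axis: "Gam x (axis i 1) (axis j 1) $ k = christoffel G k i j x"
  unfolding matrix_vector_mult_basis column_def connection_matrix_def
  by (simp add: axis_def if_distrib[of "\<lambda>c. c * _"] cong: if_cong)

lemma christoffel_commute: "x \<in> S \<Longrightarrow> christoffel G k i j x = christoffel G k j i x"
  using Gam_commute[of x "axis i 1" "axis j 1"] Gam_axis by metis

lemma Gam_component: "Gam x X Y $ k = (\<Sum>j\<in>UNIV. \<Sum>i\<in>UNIV. christoffel G k i j x * X $ i * Y $ j)"
  by (simp add: matrix_vector_mult_def connection_matrix_def sum_distrib_left mult_ac)

lemma Ck_christoffel: "Ck_on m (christoffel G k i j) S"
proof -
  have "Ck_on m (pd i (\<lambda>y. G y $ j $ l)) S" for i j l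
    unfolding pd_def by (intro Ck_on_SucD2 Ck_on_nth open_S Ck_G)
  then show ?thesis
    unfolding christoffel_def[abs_def]
    by (intro Ck_on_mult_real Ck_on_const open_S Ck_on_sum Ck_on_add Ck_on_diff Ck_on_nth Ck_G_inv)
qed

lemma ip_grad: "x \<in> S \<Longrightarrow> f differentiable (at x) \<Longrightarrow> ip (G x) (grad G f x) X = frechet_derivative f (at x) X"
proof -
  assume x: "x \<in> S" and f: "f differentiable (at x)"
  have "ip (G x) (grad G f x) X = (\<chi> k. pd k f x) \<bullet> X"
    using inner_matrix_vector[of "grad G f x" "G x" X] sym_G[OF x] by (simp add: grad_def ip_def G_inv[OF x])
  also have "\<dots> = (\<Sum>k\<in>UNIV. X $ k * frechet_derivative f (at x) (axis k 1))"
    by (simp add: inner_vec_def pd_def mult.commute)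
  also have "\<dots> = frechet_derivative f (at x) (\<Sum>k\<in>UNIV. X $ k *\<^sub>R axis k 1)"
    using linear_frechet_derivative[OF f] by (simp add: linear_sum linear_cmul)
  also have "(\<Sum>k\<in>UNIV. X $ k *\<^sub>R axis k 1) = X" using basis_expansion[of X] by (simp add: scalar_mult_eq_scaleR)
  finally show ?thesis .
qed

lemma Ck_grad:
  assumes "open T" "T \<subseteq> S" "Ck_on (Suc m) f T"
  shows "Ck_on m (grad G f) T"
proof -
  have "Ck_on m (\<lambda>x. \<chi> k. pd k f x) T"
    using assms Ck_on_SucD2[OF assms(3)] by (intro Ck_on_vec) (simp_all add: pd_def)
  then show ?thesis
    unfolding grad_def[abs_def]
    by (intro Ck_on_bilinear[OF assms(1) bounded_bilinear_matrix_vector] Ck_on_subset[OF Ck_G_inv assms(2)])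
qed

lemma ip_has_derivative:
  assumes x: "x \<in> S" and a: "(a has_derivative a') (at x)" and b: "(b has_derivative b') (at x)"
  shows "((\<lambda>y. ip (G y) (a y) (b y)) has_derivative
    (\<lambda>X. ip (G x) (cov_deriv G a x X) (b x) + ip (G x) (a x) (cov_deriv G b x X))) (at x)"
proof -
  have "((\<lambda>y. a y \<bullet> (G y *v b y)) has_derivative
    (\<lambda>X. a x \<bullet> (G x *v b' X + dG x X *v b x) + a' X \<bullet> (G x *v b x))) (at x)"
    by (intro has_derivative_inner a bounded_bilinear.FDERIV[OF bounded_bilinear_matrix_vector] has_derivative_G x b)
  moreover have "a x \<bullet> (G x *v b' X + dG x X *v b x) + a' X \<bullet> (G x *v b x)
      = ip (G x) (cov_deriv G a x X) (b x) + ip (G x) (a x) (cov_deriv G b x X)" for X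
    using metric_compatible[OF x, of "a x" X "b x"] frechet_derivative_at[OF a] frechet_derivative_at[OF b]
    by (simp add: cov_deriv_def ip_simps inner_add_right) (simp add: ip_def)
  ultimately show ?thesis by (simp add: ip_def)
qed

text \<open>The Hessian is defined by second derivatives and Christoffel symbols; here it is recognized as the covariant derivative of the gradient.\<close>

lemma ip_cov_deriv_grad:
  assumes T: "open T" "T \<subseteq> S" "x \<in> T" and f: "Ck_on 2 f T"
  shows "ip (G x) (cov_deriv G (grad G f) x X) Y = hess G f x X Y"
proof -
  have x: "x \<in> S" using T by auto
  have f2: "Ck_on (Suc (Suc 0)) f T" using f by (simp add: numeral_2_eq_2)
  have fd: "f differentiable (at y)" if "y \<in> T" for y using f2 that by (simp add: Ck_on.simps)
  have "Ck_on (Suc 0) (grad G f) T" using Ck_grad[OF T(1,2) f2] .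
  from ip_has_derivative[OF x Ck_on_SucD[OF this T(3)] has_derivative_const[of Y]]
  have "((\<lambda>y. frechet_derivative f (at y) Y) has_derivative
    (\<lambda>X. ip (G x) (cov_deriv G (grad G f) x X) Y + ip (G x) (grad G f x) (cov_deriv G (\<lambda>_. Y) x X))) (at x)"
    by (rule has_derivative_transform_within_open[OF _ T(1,3)]) (use T fd in \<open>auto simp: ip_grad\<close>)
  from fun_cong[OF frechet_derivative_at[OF this], of X]
  show ?thesis using fd[OF T(3)] x by (simp add: hess_def cov_deriv_def ip_grad)
qed

lemma hess_commute:
  assumes T: "open T" "T \<subseteq> S" "x \<in> T" and f: "Ck_on 2 f T"
  shows "hess G f x X Y = hess G f x Y X"
proof -
  have x: "x \<in> S" using T by auto
  show ?thesis
    unfolding hess_def Gam_commute[OF x, of X Y]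
    by (simp only: symmetric_second_derivative[OF T(1,3) f, of Y X])
qed

lemma laplacian_eq_hess: "laplacian G f x = (\<Sum>i\<in>UNIV. \<Sum>j\<in>UNIV. matrix_inv (G x) $ i $ j * hess G f x (axis i 1) (axis j 1))"
  if "f differentiable (at x)"
proof -
  have D: "frechet_derivative f (at x) V = (\<Sum>k\<in>UNIV. V $ k * pd k f x)" for V
  proof -
    have "V = (\<Sum>k\<in>UNIV. V $ k *\<^sub>R axis k 1)" using basis_expansion[of V] by (simp add: scalar_mult_eq_scaleR)
    then have "frechet_derivative f (at x) V = frechet_derivative f (at x) (\<Sum>k\<in>UNIV. V $ k *\<^sub>R axis k 1)" by simp
    then show ?thesis
      using linear_frechet_derivative[OF that] by (simp add: linear_sum linear_cmul pd_def)
  qed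
  have "hess G f x (axis i 1) (axis j 1) = pd i (pd j f) x - (\<Sum>k\<in>UNIV. christoffel G k i j x * pd k f x)" for i j
  proof -
    have "pd i (pd j f) x = frechet_derivative (\<lambda>y. frechet_derivative f (at y) (axis j 1)) (at x) (axis i 1)"
      by (simp add: pd_def[abs_def])
    then show ?thesis by (simp only: hess_def D Gam_axis)
  qed
  then show ?thesis unfolding laplacian_def by (simp only:)
qed

lemma laplacian_eq_diverg_grad:
  assumes T: "open T" "T \<subseteq> S" "x \<in> T" and f: "Ck_on 2 f T"
  shows "laplacian G f x = diverg G (grad G f) x"
proof -
  have x: "x \<in> S" using T by auto
  have fd: "f differentiable (at x)" using f T by (simp add: numeral_2_eq_2 Ck_on.simps)
  have "cov_deriv G (grad G f) x (axis k 1) $ k = (\<Sum>j\<in>UNIV. matrix_inv (G x) $ k $ j * hess G f x (axis k 1) (axis j 1))" for k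
  proof -
    let ?N = "cov_deriv G (grad G f) x (axis k 1)"
    have "(G x *v ?N) $ j = hess G f x (axis k 1) (axis j 1)" for j
      using ip_cov_deriv_grad[OF T f, of "axis k 1" "axis j 1"] ip_commute[OF x, of "axis j 1" ?N]
      by (simp add: ip_def inner_axis')
    moreover have "?N = matrix_inv (G x) *v (G x *v ?N)" using G_inv[OF x] by simp
    moreover have "(matrix_inv (G x) *v (G x *v ?N)) $ k = (\<Sum>j\<in>UNIV. matrix_inv (G x) $ k $ j * (G x *v ?N) $ j)"
      by (simp only: matrix_vector_mult_def vec_lambda_beta)
    ultimately show ?thesis by simp
  qed
  then show ?thesis by (simp add: laplacian_eq_hess[OF fd] diverg_def)
qed

end

section \<open>The Bochner formula\<close>

lemma sum_rotate3: "(\<Sum>k\<in>A. \<Sum>i\<in>B. \<Sum>j\<in>C. f k i j) = (\<Sum>i\<in>B. \<Sum>j\<in>C. \<Sum>k\<in>A. f k i j)"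
  by (subst sum.swap) (intro sum.cong refl sum.swap)

lemma sum_rotate4:
  "(\<Sum>k\<in>A. \<Sum>m\<in>D. \<Sum>i\<in>B. \<Sum>j\<in>C. f k m i j) = (\<Sum>i\<in>B. \<Sum>j\<in>C. \<Sum>k\<in>A. \<Sum>m\<in>D. f k m i j)"
proof -
  have "(\<Sum>k\<in>A. \<Sum>m\<in>D. \<Sum>i\<in>B. \<Sum>j\<in>C. f k m i j) = (\<Sum>k\<in>A. \<Sum>i\<in>B. \<Sum>j\<in>C. \<Sum>m\<in>D. f k m i j)"
    by (intro sum.cong refl sum_rotate3)
  also have "\<dots> = (\<Sum>i\<in>B. \<Sum>j\<in>C. \<Sum>k\<in>A. \<Sum>m\<in>D. f k m i j)" by (rule sum_rotate3)
  finally show ?thesis .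
qed

text \<open>The algebra of the Bochner formula, separated from the analysis: \<open>A\<close>, \<open>B\<close> stand for the first derivatives of the components \<open>a\<close>, \<open>b\<close>, \<open>B2\<close> for the second derivatives of \<open>b\<close>, and \<open>g\<close>, \<open>dg\<close> for the Christoffel symbols and their derivatives. The hypotheses are Schwarz's theorem and the vanishing of the torsion.\<close>

lemma bochner_sums:
  fixes a b :: "'n::finite \<Rightarrow> real" and A B :: "'n \<Rightarrow> 'n \<Rightarrow> real" and B2 g :: "'n \<Rightarrow> 'n \<Rightarrow> 'n \<Rightarrow> real"
    and dg :: "'n \<Rightarrow> 'n \<Rightarrow> 'n \<Rightarrow> 'n \<Rightarrow> real"
  assumes B2: "\<And>k i j. B2 k i j = B2 i k j" and g: "\<And>k i j. g k i j = g k j i"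
  shows "(\<Sum>k\<in>UNIV. (\<Sum>i\<in>UNIV. A k i * B i k + a i * B2 k i k)
        + (\<Sum>j\<in>UNIV. \<Sum>i\<in>UNIV. dg k k i j * a i * b j + g k i j * A k i * b j + g k i j * a i * B k j)
        + (\<Sum>j\<in>UNIV. g k k j * ((\<Sum>i\<in>UNIV. a i * B i j) + (\<Sum>l\<in>UNIV. \<Sum>i\<in>UNIV. g j i l * a i * b l))))
    = (\<Sum>l\<in>UNIV. a l * (\<Sum>k\<in>UNIV. B2 l k k + (\<Sum>j\<in>UNIV. dg l k k j * b j + g k k j * B l j)))
      + (\<Sum>i\<in>UNIV. \<Sum>k\<in>UNIV. (A k i + (\<Sum>j\<in>UNIV. g i k j * a j)) * (B i k + (\<Sum>m\<in>UNIV. g k i m * b m)))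
      + (\<Sum>i\<in>UNIV. \<Sum>j\<in>UNIV. ((\<Sum>k\<in>UNIV. dg k k i j) + (\<Sum>k\<in>UNIV. \<Sum>m\<in>UNIV. g k k m * g m i j)
          - (\<Sum>k\<in>UNIV. \<Sum>l\<in>UNIV. g l k i * g k l j) - (\<Sum>k\<in>UNIV. dg i k k j)) * a i * b j)"
proof -
  have E0: "(\<Sum>k\<in>UNIV. \<Sum>i\<in>UNIV. A k i * B i k) = (\<Sum>i\<in>UNIV. \<Sum>k\<in>UNIV. A k i * B i k)" by (rule sum.swap)
  have E1: "(\<Sum>k\<in>UNIV. \<Sum>i\<in>UNIV. a i * B2 k i k) = (\<Sum>l\<in>UNIV. \<Sum>k\<in>UNIV. a l * B2 l k k)"
    by (subst sum.swap) (simp add: B2)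
  have E2: "(\<Sum>k\<in>UNIV. \<Sum>j\<in>UNIV. \<Sum>i\<in>UNIV. g k i j * A k i * b j) = (\<Sum>i\<in>UNIV. \<Sum>k\<in>UNIV. A k i * (\<Sum>m\<in>UNIV. g k i m * b m))"
    unfolding sum_distrib_left by (subst (3) sum.swap, subst sum_rotate3[symmetric], subst (2) sum.swap)
      (simp add: mult_ac)
  have E3: "(\<Sum>k\<in>UNIV. \<Sum>j\<in>UNIV. \<Sum>i\<in>UNIV. g k i j * a i * B k j) = (\<Sum>i\<in>UNIV. \<Sum>k\<in>UNIV. (\<Sum>j\<in>UNIV. g i k j * a j) * B i k)"
    unfolding sum_distrib_right by (intro sum.cong refl) (simp add: g)
  have E4: "(\<Sum>k\<in>UNIV. \<Sum>j\<in>UNIV. g k k j * (\<Sum>i\<in>UNIV. a i * B i j)) = (\<Sum>l\<in>UNIV. a l * (\<Sum>k\<in>UNIV. \<Sum>j\<in>UNIV. g k k j * B l j))"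
  proof -
    have "(\<Sum>k\<in>UNIV. \<Sum>j\<in>UNIV. g k k j * (\<Sum>i\<in>UNIV. a i * B i j)) = (\<Sum>k\<in>UNIV. \<Sum>j\<in>UNIV. \<Sum>i\<in>UNIV. g k k j * (a i * B i j))"
      by (simp add: sum_distrib_left)
    also have "\<dots> = (\<Sum>i\<in>UNIV. \<Sum>k\<in>UNIV. \<Sum>j\<in>UNIV. g k k j * (a i * B i j))"
      by (rule sum_rotate3[symmetric])
    finally show ?thesis by (simp add: sum_distrib_left mult_ac)
  qed
  have E5: "(\<Sum>k\<in>UNIV. \<Sum>j\<in>UNIV. \<Sum>i\<in>UNIV. dg k k i j * a i * b j) = (\<Sum>i\<in>UNIV. \<Sum>j\<in>UNIV. (\<Sum>k\<in>UNIV. dg k k i j) * a i * b j)"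
    by (subst sum_rotate3, subst sum.swap) (simp add: sum_distrib_right)
  have E6: "(\<Sum>k\<in>UNIV. \<Sum>m\<in>UNIV. g k k m * (\<Sum>j\<in>UNIV. \<Sum>i\<in>UNIV. g m i j * a i * b j))
     = (\<Sum>i\<in>UNIV. \<Sum>j\<in>UNIV. (\<Sum>k\<in>UNIV. \<Sum>m\<in>UNIV. g k k m * g m i j) * a i * b j)"
    unfolding sum_distrib_left sum_distrib_right
    by (subst sum_rotate4, subst sum.swap) (simp add: mult.assoc)
  have E7: "(\<Sum>i\<in>UNIV. \<Sum>k\<in>UNIV. (\<Sum>j\<in>UNIV. g i k j * a j) * (\<Sum>m\<in>UNIV. g k i m * b m))
     = (\<Sum>i\<in>UNIV. \<Sum>j\<in>UNIV. (\<Sum>k\<in>UNIV. \<Sum>l\<in>UNIV. g l k i * g k l j) * a i * b j)"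
  proof -
    have "(\<Sum>i\<in>UNIV. \<Sum>k\<in>UNIV. (\<Sum>j\<in>UNIV. g i k j * a j) * (\<Sum>m\<in>UNIV. g k i m * b m))
      = (\<Sum>j\<in>UNIV. \<Sum>m\<in>UNIV. \<Sum>i\<in>UNIV. \<Sum>k\<in>UNIV. (g i k j * a j) * (g k i m * b m))"
      unfolding sum_product by (rule sum_rotate4)
    also have "\<dots> = (\<Sum>j\<in>UNIV. \<Sum>m\<in>UNIV. \<Sum>k\<in>UNIV. \<Sum>i\<in>UNIV. (g i k j * a j) * (g k i m * b m))"
      by (intro sum.cong refl sum.swap)
    also have "\<dots> = (\<Sum>i\<in>UNIV. \<Sum>j\<in>UNIV. (\<Sum>k\<in>UNIV. \<Sum>l\<in>UNIV. g l k i * g k l j) * a i * b j)"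
      by (simp add: sum_distrib_left sum_distrib_right mult_ac)
    finally show ?thesis .
  qed
  have E8: "(\<Sum>l\<in>UNIV. a l * (\<Sum>k\<in>UNIV. \<Sum>j\<in>UNIV. dg l k k j * b j)) = (\<Sum>i\<in>UNIV. \<Sum>j\<in>UNIV. (\<Sum>k\<in>UNIV. dg i k k j) * a i * b j)"
  proof -
    have "(\<Sum>k\<in>UNIV. \<Sum>j\<in>UNIV. dg l k k j * b j) = (\<Sum>j\<in>UNIV. \<Sum>k\<in>UNIV. dg l k k j * b j)" for l
      by (rule sum.swap)
    then show ?thesis by (simp add: sum_distrib_left sum_distrib_right mult_ac)
  qed
  show ?thesis
    using E0 E1 E2 E3 E4 E5 E6 E7 E8
    by (simp add: sum.distrib sum_subtractf distrib_left distrib_right left_diff_distrib sum_distrib_left[symmetric])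
qed

lemma pd_add: "f differentiable (at x) \<Longrightarrow> g differentiable (at x) \<Longrightarrow> pd k (\<lambda>y. f y + g y) x = pd k f x + pd k g x"
  unfolding pd_def frechet_derivative_works
  by (subst frechet_derivative_at[OF has_derivative_add, symmetric]) auto

lemma pd_mult: "f differentiable (at x) \<Longrightarrow> g differentiable (at x) \<Longrightarrow> pd k (\<lambda>y. f y * g y) x = pd k f x * g x + f x * pd k g x"
  unfolding pd_def frechet_derivative_works
  by (subst frechet_derivative_at[OF has_derivative_mult, symmetric]) auto

lemma pd_sum:
  assumes "finite I" "\<And>i. i \<in> I \<Longrightarrow> f i differentiable (at x)"
  shows "pd k (\<lambda>y. \<Sum>i\<in>I. f i y) x = (\<Sum>i\<in>I. pd k (f i) x)"
proof -
  have "((\<lambda>y. \<Sum>i\<in>I. f i y) has_derivative (\<lambda>h. \<Sum>i\<in>I. frechet_derivative (f i) (at x) h)) (at x)"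
    by (rule has_derivative_sum) (use assms frechet_derivative_works in blast)
  from frechet_derivative_at[OF this] show ?thesis unfolding pd_def by metis
qed

lemma pd_cong_open:
  assumes "open T" "x \<in> T" "\<And>y. y \<in> T \<Longrightarrow> f y = g y" "f differentiable (at x)"
  shows "pd k f x = pd k g x"
  unfolding pd_def using frechet_derivative_transform_within_open[OF assms(4,1,2,3)] by simp

lemma frechet_derivative_component_expansion:
  fixes b :: "real^'n \<Rightarrow> real^'m"
  assumes "b differentiable (at y)"
  shows "frechet_derivative b (at y) X $ k = (\<Sum>i\<in>UNIV. X $ i * pd i (\<lambda>y. b y $ k) y)"
proof -
  have lin: "linear (frechet_derivative b (at y))" using assms by (rule linear_frechet_derivative)
  have e: "(\<Sum>i\<in>UNIV. X $ i *\<^sub>R axis i 1) = X" using basis_expansion[of X] by (simp add: scalar_mult_eq_scaleR)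
  have "frechet_derivative b (at y) (\<Sum>i\<in>UNIV. X $ i *\<^sub>R axis i 1) = (\<Sum>i\<in>UNIV. X $ i *\<^sub>R frechet_derivative b (at y) (axis i 1))"
    by (simp add: linear_sum[OF lin] linear_cmul[OF lin])
  then show ?thesis
    unfolding e pd_def frechet_derivative_bounded_linear[OF bounded_linear_vec_nth assms] by simp
qed

lemma Ck_on_differentiable: "Ck_on (Suc k) f T \<Longrightarrow> x \<in> T \<Longrightarrow> f differentiable (at x)"
  by (simp add: Ck_on.simps)

lemma Ck_on_pd: "Ck_on (Suc k) f T \<Longrightarrow> Ck_on k (pd i f) T"
  using Ck_on_SucD2[of k f T "axis i 1"] by (simp add: pd_def[abs_def])

context local_metric
begin

text \<open>The components of the Ricci tensor, written with Christoffel symbols because the Bochner formula below is a computation in coordinates.\<close>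

definition ric :: "'n \<Rightarrow> 'n \<Rightarrow> real^'n \<Rightarrow> real" where
  "ric i j x = (\<Sum>k\<in>UNIV. pd k (christoffel G k i j) x)
    + (\<Sum>k\<in>UNIV. \<Sum>m\<in>UNIV. christoffel G k k m x * christoffel G m i j x)
    - (\<Sum>k\<in>UNIV. \<Sum>l\<in>UNIV. christoffel G l k i x * christoffel G k l j x)
    - (\<Sum>k\<in>UNIV. pd i (christoffel G k k j) x)"

lemma cov_deriv_component:
  assumes "b differentiable (at y)"
  shows "cov_deriv G b y X $ k = (\<Sum>i\<in>UNIV. X $ i * pd i (\<lambda>y. b y $ k) y)
     + (\<Sum>j\<in>UNIV. \<Sum>i\<in>UNIV. christoffel G k i j y * X $ i * b y $ j)"
  by (simp add: cov_deriv_def frechet_derivative_component_expansion[OF assms] Gam_component)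

lemma cov_deriv_axis_component:
  assumes "b differentiable (at y)"
  shows "cov_deriv G b y (axis i 1) $ k = pd i (\<lambda>y. b y $ k) y + (\<Sum>j\<in>UNIV. christoffel G k i j y * b y $ j)"
  unfolding cov_deriv_component[OF assms]
  by (simp add: axis_def if_distrib[of "\<lambda>c. c * _"] if_distrib[of "\<lambda>c. _ * c"] cong: if_cong)

lemma diverg_component:
  assumes "b differentiable (at y)"
  shows "diverg G b y = (\<Sum>k\<in>UNIV. pd k (\<lambda>y. b y $ k) y + (\<Sum>j\<in>UNIV. christoffel G k k j y * b y $ j))"
  by (simp add: diverg_def cov_deriv_axis_component[OF assms])

text \<open>Commuting the two covariant derivatives in \<open>div (\<nabla>\<^sub>a b)\<close> produces the curvature term. Two different fields are admitted because the formula is applied to the polarized pair of gradients.\<close>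

lemma bochner:
  assumes T: "open T" "T \<subseteq> S" "x \<in> T" and a: "Ck_on 1 a T" and b: "Ck_on 2 b T"
  shows "diverg G (\<lambda>y. cov_deriv G b y (a y)) x = frechet_derivative (diverg G b) (at x) (a x)
    + trace (matrix (cov_deriv G a x) ** matrix (cov_deriv G b x))
    + (\<Sum>i\<in>UNIV. \<Sum>j\<in>UNIV. ric i j x * a x $ i * b x $ j)"
proof -
  have a1: "Ck_on (Suc 0) a T" and b2: "Ck_on (Suc (Suc 0)) b T" and b1: "Ck_on (Suc 0) b T"
    using a b Ck_on_Suc_imp by (auto simp: numeral_2_eq_2)
  let ?a = "\<lambda>i y. a y $ i" and ?b = "\<lambda>i y. b y $ i" and ?g = "christoffel G"
  have ai1: "Ck_on (Suc 0) (?a i) T" for i by (intro Ck_on_nth T a1)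
  have bi2: "Ck_on (Suc (Suc 0)) (?b i) T" for i by (intro Ck_on_nth T b2)
  have bi1: "Ck_on (Suc 0) (?b i) T" for i by (intro Ck_on_nth T b1)
  have g1: "Ck_on (Suc 0) (?g k i j) T" for k i j by (rule Ck_on_subset[OF Ck_christoffel T(2)])
  have pb1: "Ck_on (Suc 0) (pd k (?b i)) T" for k i by (rule Ck_on_pd[OF bi2])
  note d = Ck_on_differentiable[OF ai1] Ck_on_differentiable[OF bi1] Ck_on_differentiable[OF g1] Ck_on_differentiable[OF pb1]
  note bd = Ck_on_differentiable[OF b1]
  let ?c = "\<lambda>y. cov_deriv G b y (a y)"
  let ?e = "\<lambda>k y. (\<Sum>i\<in>UNIV. ?a i y * pd i (?b k) y) + (\<Sum>j\<in>UNIV. \<Sum>i\<in>UNIV. ?g k i j y * ?a i y * ?b j y)"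
  have c_comp: "?c y $ k = ?e k y" if "y \<in> T" for y k
    by (rule cov_deriv_component[OF bd[OF that]])
  have e1: "Ck_on (Suc 0) (?e k) T" for k
    by (intro Ck_on_add Ck_on_sum Ck_on_mult_real T ai1 pb1 g1 bi1)
  have c1: "Ck_on (Suc 0) (\<lambda>y. \<chi> k. ?e k y) T"
    by (rule Ck_on_vec[OF T(1)]) (use e1 in simp)
  have c1: "Ck_on (Suc 0) ?c T"
    by (rule Ck_on_cong[OF T(1) c1]) (simp add: vec_eq_iff c_comp)
  have pd_c: "pd k (\<lambda>y. ?c y $ k) x = (\<Sum>i\<in>UNIV. pd k (?a i) x * pd i (?b k) x + ?a i x * pd k (pd i (?b k)) x)
     + (\<Sum>j\<in>UNIV. \<Sum>i\<in>UNIV. pd k (?g k i j) x * ?a i x * ?b j x + ?g k i j x * pd k (?a i) x * ?b j x + ?g k i j x * ?a i x * pd k (?b j) x)" for k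
  proof -
    have "pd k (\<lambda>y. ?c y $ k) x = pd k (?e k) x"
      by (rule pd_cong_open[OF T(1,3) c_comp]) (use Ck_on_differentiable[OF Ck_on_nth[OF T(1) c1] T(3)] in auto)
    also have "\<dots> = (\<Sum>i\<in>UNIV. pd k (?a i) x * pd i (?b k) x + ?a i x * pd k (pd i (?b k)) x)
     + (\<Sum>j\<in>UNIV. \<Sum>i\<in>UNIV. pd k (?g k i j) x * ?a i x * ?b j x + ?g k i j x * pd k (?a i) x * ?b j x + ?g k i j x * ?a i x * pd k (?b j) x)"
      by (simp add: pd_add pd_sum pd_mult d T differentiable_sum differentiable_mult distrib_right)
    finally show ?thesis .
  qed
  have L: "diverg G ?c x = (\<Sum>k\<in>UNIV. (\<Sum>i\<in>UNIV. pd k (?a i) x * pd i (?b k) x + ?a i x * pd k (pd i (?b k)) x)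
     + (\<Sum>j\<in>UNIV. \<Sum>i\<in>UNIV. pd k (?g k i j) x * ?a i x * ?b j x + ?g k i j x * pd k (?a i) x * ?b j x + ?g k i j x * ?a i x * pd k (?b j) x)
     + (\<Sum>j\<in>UNIV. ?g k k j x * ((\<Sum>i\<in>UNIV. ?a i x * pd i (?b j) x) + (\<Sum>l\<in>UNIV. \<Sum>i\<in>UNIV. ?g j i l x * ?a i x * ?b l x))))"
    unfolding diverg_component[OF Ck_on_differentiable[OF c1 T(3)]] pd_c c_comp[OF T(3)] by (rule refl)
  let ?f = "\<lambda>y. \<Sum>k\<in>UNIV. pd k (?b k) y + (\<Sum>j\<in>UNIV. ?g k k j y * ?b j y)"
  have f1: "Ck_on (Suc 0) ?f T"
    by (intro Ck_on_add Ck_on_sum Ck_on_mult_real T pb1 g1 bi1)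
  have df: "diverg G b y = ?f y" if "y \<in> T" for y by (rule diverg_component[OF bd[OF that]])
  have D: "frechet_derivative (diverg G b) (at x) (a x) = (\<Sum>l\<in>UNIV. ?a l x * (\<Sum>k\<in>UNIV. pd l (pd k (?b k)) x
      + (\<Sum>j\<in>UNIV. pd l (?g k k j) x * ?b j x + ?g k k j x * pd l (?b j) x)))"
  proof -
    have fd: "?f differentiable (at x)" by (rule Ck_on_differentiable[OF f1 T(3)])
    have "frechet_derivative (diverg G b) (at x) = frechet_derivative ?f (at x)"
      by (rule sym, rule frechet_derivative_transform_within_open[OF fd T(1,3)]) (simp add: df)
    moreover have "frechet_derivative ?f (at x) (a x) = (\<Sum>l\<in>UNIV. ?a l x * pd l ?f x)"
    proof -
      have e: "(\<Sum>i\<in>UNIV. a x $ i *\<^sub>R axis i 1) = a x" using basis_expansion[of "a x"] by (simp add: scalar_mult_eq_scaleR)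
      have "frechet_derivative ?f (at x) (\<Sum>i\<in>UNIV. a x $ i *\<^sub>R axis i 1) = (\<Sum>l\<in>UNIV. ?a l x * pd l ?f x)"
        unfolding pd_def[of _ ?f] using linear_frechet_derivative[OF fd] by (simp add: linear_sum linear_cmul)
      then show ?thesis unfolding e .
    qed
    moreover have "pd l ?f x = (\<Sum>k\<in>UNIV. pd l (pd k (?b k)) x
      + (\<Sum>j\<in>UNIV. pd l (?g k k j) x * ?b j x + ?g k k j x * pd l (?b j) x))" for l
    proof -
      show ?thesis
        by (simp add: pd_add pd_sum pd_mult d T differentiable_sum differentiable_mult differentiable_add)
    qed
    ultimately show ?thesis by simp
  qed
  have Tr: "trace (matrix (cov_deriv G a x) ** matrix (cov_deriv G b x))
    = (\<Sum>i\<in>UNIV. \<Sum>k\<in>UNIV. (pd k (?a i) x + (\<Sum>j\<in>UNIV. ?g i k j x * ?a j x)) * (pd i (?b k) x + (\<Sum>m\<in>UNIV. ?g k i m x * ?b m x)))"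
    by (simp add: trace_def matrix_matrix_mult_def matrix_def
        cov_deriv_axis_component[OF Ck_on_differentiable[OF a1 T(3)]] cov_deriv_axis_component[OF bd[OF T(3)]])
  have sym2: "pd k (pd i (?b j)) x = pd i (pd k (?b j)) x" for k i j
    using symmetric_second_derivative[OF T(1,3), of "?b j" "axis i 1" "axis k 1"] bi2[of j]
    by (simp add: pd_def[abs_def] numeral_2_eq_2)
  have symg: "?g k i j x = ?g k j i x" for k i j using christoffel_commute T by auto
  have R: "diverg G ?c x = frechet_derivative (diverg G b) (at x) (a x)
    + trace (matrix (cov_deriv G a x) ** matrix (cov_deriv G b x))
    + (\<Sum>i\<in>UNIV. \<Sum>j\<in>UNIV. ric i j x * a x $ i * b x $ j)"
    unfolding L D Tr ric_def
    using bochner_sums[of "\<lambda>k i j. pd k (pd i (?b j)) x" "\<lambda>k i j. ?g k i j x" "\<lambda>k i. pd k (?a i) x"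
      "\<lambda>i k. pd i (?b k) x" "\<lambda>i. ?a i x" "\<lambda>l k i j. pd l (?g k i j) x" "\<lambda>i. ?b i x", OF sym2 symg]
    .
  then show ?thesis by simp
qed

lemma Ck_ric: "continuous_on S (ric i j)"
proof -
  have p: "Ck_on 0 (pd l (christoffel G k i j)) S" for l k i j
    by (rule Ck_on_pd[OF Ck_christoffel])
  have "Ck_on 0 (ric i j) S"
    unfolding ric_def[abs_def]
    by (intro Ck_on_add Ck_on_diff Ck_on_sum Ck_on_mult_real open_S p Ck_christoffel)
  then show ?thesis by simp
qed

end

section \<open>Orthonormal frames and pairs of functions with null complex gradient\<close>

definition frame_matrix :: "('n \<Rightarrow> real^'n) \<Rightarrow> real^'n^'n::finite" where
  "frame_matrix e = (\<chi> i k. e k $ i)"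

lemma frame_matrix_entry: "(transpose (frame_matrix e) ** G ** A ** frame_matrix e) $ i $ j = ip G (e i) (A *v e j)"
proof -
  have "(transpose (frame_matrix e) ** G ** A ** frame_matrix e) *v axis j 1 = transpose (frame_matrix e) *v (G *v (A *v (frame_matrix e *v axis j 1)))"
    by (simp add: matrix_vector_mul_assoc matrix_mul_assoc)
  also have "frame_matrix e *v axis j 1 = e j"
    by (simp add: matrix_vector_mult_basis column_def frame_matrix_def)
  finally have "((transpose (frame_matrix e) ** G ** A ** frame_matrix e) *v axis j 1) $ i = (transpose (frame_matrix e) *v (G *v (A *v e j))) $ i"
    by simp
  moreover have "(transpose (frame_matrix e) *v w) $ i = e i \<bullet> w" for w
    unfolding matrix_vector_mult_def transpose_def frame_matrix_def inner_vec_def by simp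
  ultimately show ?thesis
    unfolding matrix_vector_mult_basis column_def vec_lambda_beta ip_def by simp
qed

lemma frame_matrix_inverse:
  fixes G :: "real^'n^'n::finite"
  assumes "orthonormal_frame G e"
  shows "frame_matrix e ** (transpose (frame_matrix e) ** G) = mat 1" "transpose (frame_matrix e) ** G ** frame_matrix e = mat 1"
proof -
  have "(transpose (frame_matrix e) ** G ** mat 1 ** frame_matrix e) $ i $ j = (mat 1 :: real^'n^'n) $ i $ j" for i j
    unfolding frame_matrix_entry matrix_vector_mul_lid using assms by (simp add: orthonormal_frame_def mat_def)
  then show *: "transpose (frame_matrix e) ** G ** frame_matrix e = mat 1" by (simp add: vec_eq_iff)
  show "frame_matrix e ** (transpose (frame_matrix e) ** G) = mat 1"
    using * matrix_left_right_inverse by blast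
qed

text \<open>The matrix of an endomorphism is conjugated by the matrix of the frame, so traces can be computed with the metric alone.\<close>

lemma trace_frame:
  assumes "orthonormal_frame G e"
  shows "trace A = (\<Sum>i\<in>UNIV. ip G (e i) (A *v e i))"
proof -
  let ?E = "frame_matrix e"
  have "trace A = trace ((?E ** (transpose ?E ** G)) ** A)" by (simp add: frame_matrix_inverse[OF assms])
  also have "\<dots> = trace (?E ** (transpose ?E ** G ** A))" by (simp add: matrix_mul_assoc)
  also have "\<dots> = trace (transpose ?E ** G ** A ** ?E)" by (rule trace_mul_sym)
  finally show ?thesis unfolding trace_def frame_matrix_entry .
qed

lemma trace_product_frame:
  assumes "orthonormal_frame G e"
  shows "trace (A ** B) = (\<Sum>i\<in>UNIV. \<Sum>j\<in>UNIV. ip G (e i) (A *v e j) * ip G (e j) (B *v e i))"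
proof -
  let ?E = "frame_matrix e"
  have "transpose ?E ** G ** (A ** B) ** ?E = transpose ?E ** G ** A ** mat 1 ** B ** ?E"
    by (simp add: matrix_mul_assoc)
  also have "\<dots> = transpose ?E ** G ** A ** (?E ** (transpose ?E ** G)) ** B ** ?E"
    by (simp only: frame_matrix_inverse(1)[OF assms])
  also have "\<dots> = (transpose ?E ** G ** A ** ?E) ** (transpose ?E ** G ** B ** ?E)"
    by (simp add: matrix_mul_assoc)
  finally have "ip G (e i) ((A ** B) *v e i) = ((transpose ?E ** G ** A ** ?E) ** (transpose ?E ** G ** B ** ?E)) $ i $ i" for i
    unfolding frame_matrix_entry[symmetric] by simp
  then show ?thesis
    unfolding trace_frame[OF assms] by (simp only: matrix_matrix_mult_def[of "transpose ?E ** G ** A ** ?E"] vec_lambda_beta frame_matrix_entry)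
qed

text \<open>The right hand side does not mention the frame; hence the norm of an endomorphism can be computed in any orthonormal frame.\<close>

lemma trace_adjoint_frame:
  assumes G: "transpose G = G" and e: "orthonormal_frame G e"
  shows "(\<Sum>i\<in>UNIV. \<Sum>j\<in>UNIV. (ip G (L *v e i) (e j))\<^sup>2) = trace (matrix_inv G ** transpose L ** G ** L)"
proof -
  let ?E = "frame_matrix e"
  have "det G \<noteq> 0"
  proof
    assume "det G = 0"
    then have "det (transpose ?E ** G ** ?E) = 0" by (simp add: det_mul)
    then show False using frame_matrix_inverse(2)[OF e] by simp
  qed
  note Gi = matrix_inv_works[OF this]
  have ipc: "ip G u v = ip G v u" for u v
    using inner_matrix_vector[of u G v] G by (simp add: ip_def inner_commute)
  have adj: "ip G u ((matrix_inv G ** transpose L ** G) *v v) = ip G (L *v u) v" for u v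
  proof -
    have "ip G u ((matrix_inv G ** transpose L ** G) *v v) = u \<bullet> ((G ** matrix_inv G) *v (transpose L *v (G *v v)))"
      by (simp add: ip_def matrix_vector_mul_assoc matrix_mul_assoc)
    also have "\<dots> = (L *v u) \<bullet> (G *v v)"
      unfolding Gi using inner_matrix_vector[of u "transpose L" "G *v v"] by simp
    finally show ?thesis by (simp add: ip_def)
  qed
  have "trace (matrix_inv G ** transpose L ** G ** L)
      = (\<Sum>i\<in>UNIV. \<Sum>j\<in>UNIV. ip G (e i) ((matrix_inv G ** transpose L ** G) *v e j) * ip G (e j) (L *v e i))"
    by (rule trace_product_frame[OF e])
  then show ?thesis unfolding adj by (simp add: ipc[of "e _" "L *v _"] power2_eq_square)
qed

context local_metric
begin

lemma linear_cov_deriv: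
  assumes "x \<in> S" "b differentiable (at x)"
  shows "linear (cov_deriv G b x)"
  unfolding cov_deriv_def
  using linear_frechet_derivative[OF assms(2)]
  by (intro linearI) (simp_all add: linear_add linear_cmul Gam_add_left[OF assms(1)] Gam_scale_left[OF assms(1)] scaleR_add_right)

lemma diverg_eq_trace: "diverg G b x = trace (matrix (cov_deriv G b x))"
  by (simp add: diverg_def trace_def matrix_def)

lemma linear_hess:
  assumes T: "open T" "T \<subseteq> S" "x \<in> T" and f: "Ck_on 2 f T"
  shows "hess G f x (c *\<^sub>R X) Y = c * hess G f x X Y" "hess G f x X (c *\<^sub>R Y) = c * hess G f x X Y"
proof -
  have "Ck_on (Suc 0) (grad G f) T" using Ck_grad[OF T(1,2)] f by (simp add: numeral_2_eq_2)
  then have "linear (cov_deriv G (grad G f) x)" using T Ck_on_differentiable by (intro linear_cov_deriv) auto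
  then show "hess G f x (c *\<^sub>R X) Y = c * hess G f x X Y"
    unfolding ip_cov_deriv_grad[OF T f, symmetric] by (simp add: linear_cmul ip_simps)
  show "hess G f x X (c *\<^sub>R Y) = c * hess G f x X Y"
    unfolding ip_cov_deriv_grad[OF T f, symmetric] by (simp add: ip_simps)
qed

definition hess_op :: "(real^'n \<Rightarrow> real) \<Rightarrow> real^'n \<Rightarrow> real^'n^'n" where
  "hess_op f x = matrix (cov_deriv G (grad G f) x)"

lemma ip_hess_op:
  assumes T: "open T" "T \<subseteq> S" "x \<in> T" and f: "Ck_on 2 f T"
  shows "ip (G x) X (hess_op f x *v Y) = hess G f x X Y"
proof -
  have x: "x \<in> S" using T by auto
  have "Ck_on (Suc 0) (grad G f) T" using Ck_grad[OF T(1,2)] f by (simp add: numeral_2_eq_2)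
  then have "linear (cov_deriv G (grad G f) x)" using T Ck_on_differentiable by (intro linear_cov_deriv) auto
  then have "hess_op f x *v Y = cov_deriv G (grad G f) x Y" unfolding hess_op_def using matrix_vector_mul by metis
  then show ?thesis
    using ip_cov_deriv_grad[OF T f, of Y X] hess_commute[OF T f, of X Y] ip_commute[OF x] by simp
qed

lemma laplacian_eq_trace:
  assumes T: "open T" "T \<subseteq> S" "x \<in> T" and f: "Ck_on 2 f T"
  shows "laplacian G f x = trace (hess_op f x)"
  using laplacian_eq_diverg_grad[OF assms] by (simp add: diverg_eq_trace hess_op_def)

text \<open>Equivalently the complex gradient of \<open>u + \<i> v\<close> is a null vector for the complex bilinear extension of the metric.\<close>

definition null_pair :: "(real^'n \<Rightarrow> real) \<Rightarrow> (real^'n \<Rightarrow> real) \<Rightarrow> (real^'n) set \<Rightarrow> bool" where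
  "null_pair u v T \<longleftrightarrow> (\<forall>y\<in>T. ip (G y) (grad G u y) (grad G u y) = ip (G y) (grad G v y) (grad G v y)
     \<and> ip (G y) (grad G u y) (grad G v y) = 0)"

text \<open>The derivatives of the two defining equations.\<close>

lemma null_pair_hess:
  assumes T: "open T" "T \<subseteq> S" "x \<in> T" and u: "Ck_on 2 u T" and v: "Ck_on 2 v T" and null: "null_pair u v T"
  shows "hess G u x X (grad G u x) = hess G v x X (grad G v x)"
    and "hess G u x X (grad G v x) = - hess G v x X (grad G u x)"
proof -
  have x: "x \<in> S" using T by auto
  have a: "Ck_on (Suc 0) (grad G u) T" and b: "Ck_on (Suc 0) (grad G v) T"
    using Ck_grad[OF T(1,2)] u v by (simp_all add: numeral_2_eq_2)
  note da = Ck_on_SucD[OF a T(3)] and db = Ck_on_SucD[OF b T(3)]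
  have "((\<lambda>y. ip (G y) (grad G u y) (grad G u y)) has_derivative
     (\<lambda>X. ip (G x) (cov_deriv G (grad G v) x X) (grad G v x) + ip (G x) (grad G v x) (cov_deriv G (grad G v) x X))) (at x)"
    by (rule has_derivative_transform_within_open[OF ip_has_derivative[OF x db db] T(1,3)])
       (use null in \<open>simp add: null_pair_def\<close>)
  from has_derivative_unique[OF this ip_has_derivative[OF x da da]]
  have "ip (G x) (cov_deriv G (grad G v) x X) (grad G v x) + ip (G x) (grad G v x) (cov_deriv G (grad G v) x X)
     = ip (G x) (cov_deriv G (grad G u) x X) (grad G u x) + ip (G x) (grad G u x) (cov_deriv G (grad G u) x X)"
    by (rule fun_cong)
  then show "hess G u x X (grad G u x) = hess G v x X (grad G v x)"
    using ip_commute[OF x, of "grad G v x"] ip_commute[OF x, of "grad G u x"]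
      ip_cov_deriv_grad[OF T u] ip_cov_deriv_grad[OF T v] by simp
  have "((\<lambda>y. ip (G y) (grad G u y) (grad G v y)) has_derivative (\<lambda>X. 0)) (at x)"
    by (rule has_derivative_transform_within_open[OF has_derivative_const T(1,3)])
       (use null in \<open>simp add: null_pair_def\<close>)
  from has_derivative_unique[OF this ip_has_derivative[OF x da db]]
  have "0 = ip (G x) (cov_deriv G (grad G u) x X) (grad G v x) + ip (G x) (grad G u x) (cov_deriv G (grad G v) x X)"
    by (rule fun_cong)
  then show "hess G u x X (grad G v x) = - hess G v x X (grad G u x)"
    using ip_commute[OF x, of "grad G u x"] ip_cov_deriv_grad[OF T u] ip_cov_deriv_grad[OF T v] by simp
qed

lemma Ck_cov_deriv:
  assumes T: "open T" "T \<subseteq> S" and a: "Ck_on k a T" and b: "Ck_on (Suc k) b T"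
  shows "Ck_on k (\<lambda>y. cov_deriv G b y (a y)) T"
proof -
  let ?e = "\<lambda>m y. (\<Sum>i\<in>UNIV. a y $ i * pd i (\<lambda>y. b y $ m) y)
     + (\<Sum>j\<in>UNIV. \<Sum>i\<in>UNIV. christoffel G m i j y * a y $ i * b y $ j)"
  have "Ck_on k (\<lambda>y. \<chi> m. ?e m y) T"
    by (rule Ck_on_vec[OF T(1)], unfold vec_lambda_beta)
       (intro Ck_on_add Ck_on_sum Ck_on_mult_real T Ck_on_nth a Ck_on_pd[OF Ck_on_nth[OF T(1) b]]
        Ck_on_subset[OF Ck_christoffel] Ck_on_Suc_imp[OF b])
  then show ?thesis
    by (rule Ck_on_cong[OF T(1)]) (simp add: vec_eq_iff cov_deriv_component[OF Ck_on_differentiable[OF b]])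
qed

lemma diverg_cong:
  assumes "open T" "x \<in> T" "\<And>y. y \<in> T \<Longrightarrow> a y = b y" "a differentiable (at x)"
  shows "diverg G a x = diverg G b x"
  using frechet_derivative_transform_within_open[OF assms(4,1,2,3)] assms(2,3)
  by (simp add: diverg_def cov_deriv_def)

lemma diverg_uminus:
  assumes "a differentiable (at x)"
  shows "diverg G (\<lambda>y. - a y) x = - diverg G a x"
  using frechet_derivative_bounded_linear[OF bounded_linear_minus[OF bounded_linear_ident] assms]
  by (simp add: diverg_def cov_deriv_def linear_neg[OF matrix_vector_mul_linear] flip: sum_negf)

lemma frechet_derivative_eq_0:
  assumes "open T" "x \<in> T" "\<And>y. y \<in> T \<Longrightarrow> f y = (0::real)"
  shows "frechet_derivative f (at x) X = 0"
proof -
  have "(f has_derivative (\<lambda>X. 0)) (at x)"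
    by (rule has_derivative_transform_within_open[OF has_derivative_const assms(1,2)]) (simp add: assms(3))
  then show ?thesis by (rule fun_cong[OF frechet_derivative_at[symmetric]])
qed

abbreviation Ric where "Ric x X Y \<equiv> (\<Sum>i\<in>UNIV. \<Sum>j\<in>UNIV. ric i j x * X $ i * Y $ j)"

text \<open>By the previous relations \<open>\<nabla>\<^sub>a a = \<nabla>\<^sub>b b\<close> and \<open>\<nabla>\<^sub>a b = - \<nabla>\<^sub>b a\<close> for the gradients \<open>a\<close>, \<open>b\<close>: the derivative of \<open>\<nabla>f\<close> along itself is zero. So in the Bochner formulas for the four pairs of gradients the divergences on the left cancel, and those of \<open>a\<close> and \<open>b\<close> on the right vanish by harmonicity.\<close>

lemma null_pair_bochner:
  assumes T: "open T" "T \<subseteq> S" "x \<in> T" and u: "Ck_on 3 u T" and v: "Ck_on 3 v T" and null: "null_pair u v T"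
    and harm: "\<And>y. y \<in> T \<Longrightarrow> laplacian G u y = 0" "\<And>y. y \<in> T \<Longrightarrow> laplacian G v y = 0"
  shows "trace (hess_op u x ** hess_op u x) - trace (hess_op v x ** hess_op v x)
      = Ric x (grad G v x) (grad G v x) - Ric x (grad G u x) (grad G u x)"
    and "2 * trace (hess_op u x ** hess_op v x) = - Ric x (grad G u x) (grad G v x) - Ric x (grad G v x) (grad G u x)"
proof -
  have u2: "Ck_on 2 u T" and v2: "Ck_on 2 v T" using u v Ck_on_le by force+
  have a: "Ck_on 2 (grad G u) T" and b: "Ck_on 2 (grad G v) T"
    using Ck_grad[OF T(1,2), of 2] u v by simp_all
  have a1: "Ck_on 1 (grad G u) T" and b1: "Ck_on 1 (grad G v) T"
    using a b Ck_on_le by force+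
  have a2: "Ck_on (Suc 1) (grad G u) T" and b2: "Ck_on (Suc 1) (grad G v) T"
    using a b by (simp_all add: numeral_2_eq_2)
  have dva: "frechet_derivative (diverg G (grad G u)) (at x) X = 0" "frechet_derivative (diverg G (grad G v)) (at x) X = 0" for X
    using laplacian_eq_diverg_grad[OF T(1,2) _ u2] laplacian_eq_diverg_grad[OF T(1,2) _ v2] harm
    by (auto intro!: frechet_derivative_eq_0[OF T(1,3)])
  let ?c = "\<lambda>f g y. cov_deriv G (grad G g) y (grad G f y)"
  have diff: "?c u u differentiable (at x)" "?c v u differentiable (at x)"
    using Ck_on_differentiable[OF Ck_cov_deriv[OF T(1,2), of "Suc 0"] T(3)] a1 b1 a2 b2 by auto
  have eq1: "?c u u y = ?c v v y" if y: "y \<in> T" for y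
  proof (rule ip_eqI)
    show "y \<in> S" using T y by auto
    fix w
    show "ip (G y) (?c u u y) w = ip (G y) (?c v v y) w"
      unfolding ip_cov_deriv_grad[OF T(1,2) y u2] ip_cov_deriv_grad[OF T(1,2) y v2]
      using null_pair_hess(1)[OF T(1,2) y u2 v2 null, of w] hess_commute[OF T(1,2) y u2] hess_commute[OF T(1,2) y v2]
      by metis
  qed
  have eq2: "?c u v y = - ?c v u y" if y: "y \<in> T" for y
  proof (rule ip_eqI)
    show "y \<in> S" using T y by auto
    fix w
    show "ip (G y) (?c u v y) w = ip (G y) (- ?c v u y) w"
      unfolding ip_simps ip_cov_deriv_grad[OF T(1,2) y u2] ip_cov_deriv_grad[OF T(1,2) y v2]
      using null_pair_hess(2)[OF T(1,2) y u2 v2 null, of w] hess_commute[OF T(1,2) y u2] hess_commute[OF T(1,2) y v2]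
      by (metis minus_minus)
  qed
  have "diverg G (?c u u) x = diverg G (?c v v) x" by (rule diverg_cong[OF T(1,3) eq1 diff(1)])
  then show "trace (hess_op u x ** hess_op u x) - trace (hess_op v x ** hess_op v x)
      = Ric x (grad G v x) (grad G v x) - Ric x (grad G u x) (grad G u x)"
    using bochner[OF T a1 a] bochner[OF T b1 b] dva by (simp add: hess_op_def)
  have "diverg G (\<lambda>y. - ?c v u y) x = diverg G (?c u v) x"
    by (rule diverg_cong[OF T(1,3)]) (use eq2 diff(2) in \<open>auto intro: differentiable_minus\<close>)
  then have "diverg G (?c u v) x = - diverg G (?c v u) x" using diverg_uminus[OF diff(2)] by simp
  then show "2 * trace (hess_op u x ** hess_op v x) = - Ric x (grad G u x) (grad G v x) - Ric x (grad G v x) (grad G u x)"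
    using bochner[OF T a1 b] bochner[OF T b1 a] dva trace_mul_sym[of "hess_op u x" "hess_op v x"]
    by (simp add: hess_op_def)
qed

end

text \<open>In dimension two the gradients span the tangent plane, so the Laplacian is the trace over them, and the relations for the Hessians make it vanish.\<close>

lemma null_pair_surface_harmonic:
  fixes G :: "real^2 \<Rightarrow> real^2^2"
  assumes G: "local_metric G S" and T: "open T" "T \<subseteq> S" "x \<in> T" and u: "Ck_on 2 u T" and v: "Ck_on 2 v T"
    and null: "local_metric.null_pair G u v T" and nz: "grad G u x \<noteq> 0"
  shows "laplacian G u x = 0" "laplacian G v x = 0"
proof -
  interpret local_metric G S by (rule G)
  have x: "x \<in> S" using T by auto
  let ?a = "grad G u x" and ?b = "grad G v x"
  have pos: "0 < ip (G x) ?a ?a" using pos_G[OF x nz] .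
  define r where "r = 1 / sqrt (ip (G x) ?a ?a)"
  have r: "r * r * ip (G x) ?a ?a = 1" using pos by (simp add: r_def)
  define e where "e i = (if i = 1 then r *\<^sub>R ?a else r *\<^sub>R ?b)" for i :: 2
  have ab: "ip (G x) ?a ?a = ip (G x) ?b ?b" "ip (G x) ?a ?b = 0" "ip (G x) ?b ?a = 0"
    using null T ip_commute[OF x] by (auto simp: null_pair_def)
  have e: "orthonormal_frame (G x) e"
    unfolding orthonormal_frame_def forall_2 e_def using r ab by (simp add: ip_simps mult.assoc)
  have tr: "laplacian G f x = r * r * hess G f x ?a ?a + r * r * hess G f x ?b ?b" if f: "Ck_on 2 f T" for f
    unfolding laplacian_eq_trace[OF T f] trace_frame[OF e] ip_hess_op[OF T f]
    by (simp add: sum_2 e_def linear_hess[OF T f])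
  have n1: "hess G u x ?a ?a = hess G v x ?a ?b" "hess G u x ?b ?b = - hess G v x ?b ?a"
    "hess G u x ?a ?b = - hess G v x ?a ?a" "hess G u x ?b ?a = hess G v x ?b ?b"
    using null_pair_hess[OF T u v null] by blast+
  show "laplacian G u x = 0"
    unfolding tr[OF u] n1 hess_commute[OF T v, of ?b ?a] by simp
  show "laplacian G v x = 0"
  proof -
    have "hess G v x ?a ?a + hess G v x ?b ?b = 0" using n1(3,4) hess_commute[OF T u, of ?b ?a] by linarith
    then show ?thesis unfolding tr[OF v] by (simp flip: distrib_left)
  qed
qed

text \<open>In a frame adapted to the gradients, the relations for the Hessians make the block of \<open>e 1\<close>, \<open>e 2\<close> cancel in both traces, and the mixed entries cancel as well. Harmonicity then makes the block of \<open>e 3\<close>, \<open>e 4\<close> traceless, since the block of \<open>e 1\<close>, \<open>e 2\<close> is.\<close>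

lemma null_pair_4_traces:
  fixes G :: "real^4 \<Rightarrow> real^4^4"
  assumes G: "local_metric G S" and T: "open T" "T \<subseteq> S" "x \<in> T" and u: "Ck_on 2 u T" and v: "Ck_on 2 v T"
    and null: "local_metric.null_pair G u v T" and harm: "laplacian G u x = 0" "laplacian G v x = 0"
    and e: "orthonormal_frame (G x) e" and e12: "grad G u x = l *\<^sub>R e 1" "grad G v x = l *\<^sub>R e 2" "l \<noteq> 0"
  shows "trace (local_metric.hess_op G u x ** local_metric.hess_op G u x) - trace (local_metric.hess_op G v x ** local_metric.hess_op G v x)
     = 2 * ((hess G u x (e 3) (e 3))\<^sup>2 - (hess G v x (e 3) (e 3))\<^sup>2 + (hess G u x (e 3) (e 4))\<^sup>2 - (hess G v x (e 3) (e 4))\<^sup>2)"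
    and "trace (local_metric.hess_op G u x ** local_metric.hess_op G v x)
     = 2 * (hess G u x (e 3) (e 3) * hess G v x (e 3) (e 3) + hess G u x (e 3) (e 4) * hess G v x (e 3) (e 4))"
proof -
  interpret local_metric G S by (rule G)
  let ?U = "\<lambda>i j. hess G u x (e i) (e j)" and ?V = "\<lambda>i j. hess G v x (e i) (e j)"
  have n1: "?U i 1 = ?V i 2" for i
    using null_pair_hess(1)[OF T u v null, of "e i"] e12 by (simp add: linear_hess[OF T u] linear_hess[OF T v])
  have n2: "?U i 2 = - ?V i 1" for i
  proof -
    have "l * ?U i 2 = - (l * ?V i 1)"
      using null_pair_hess(2)[OF T u v null, of "e i"] unfolding e12 linear_hess[OF T u] linear_hess[OF T v] .
    then have "l * (?U i 2 + ?V i 1) = 0" by (simp add: distrib_left)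
    then show ?thesis using e12(3) by simp
  qed
  have su: "?U i j = ?U j i" and sv: "?V i j = ?V j i" for i j
    using hess_commute[OF T u] hess_commute[OF T v] by blast+
  have tu: "?U 1 1 + ?U 2 2 + ?U 3 3 + ?U 4 4 = 0"
    using harm(1) unfolding laplacian_eq_trace[OF T u] trace_frame[OF e] ip_hess_op[OF T u] sum_4 .
  have tv: "?V 1 1 + ?V 2 2 + ?V 3 3 + ?V 4 4 = 0"
    using harm(2) unfolding laplacian_eq_trace[OF T v] trace_frame[OF e] ip_hess_op[OF T v] sum_4 .
  have u11: "?U 1 1 = ?V 1 2" and u22: "?U 2 2 = - ?V 1 2" and u12: "?U 1 2 = - ?V 1 1" and v22: "?V 2 2 = - ?V 1 1"
    using n1[of 1] n2[of 2] n2[of 1] n1[of 2] sv[of 2 1] su[of 2 1] by auto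
  have u44: "?U 4 4 = - ?U 3 3" using tu u11 u22 by simp
  have v44: "?V 4 4 = - ?V 3 3" using tv v22 by simp
  have u1: "?U 3 1 = ?V 3 2" "?U 4 1 = ?V 4 2" "?U 3 2 = - ?V 3 1" "?U 4 2 = - ?V 4 1"
    using n1 n2 by auto
  note rel = su[of 2 1] su[of 1 3] su[of 1 4] su[of 2 3] su[of 2 4] su[of 4 3]
    sv[of 2 1] sv[of 1 3] sv[of 1 4] sv[of 2 3] sv[of 2 4] sv[of 4 3] u11 u22 u12 v22 u44 v44 u1
  show "trace (hess_op u x ** hess_op u x) - trace (hess_op v x ** hess_op v x)
     = 2 * ((?U 3 3)\<^sup>2 - (?V 3 3)\<^sup>2 + (?U 3 4)\<^sup>2 - (?V 3 4)\<^sup>2)"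
    unfolding trace_product_frame[OF e] ip_hess_op[OF T u] ip_hess_op[OF T v] sum_4 rel
    by (simp add: power2_eq_square algebra_simps)
  show "trace (hess_op u x ** hess_op v x) = 2 * (?U 3 3 * ?V 3 3 + ?U 3 4 * ?V 3 4)"
    unfolding trace_product_frame[OF e] ip_hess_op[OF T u] ip_hess_op[OF T v] sum_4 rel
    by (simp add: algebra_simps)
qed

section \<open>Hermitian structures on a four-dimensional space\<close>

lemma vector_4 [simp]:
  "(vector [w,x,y,z] :: 'a::zero^4) $ 1 = w" "(vector [w,x,y,z] :: 'a::zero^4) $ 2 = x"
  "(vector [w,x,y,z] :: 'a::zero^4) $ 3 = y" "(vector [w,x,y,z] :: 'a::zero^4) $ 4 = z"
  unfolding vector_def by simp_all

lemma linear_det_row: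
  fixes M :: "real^'n^'n"
  shows "linear (\<lambda>X. det (\<chi> i. if i = k then X else M $ i))"
proof (rule linearI)
  fix X Y :: "real^'n" and c :: real
  show "det (\<chi> i. if i = k then X + Y else M $ i) = det (\<chi> i. if i = k then X else M $ i) + det (\<chi> i. if i = k then Y else M $ i)"
    using det_row_add[of k "\<lambda>_. X" "\<lambda>_. Y" "\<lambda>i. M $ i"] by simp
  show "det (\<chi> i. if i = k then c *\<^sub>R X else M $ i) = c *\<^sub>R det (\<chi> i. if i = k then X else M $ i)"
    using det_row_mul[of k c "\<lambda>_. X" "\<lambda>i. M $ i"] by (simp add: scalar_mult_eq_scaleR cong: if_cong)
qed

lemma linear_det_vector_4:
  "linear (\<lambda>X. det (vector [a, b, X, Y] :: real^4^4))" "linear (\<lambda>Y. det (vector [a, b, X, Y] :: real^4^4))"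
proof -
  have "(\<lambda>X. det (vector [a, b, X, Y] :: real^4^4)) = (\<lambda>X. det (\<chi> i. if i = 3 then X else (vector [a, b, 0, Y] :: real^4^4) $ i))"
    by (intro ext arg_cong[of _ _ det]) (simp add: vec_eq_iff[of "vector _"] forall_4)
  then show "linear (\<lambda>X. det (vector [a, b, X, Y] :: real^4^4))" by (simp only: linear_det_row)
  have "(\<lambda>Y. det (vector [a, b, X, Y] :: real^4^4)) = (\<lambda>Y. det (\<chi> i. if i = 4 then Y else (vector [a, b, X, 0] :: real^4^4) $ i))"
    by (intro ext arg_cong[of _ _ det]) (simp add: vec_eq_iff[of "vector _"] forall_4)
  then show "linear (\<lambda>Y. det (vector [a, b, X, Y] :: real^4^4))" by (simp only: linear_det_row)
qed

lemma det_vector_4_repeated: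
  "det (vector [a, b, a, Y] :: real^4^4) = 0" "det (vector [a, b, b, Y] :: real^4^4) = 0"
  "det (vector [a, b, X, a] :: real^4^4) = 0" "det (vector [a, b, X, b] :: real^4^4) = 0"
  "det (vector [a, b, X, X] :: real^4^4) = 0"
  by (rule det_identical_rows[of 1 3] det_identical_rows[of 2 3] det_identical_rows[of 1 4]
      det_identical_rows[of 2 4] det_identical_rows[of 3 4]; simp add: row_def)+

lemma frame_expansion:
  assumes "orthonormal_frame G e"
  shows "X = (\<Sum>i\<in>UNIV. ip G (e i) X *\<^sub>R e i)"
proof -
  have "X = (frame_matrix e ** (transpose (frame_matrix e) ** G)) *v X"
    by (simp add: frame_matrix_inverse[OF assms])
  also have "\<dots> = frame_matrix e *v (transpose (frame_matrix e) *v (G *v X))"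
    by (simp add: matrix_vector_mul_assoc matrix_mul_assoc)
  also have "\<dots> = (\<Sum>i\<in>UNIV. ip G (e i) X *\<^sub>R e i)"
    unfolding vec_eq_iff
  proof
    fix k
    have "(transpose (frame_matrix e) *v w) $ i = e i \<bullet> w" for i w
      unfolding matrix_vector_mult_def transpose_def frame_matrix_def inner_vec_def by simp
    then have "(transpose (frame_matrix e) *v (G *v X)) $ i = ip G (e i) X" for i
      by (simp only: ip_def)
    then show "(frame_matrix e *v (transpose (frame_matrix e) *v (G *v X))) $ k = (\<Sum>i\<in>UNIV. ip G (e i) X *\<^sub>R e i) $ k"
      unfolding matrix_vector_mult_def[of "frame_matrix e"] by (simp add: frame_matrix_def mult.commute)
  qed
  finally show ?thesis .
qed

lemma linear_eq_on_frame:
  assumes e: "orthonormal_frame G e" and "linear L" "linear M" "\<And>i. L (e i) = M (e i)"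
  shows "L X = M X"
proof -
  have "L (\<Sum>i\<in>UNIV. ip G (e i) X *\<^sub>R e i) = M (\<Sum>i\<in>UNIV. ip G (e i) X *\<^sub>R e i)"
    by (simp add: linear_sum assms linear_cmul)
  then show ?thesis using frame_expansion[OF e, of X] by simp
qed

lemma endo_norm_frame:
  assumes G: "transpose G = G" and e: "orthonormal_frame G e"
  shows "endo_norm G L = sqrt (\<Sum>i\<in>UNIV. \<Sum>j\<in>UNIV. (ip G (L *v e i) (e j))\<^sup>2)"
proof -
  have "orthonormal_frame G (SOME e. orthonormal_frame G e)"
    by (rule someI[of "\<lambda>e. orthonormal_frame G e", OF e])
  from trace_adjoint_frame[OF G this] trace_adjoint_frame[OF G e] show ?thesis
    by (simp add: endo_norm_def)
qed

lemma hermitian_square: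
  assumes "hermitian_structure G J"
  shows "J *v (J *v X) = - X"
proof -
  have "J *v (J *v X) = (- mat 1) *v X" using assms by (simp add: hermitian_structure_def matrix_vector_mul_assoc)
  also have "\<dots> = - X" using bounded_bilinear.minus_left[OF bounded_bilinear_matrix_vector, of "mat 1" X] by simp
  finally show ?thesis .
qed

lemma hermitian_skew:
  assumes "hermitian_structure G J"
  shows "ip G (J *v X) Y = - ip G X (J *v Y)"
proof -
  have "ip G (J *v (J *v X)) (J *v Y) = ip G (J *v X) Y"
    using assms unfolding hermitian_structure_def by blast
  then show ?thesis unfolding hermitian_square[OF assms] by (simp add: ip_simps)
qed

text \<open>In the applications \<open>a\<close> is the gradient of \<open>u\<close> and \<open>T\<close> is vertical: the first two vectors span the horizontal plane, the others the vertical plane.\<close>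

definition adapted_frame :: "real^4^4 \<Rightarrow> real^4^4 \<Rightarrow> real^4 \<Rightarrow> real^4 \<Rightarrow> 4 \<Rightarrow> real^4" where
  "adapted_frame G J a T i = (if i = 1 then (1 / sqrt (ip G a a)) *\<^sub>R a
     else if i = 2 then (1 / sqrt (ip G a a)) *\<^sub>R (J *v a) else if i = 3 then T else J *v T)"

locale adapted_point =
  fixes G J :: "real^4^4" and a T :: "real^4"
  assumes sym: "transpose G = G" and pos: "v \<noteq> 0 \<Longrightarrow> 0 < ip G v v"
    and herm: "hermitian_structure G J" and a: "a \<noteq> 0"
    and T: "ip G a T = 0" "ip G (J *v a) T = 0" "ip G T T = 1"
begin

abbreviation "l \<equiv> sqrt (ip G a a)"
abbreviation "e \<equiv> adapted_frame G J a T"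

lemma l: "0 < l" "l * l = ip G a a"
  using pos[OF a] by auto

lemma ip_sym: "ip G u v = ip G v u"
  using inner_matrix_vector[of u G v] sym by (simp add: ip_def inner_commute)

lemma J_J: "J *v (J *v X) = - X"
  by (rule hermitian_square[OF herm])

lemma ip_J_J: "ip G (J *v X) (J *v Y) = ip G X Y"
  using herm by (simp add: hermitian_structure_def)

lemma ip_J_skew: "ip G (J *v X) Y = - ip G X (J *v Y)"
  by (rule hermitian_skew[OF herm])

lemma ip_J_self: "ip G X (J *v X) = 0" "ip G (J *v X) X = 0"
  using ip_J_skew[of X X] ip_sym[of X "J *v X"] by auto

lemma adapted_frame_simps: "e 1 = (1 / l) *\<^sub>R a" "e 2 = (1 / l) *\<^sub>R (J *v a)" "e 3 = T" "e 4 = J *v T"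
  by (simp_all add: adapted_frame_def)

lemma orthonormal: "orthonormal_frame G e"
proof -
  have "ip G a (J *v T) = 0" "ip G (J *v T) a = 0" using T(2) ip_J_skew[of a T] ip_sym[of a "J *v T"] by auto
  moreover have "ip G (J *v a) (J *v T) = 0" "ip G (J *v T) (J *v a) = 0"
    using T(1) ip_sym[of a T] by (simp_all add: ip_J_J)
  moreover have "ip G T a = 0" "ip G T (J *v a) = 0" using T ip_sym by metis+
  moreover have "ip G a a / (l * l) = 1" using l by simp
  ultimately show ?thesis
    unfolding orthonormal_frame_def forall_4 adapted_frame_simps
    using T by (simp add: ip_simps ip_J_J ip_J_self)
qed

lemma J_frame: "J *v e 1 = e 2" "J *v e 2 = - e 1" "J *v e 3 = e 4" "J *v e 4 = - e 3"
  unfolding adapted_frame_simps by (simp_all add: matrix_vector_mult_scaleR J_J)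

text \<open>The entries of \<open>D\<close> in the adapted frame vanish inside the two planes, and the mixed entries are determined up to sign by the two components of \<open>D T\<close> along the horizontal plane; each occurs four times.\<close>

lemma endo_norm_anticommuting:
  assumes skew: "\<And>X Y. ip G (D *v X) Y = - ip G X (D *v Y)" and anti: "D ** J = - (J ** D)"
  shows "endo_norm G D = 2 / l * sqrt ((ip G a (D *v T))\<^sup>2 + (ip G (J *v a) (D *v T))\<^sup>2)"
proof -
  let ?d = "\<lambda>i j. ip G (D *v e i) (e j)"
  have anti': "D *v (J *v X) = - (J *v (D *v X))" for X
  proof -
    have "D *v (J *v X) = (- (J ** D)) *v X" using anti by (simp add: matrix_vector_mul_assoc)
    also have "\<dots> = - (J *v (D *v X))"
      using bounded_bilinear.minus_left[OF bounded_bilinear_matrix_vector, of "J ** D" X]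
      by (simp add: matrix_vector_mul_assoc)
    finally show ?thesis .
  qed
  have as: "?d i j = - ?d j i" for i j using skew[of "e i" "e j"] ip_sym[of "e i" "D *v e j"] by simp
  have move: "ip G (D *v (J *v X)) Y = ip G (D *v X) (J *v Y)" for X Y
    unfolding anti' using ip_J_skew[of "D *v X" Y] by (simp add: ip_simps)
  have "?d 2 1 = ?d 1 2" "?d 4 3 = ?d 3 4" "?d 2 3 = ?d 1 4" "?d 2 4 = - ?d 1 3"
    using move[of "e 1" "e 1"] move[of "e 3" "e 3"] move[of "e 1" "e 3"] move[of "e 1" "e 4"]
    by (simp_all only: J_frame ip_simps)
  then have rel: "?d 1 1 = 0" "?d 2 2 = 0" "?d 3 3 = 0" "?d 4 4 = 0" "?d 1 2 = 0" "?d 2 1 = 0" "?d 3 4 = 0" "?d 4 3 = 0"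
    "?d 1 3 = - ?d 3 1" "?d 1 4 = - ?d 3 2" "?d 2 3 = - ?d 3 2" "?d 2 4 = ?d 3 1" "?d 4 1 = ?d 3 2" "?d 4 2 = - ?d 3 1"
    using as[of 1 1] as[of 2 2] as[of 3 3] as[of 4 4] as[of 2 1] as[of 4 3] as[of 1 3] as[of 1 4] as[of 2 3] as[of 2 4] as[of 4 1] as[of 4 2]
    by linarith+
  have "(\<Sum>i\<in>UNIV. \<Sum>j\<in>UNIV. (?d i j)\<^sup>2) = 4 * ((?d 3 1)\<^sup>2 + (?d 3 2)\<^sup>2)"
    unfolding sum_4 rel by simp
  also have "\<dots> = (2 / l)\<^sup>2 * ((ip G a (D *v T))\<^sup>2 + (ip G (J *v a) (D *v T))\<^sup>2)"
    unfolding adapted_frame_simps ip_simps ip_sym[of "D *v T"] by (simp add: power_mult_distrib power_divide algebra_simps)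
  finally show ?thesis
    unfolding endo_norm_frame[OF sym orthonormal]
    using l(1) by (simp add: real_sqrt_mult)
qed

text \<open>The Gram determinant of the orthogonal vectors \<open>a\<close>, \<open>J a\<close>, \<open>T\<close>, \<open>J T\<close>.\<close>

lemma det_gram: "(det (vector [a, J *v a, T, J *v T] :: real^4^4))\<^sup>2 * det G = (ip G a a)\<^sup>2"
proof -
  let ?M = "vector [a, J *v a, T, J *v T] :: real^4^4"
  have "ip G a (J *v T) = 0" "ip G (J *v T) a = 0" using T(2) ip_J_skew[of a T] ip_sym[of a "J *v T"] by auto
  moreover have "ip G (J *v a) (J *v T) = 0" "ip G (J *v T) (J *v a) = 0"
    using T(1) ip_sym[of a T] by (simp_all add: ip_J_J)
  moreover have "ip G T a = 0" "ip G T (J *v a) = 0" using T ip_sym by metis+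
  moreover have ent: "(?M ** G ** transpose ?M) $ i $ j = ip G (?M $ i) (?M $ j)" for i j
  proof -
    have "(?M ** G ** transpose ?M) = ?M ** (G ** transpose ?M)" by (simp add: matrix_mul_assoc)
    then show ?thesis
      unfolding matrix_matrix_mult_def transpose_def ip_def inner_vec_def matrix_vector_mult_def by simp
  qed
  ultimately have "(?M ** G ** transpose ?M) $ i $ j = 0" if "i \<noteq> j" for i j
    using that exhaust_4[of i] exhaust_4[of j] T unfolding ent by (auto simp: ip_J_self)
  then have "det (?M ** G ** transpose ?M) = (\<Prod>i\<in>UNIV. (?M ** G ** transpose ?M) $ i $ i)"
    by (rule det_diagonal)
  also have "\<dots> = ip G a a * ip G a a"
    unfolding ent UNIV_4 by (simp add: ip_J_J T)
  finally show ?thesis by (simp add: det_mul power2_eq_square mult_ac)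
qed

lemma det_pos: "0 < det G"
proof -
  have "0 < (det (vector [a, J *v a, T, J *v T] :: real^4^4))\<^sup>2 * det G"
    unfolding det_gram using pos[OF a] by simp
  then show ?thesis by (simp add: zero_less_mult_iff)
qed

lemma det_oriented:
  assumes "induces_orientation s J" "\<bar>s\<bar> = 1"
  shows "s * sqrt (det G) / ip G a a * det (vector [a, J *v a, T, J *v T] :: real^4^4) = 1"
proof -
  let ?d = "det (vector [a, J *v a, T, J *v T] :: real^4^4)"
  have nz: "?d \<noteq> 0" using det_gram pos[OF a] by auto
  have "sgn ?d = s" using assms(1) nz unfolding induces_orientation_def Let_def by blast
  then have abs: "s * ?d = \<bar>?d\<bar>" using assms(2) nz by (auto simp: sgn_if split: if_splits)
  have "\<bar>?d\<bar> * sqrt (det G) = sqrt (?d\<^sup>2 * det G)" by (simp add: real_sqrt_mult)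
  also have "\<dots> = ip G a a" unfolding det_gram using pos[OF a] by simp
  finally have "\<bar>?d\<bar> * sqrt (det G) = ip G a a" .
  moreover have "s * sqrt (det G) / ip G a a * ?d = (s * ?d) * sqrt (det G) / ip G a a" by simp
  ultimately have "s * sqrt (det G) / ip G a a * ?d = ip G a a / ip G a a" by (simp only: abs)
  then show ?thesis by (rule trans) (use pos[OF a] in simp)
qed

text \<open>On the horizontal plane \<open>J\<close> rotates \<open>a\<close> to \<open>J a\<close>; on its orthogonal complement \<open>J\<close> is the rotation with the prescribed orientation, which is a cross product with \<open>a\<close> and \<open>J a\<close>. The right hand side involves \<open>J\<close> only through \<open>J a\<close>, and this yields the differentiability of \<open>J\<close>.\<close>

lemma structure_formula:
  assumes ori: "induces_orientation s J" "\<bar>s\<bar> = 1"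
  shows "J *v X = (1 / ip G a a) *\<^sub>R (ip G a X *\<^sub>R (J *v a) - ip G (J *v a) X *\<^sub>R a)
    + (s * sqrt (det G) / ip G a a) *\<^sub>R (matrix_inv G *v (\<chi> m. det (vector [a, J *v a, X, axis m 1] :: real^4^4)))"
proof -
  let ?b = "J *v a" and ?k = "s * sqrt (det G) / ip G a a" and ?d = "\<lambda>X Y. det (vector [a, J *v a, X, Y] :: real^4^4)"
  let ?N = "\<lambda>X. matrix_inv G *v (\<chi> m. ?d X (axis m 1))"
  let ?R = "\<lambda>X. (1 / ip G a a) *\<^sub>R (ip G a X *\<^sub>R ?b - ip G ?b X *\<^sub>R a) + ?k *\<^sub>R ?N X"
  have Gi: "G ** matrix_inv G = mat 1" using det_pos matrix_inv_works by force
  have linN: "linear ?N"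
  proof (rule linear_compose[of "\<lambda>X. \<chi> m. ?d X (axis m 1)" "\<lambda>v. matrix_inv G *v v", unfolded o_def])
    show "linear (\<lambda>X. \<chi> m. ?d X (axis m 1))"
      by (intro linearI) (simp_all add: vec_eq_iff linear_add[OF linear_det_vector_4(1)] linear_cmul[OF linear_det_vector_4(1)])
  qed simp
  have linR: "linear ?R"
    by (intro linearI) (simp_all add: linear_add[OF linN] linear_cmul[OF linN] ip_simps algebra_simps divide_simps)
  have N_ip: "ip G (?N X) Y = ?d X Y" for X Y
  proof -
    have "ip G (?N X) Y = ip G Y (?N X)" by (rule ip_sym)
    also have "\<dots> = Y \<bullet> (\<chi> m. ?d X (axis m 1))"
      by (simp add: ip_def matrix_vector_mul_assoc Gi)
    also have "\<dots> = (\<Sum>m\<in>UNIV. Y $ m * ?d X (axis m 1))" by (simp add: inner_vec_def)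
    also have "\<dots> = ?d X (\<Sum>m\<in>UNIV. Y $ m *\<^sub>R axis m 1)"
      by (simp add: linear_sum[OF linear_det_vector_4(2)] linear_cmul[OF linear_det_vector_4(2)])
    also have "(\<Sum>m\<in>UNIV. Y $ m *\<^sub>R axis m 1) = Y" using basis_expansion[of Y] by (simp add: scalar_mult_eq_scaleR)
    finally show ?thesis .
  qed
  have eqI: "U = V" if "\<And>i. ip G (e i) U = ip G (e i) V" for U V
    using frame_expansion[OF orthonormal, of U] frame_expansion[OF orthonormal, of V] that by simp
  have la: "ip G a a \<noteq> 0" using pos[OF a] by simp
  have Na: "?N a = 0" "?N ?b = 0" by (simp_all add: det_vector_4_repeated zero_vec_def[symmetric])
  have perp: "ip G a (J *v T) = 0" "ip G ?b (J *v T) = 0"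
    using T ip_J_skew[of a T] ip_J_J[of a T] by auto
  \<comment> \<open>The determinant alternates in its last two arguments.\<close>
  have swap: "?d (J *v T) T = - ?d T (J *v T)"
  proof -
    have "?d (T + J *v T) (T + J *v T) = 0" by (rule det_vector_4_repeated)
    then have "?d T T + ?d (J *v T) T + (?d T (J *v T) + ?d (J *v T) (J *v T)) = 0"
      by (simp only: linear_add[OF linear_det_vector_4(1)] linear_add[OF linear_det_vector_4(2)])
    then show ?thesis using det_vector_4_repeated(5)[of a ?b] by simp
  qed
  have kd: "?k * ?d T (J *v T) = 1" by (rule det_oriented[OF ori])
  have "J *v e i = ?R (e i)" for i
  proof -
    have 1: "J *v e 1 = ?R (e 1)"
      unfolding adapted_frame_simps(1) linear_cmul[OF linR] matrix_vector_mult_scaleR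
      using la by (simp add: Na ip_J_self)
    have 2: "J *v e 2 = ?R (e 2)"
      unfolding adapted_frame_simps(2) linear_cmul[OF linR] matrix_vector_mult_scaleR
      using la by (simp add: Na ip_J_self J_J ip_J_J)
    have 3: "J *v e 3 = ?R (e 3)"
    proof (rule eqI)
      fix i
      have P: "ip G Y (J *v T) = ?k * ?d T Y" if "Y \<in> {a, ?b, T, J *v T}" for Y
        using that kd perp by (auto simp: det_vector_4_repeated ip_J_self ip_J_J T)
      then have "ip G (e i) (J *v T) = ?k * ?d T (e i)"
        using exhaust_4[of i] by (elim disjE) (simp_all add: adapted_frame_simps ip_simps linear_cmul[OF linear_det_vector_4(2)])
      then show "ip G (e i) (J *v e 3) = ip G (e i) (?R (e 3))"
        using N_ip[of T "e i"] ip_sym[of "e i" "?N T"] T by (simp add: adapted_frame_simps(3) ip_simps)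
    qed
    have 4: "J *v e 4 = ?R (e 4)"
    proof (rule eqI)
      fix i
      have P: "ip G Y (- T) = ?k * ?d (J *v T) Y" if "Y \<in> {a, ?b, T, J *v T}" for Y
        using that kd T ip_J_self(2)[of T] swap by (auto simp: det_vector_4_repeated ip_simps)
      then have "ip G (e i) (- T) = ?k * ?d (J *v T) (e i)"
        using exhaust_4[of i] P[of a] P[of ?b] P[of T] P[of "J *v T"]
        by (elim disjE) (simp_all add: adapted_frame_simps ip_simps linear_cmul[OF linear_det_vector_4(2)] T det_vector_4_repeated)
      then show "ip G (e i) (J *v e 4) = ip G (e i) (?R (e 4))"
        using N_ip[of "J *v T" "e i"] ip_sym[of "e i" "?N (J *v T)"] perp
        by (simp add: adapted_frame_simps(4) ip_simps J_J)
    qed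
    show ?thesis using exhaust_4[of i] 1 2 3 4 by metis
  qed
  then show ?thesis by (rule linear_eq_on_frame[OF orthonormal matrix_vector_mul_linear linR])
qed

end

section \<open>The covariant derivative of an almost complex structure along a vertical vector\<close>

lemma exists_unit_orthogonal_pair:
  fixes G :: "real^4^4"
  assumes pos: "\<And>v. v \<noteq> 0 \<Longrightarrow> 0 < ip G v v" and sym: "transpose G = G"
  shows "\<exists>T. ip G p T = 0 \<and> ip G q T = 0 \<and> ip G T T = 1"
proof -
  have "dim {G *v p, G *v q} \<le> card {G *v p, G *v q}" by (rule dim_le_card') simp
  also have "\<dots> \<le> 2" by (simp add: card_insert_if)
  also have "\<dots> < DIM(real^4)" by simp
  finally obtain X where X: "X \<noteq> 0" "\<And>y. y \<in> span {G *v p, G *v q} \<Longrightarrow> orthogonal X y"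
    using orthogonal_to_subspace_exists by blast
  have "X \<bullet> (G *v p) = 0" "X \<bullet> (G *v q) = 0"
    using X(2)[OF span_base] by (auto simp: orthogonal_def)
  then have 0: "ip G p X = 0" "ip G q X = 0"
    using inner_matrix_vector[of p G X] inner_matrix_vector[of q G X] sym by (auto simp: ip_def inner_commute)
  have "ip G ((1 / sqrt (ip G X X)) *\<^sub>R X) ((1 / sqrt (ip G X X)) *\<^sub>R X) = 1"
    using pos[OF X(1)] by (simp add: ip_simps)
  then show ?thesis using 0 by (intro exI[of _ "(1 / sqrt (ip G X X)) *\<^sub>R X"]) (simp add: ip_simps)
qed

text \<open>The equation \<open>df \<circ> J = \<i> df\<close> for \<open>f = u + \<i> v\<close>, separated into real and imaginary parts.\<close>

definition complex_linear :: "(real^'n \<Rightarrow> real) \<Rightarrow> (real^'n \<Rightarrow> real) \<Rightarrow> (real^'n \<Rightarrow> real^'n^'n) \<Rightarrow> (real^'n::finite) set \<Rightarrow> bool" where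
  "complex_linear u v J T \<longleftrightarrow> (\<forall>y\<in>T. \<forall>X. frechet_derivative u (at y) (J y *v X) = - frechet_derivative v (at y) X
     \<and> frechet_derivative v (at y) (J y *v X) = frechet_derivative u (at y) X)"

lemma (in local_metric) complex_linear_grad:
  assumes T: "T \<subseteq> S" "y \<in> T" and u: "u differentiable (at y)" and v: "v differentiable (at y)"
    and cl: "complex_linear u v J T" and herm: "hermitian_structure (G y) (J y)"
  shows "J y *v grad G u y = grad G v y" "J y *v grad G v y = - grad G u y"
proof -
  have y: "y \<in> S" using T by auto
  note skew = hermitian_skew[OF herm]
  show *: "J y *v grad G u y = grad G v y"
    by (rule ip_eqI[OF y]) (use cl T in \<open>simp add: skew ip_grad[OF y u] ip_grad[OF y v] complex_linear_def\<close>)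
  show "J y *v grad G v y = - grad G u y" unfolding *[symmetric] by (rule hermitian_square[OF herm])
qed

lemma (in local_metric) complex_linear_null_pair:
  assumes T: "T \<subseteq> S" and u: "\<And>y. y \<in> T \<Longrightarrow> u differentiable (at y)" and v: "\<And>y. y \<in> T \<Longrightarrow> v differentiable (at y)"
    and cl: "complex_linear u v J T" and herm: "\<And>y. y \<in> T \<Longrightarrow> hermitian_structure (G y) (J y)"
  shows "null_pair u v T"
  unfolding null_pair_def
proof
  fix y assume y: "y \<in> T"
  then have yS: "y \<in> S" using T by auto
  have J: "J y *v grad G u y = grad G v y" "J y *v grad G v y = - grad G u y"
    using complex_linear_grad[OF T y u[OF y] v[OF y] cl herm[OF y]] by auto
  have iso: "ip (G y) (J y *v X) (J y *v Y) = ip (G y) X Y" for X Y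
    using herm[OF y] by (simp add: hermitian_structure_def)
  show "ip (G y) (grad G u y) (grad G u y) = ip (G y) (grad G v y) (grad G v y) \<and> ip (G y) (grad G u y) (grad G v y) = 0"
    using iso[of "grad G u y" "grad G u y"] iso[of "grad G u y" "grad G v y"] ip_commute[OF yS, of "grad G v y" "grad G u y"]
    unfolding J by (simp add: ip_simps)
qed

locale structure_on_chart = local_metric G S for G :: "real^4 \<Rightarrow> real^4^4" and S +
  fixes T u v J s
  assumes open_T: "open T" and T_S: "T \<subseteq> S"
    and u: "Ck_on 2 u T" and v: "Ck_on 2 v T"
    and regular: "y \<in> T \<Longrightarrow> grad G u y \<noteq> 0"
    and herm: "y \<in> T \<Longrightarrow> hermitian_structure (G y) (J y)"
    and cl: "complex_linear u v J T"
    and ori: "y \<in> T \<Longrightarrow> induces_orientation s (J y)" "\<bar>s\<bar> = 1"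
begin

lemma du: "y \<in> T \<Longrightarrow> u differentiable (at y)" and dv: "y \<in> T \<Longrightarrow> v differentiable (at y)"
  using Ck_on_differentiable[of 1] u v by (simp_all add: numeral_2_eq_2)

lemma J_grad: "y \<in> T \<Longrightarrow> J y *v grad G u y = grad G v y" "y \<in> T \<Longrightarrow> J y *v grad G v y = - grad G u y"
  by (rule complex_linear_grad(1)[OF T_S _ du dv cl herm]; assumption)
    (rule complex_linear_grad(2)[OF T_S _ du dv cl herm]; assumption)

lemma null: "null_pair u v T"
  by (rule complex_linear_null_pair[OF T_S du dv cl herm])

lemma adapted:
  assumes y: "y \<in> T" and t: "frechet_derivative u (at y) t = 0" "frechet_derivative v (at y) t = 0" "ip (G y) t t = 1"
  shows "adapted_point (G y) (J y) (grad G u y) t"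
proof
  have yS: "y \<in> S" using y T_S by auto
  show "transpose (G y) = G y" "\<And>v. v \<noteq> 0 \<Longrightarrow> 0 < ip (G y) v v" using sym_G pos_G yS by auto
  show "hermitian_structure (G y) (J y)" "grad G u y \<noteq> 0" using y herm regular by auto
  show "ip (G y) (grad G u y) t = 0" "ip (G y) (J y *v grad G u y) t = 0" "ip (G y) t t = 1"
    using t ip_grad[OF yS du[OF y]] ip_grad[OF yS dv[OF y]] J_grad[OF y] by simp_all
qed

text \<open>Differentiability follows from the algebraic conditions: \<open>J\<close> is a differentiable expression in the gradients of \<open>u\<close> and \<open>v\<close>, because \<open>J\<close> maps the former to the latter.\<close>

lemma differentiable_J:
  assumes x: "x \<in> T"
  shows "J differentiable (at x)"
proof -
  let ?a = "\<lambda>y. grad G u y" and ?b = "\<lambda>y. grad G v y" and ?l = "\<lambda>y. ip (G y) (grad G u y) (grad G u y)"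
  \<comment> \<open>The entries of the formula for \<open>J\<close>, with the gradient of \<open>v\<close> in place of \<open>J\<close> applied to the gradient of \<open>u\<close>.\<close>
  let ?R = "\<lambda>y. \<chi> k m. (1 / ?l y) * (pd m u y * ?b y $ k - pd m v y * ?a y $ k)
    + s * sqrt (det (G y)) / ?l y * (\<Sum>j\<in>UNIV. matrix_inv (G y) $ k $ j * det (vector [?a y, ?b y, axis m 1, axis j 1] :: real^4^4))"
  have point: "0 < det (G y) \<and> ?R y = J y" if y: "y \<in> T" for y
  proof -
    have yS: "y \<in> S" using y T_S by auto
    obtain t where t: "ip (G y) (?a y) t = 0" "ip (G y) (?b y) t = 0" "ip (G y) t t = 1"
      using exists_unit_orthogonal_pair[OF pos_G[OF yS] sym_G[OF yS]] by blast
    have "frechet_derivative u (at y) t = 0" "frechet_derivative v (at y) t = 0"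
      using t(1,2) unfolding ip_grad[OF yS du[OF y]] ip_grad[OF yS dv[OF y]] .
    then interpret p: adapted_point "G y" "J y" "?a y" t
      using t(3) by (rule adapted[OF y])
    have "(J y *v axis m 1) $ k = ?R y $ k $ m" for k m
    proof -
      have ipa: "ip (G y) (?a y) (axis m 1) = pd m u y" "ip (G y) (?b y) (axis m 1) = pd m v y"
        using ip_grad[OF yS du[OF y]] ip_grad[OF yS dv[OF y]] by (simp_all add: pd_def)
      note f = p.structure_formula[OF ori(1)[OF y] ori(2), of "axis m 1"]
      have "(J y *v axis m 1) $ k = ((1 / ?l y) *\<^sub>R (pd m u y *\<^sub>R ?b y - pd m v y *\<^sub>R ?a y) + (s * sqrt (det (G y)) / ?l y) *\<^sub>R
        (matrix_inv (G y) *v (\<chi> j. det (vector [?a y, ?b y, axis m 1, axis j 1] :: real^4^4)))) $ k"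
        using f unfolding J_grad(1)[OF y] ipa by (rule arg_cong)
      then show ?thesis by (simp only: matrix_vector_mult_def[of "matrix_inv (G y)"]) simp
    qed
    then have "J y = ?R y"
      by (simp add: vec_eq_iff matrix_vector_mult_basis column_def)
    then show ?thesis using p.det_pos by simp
  qed
  have S1: "Ck_on (Suc 0) f T" if "Ck_on (Suc 0) f S" for f :: "real^4 \<Rightarrow> real" using Ck_on_subset[OF that T_S] .
  have u2: "Ck_on (Suc (Suc 0)) u T" and v2: "Ck_on (Suc (Suc 0)) v T" using u v by (simp_all add: numeral_2_eq_2)
  have a: "Ck_on (Suc 0) ?a T" and b: "Ck_on (Suc 0) ?b T"
    using Ck_grad[OF open_T T_S u2] Ck_grad[OF open_T T_S v2] by auto
  have GT: "Ck_on (Suc 0) G T" and GiT: "Ck_on (Suc 0) (\<lambda>y. matrix_inv (G y)) T"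
    using Ck_on_subset[OF Ck_G T_S] Ck_on_subset[OF Ck_G_inv T_S] by auto
  have l: "Ck_on (Suc 0) ?l T"
    unfolding ip_def by (intro Ck_on_inner Ck_on_bilinear[OF _ bounded_bilinear_matrix_vector] open_T a GT)
  have lnz: "?l y \<noteq> 0" if "y \<in> T" for y using pos_G[OF _ regular[OF that]] that T_S by force
  have pu: "Ck_on (Suc 0) (pd m u) T" and pv: "Ck_on (Suc 0) (pd m v) T" for m
    using Ck_on_pd[OF u2] Ck_on_pd[OF v2] by auto
  have dets: "Ck_on (Suc 0) (\<lambda>y. det (vector [?a y, ?b y, axis m 1, axis j 1] :: real^4^4)) T" for m j
  proof (rule Ck_on_det[OF open_T])
    fix i k :: 4
    show "Ck_on (Suc 0) (\<lambda>y. (vector [?a y, ?b y, axis m 1, axis j 1] :: real^4^4) $ i $ k) T"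
      using exhaust_4[of i] by (elim disjE) (simp_all add: Ck_on_nth[OF open_T a] Ck_on_nth[OF open_T b] Ck_on_const[OF open_T])
  qed
  have sq: "Ck_on (Suc 0) (\<lambda>y. sqrt (det (G y))) T"
    by (rule Ck_on_sqrt[OF open_T Ck_on_det[OF open_T]]) (use point in \<open>auto intro!: Ck_on_nth open_T GT\<close>)
  have "Ck_on (Suc 0) ?R T"
  proof (rule Ck_on_vec[OF open_T], rule Ck_on_vec[OF open_T])
    fix k m
    show "Ck_on (Suc 0) (\<lambda>y. ?R y $ k $ m) T"
      unfolding vec_lambda_beta
      by (intro Ck_on_add Ck_on_diff Ck_on_mult_real Ck_on_divide Ck_on_const Ck_on_sum Ck_on_nth open_T a b l lnz pu pv sq GiT dets)
  qed
  then have "Ck_on (Suc 0) J T"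
    by (rule Ck_on_cong[OF open_T]) (use point in blast)
  then show ?thesis by (rule Ck_on_differentiable[OF _ x])
qed

context
  fixes x t :: "real^4" assumes x: "x \<in> T"
begin

abbreviation "J' \<equiv> frechet_derivative J (at x)"
abbreviation "D \<equiv> cov_deriv_endo G J x t"

lemma x_S: "x \<in> S" using x T_S by auto

lemma has_derivative_J: "(J has_derivative J') (at x)"
  using differentiable_J[OF x] frechet_derivative_works by blast

lemma has_derivative_J_vector: "((\<lambda>y. J y *v X) has_derivative (\<lambda>h. J' h *v X)) (at x)"
  using bounded_bilinear.FDERIV[OF bounded_bilinear_matrix_vector has_derivative_J has_derivative_const[of X]] by simp

lemma D_vector: "D *v X = J' t *v X + Gam x t (J x *v X) - J x *v Gam x t X"
  by (simp add: cov_deriv_endo_def matrix_vector_mult_add_rdistrib matrix_vector_mult_diff_rdistrib matrix_vector_mul_assoc)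

lemma cov_deriv_J_vector: "cov_deriv G (\<lambda>y. J y *v X) x t = J' t *v X + Gam x t (J x *v X)"
  by (simp add: cov_deriv_def frechet_derivative_at[OF has_derivative_J_vector, symmetric])

text \<open>The covariant derivative of \<open>J \<circ> J = - 1\<close>.\<close>

lemma D_anticommutes: "D ** J x = - (J x ** D)"
proof -
  have "((\<lambda>y. J y ** J y) has_derivative (\<lambda>h. J x ** J' h + J' h ** J x)) (at x)"
    by (rule bounded_bilinear.FDERIV[OF bounded_bilinear_matrix_matrix has_derivative_J has_derivative_J])
  moreover have "((\<lambda>y. J y ** J y) has_derivative (\<lambda>h. 0)) (at x)"
    by (rule has_derivative_transform_within_open[OF has_derivative_const[of "- mat 1"] open_T x])
       (use herm in \<open>simp add: hermitian_structure_def\<close>)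
  ultimately have "J x ** J' t + J' t ** J x = 0" using has_derivative_unique by (metis (no_types, lifting))
  moreover have JJ: "J x ** J x = - mat 1" using herm[OF x] by (simp add: hermitian_structure_def)
  let ?C = "connection_matrix G x t"
  have "D ** J x + J x ** D = (J' t ** J x + J x ** J' t) + ?C ** (J x ** J x) - (J x ** J x) ** ?C"
    by (simp add: cov_deriv_endo_def matrix_mul_assoc
        bounded_bilinear.add_left[OF bounded_bilinear_matrix_matrix] bounded_bilinear.add_right[OF bounded_bilinear_matrix_matrix]
        bounded_bilinear.diff_left[OF bounded_bilinear_matrix_matrix] bounded_bilinear.diff_right[OF bounded_bilinear_matrix_matrix])
  moreover have "?C ** (- mat 1) = - ?C" "(- mat 1) ** ?C = - ?C"
    using bounded_bilinear.minus_left[OF bounded_bilinear_matrix_matrix, of "mat 1" ?C]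
      bounded_bilinear.minus_right[OF bounded_bilinear_matrix_matrix, of ?C "mat 1"] by simp_all
  ultimately have "D ** J x + J x ** D = 0" by (simp add: JJ add.commute)
  then show ?thesis by (simp add: eq_neg_iff_add_eq_0)
qed

lemma J_skew: "y \<in> T \<Longrightarrow> ip (G y) (J y *v X) Y = - ip (G y) X (J y *v Y)"
  by (rule hermitian_skew[OF herm])

text \<open>The covariant derivative of the skewness of \<open>J\<close>, which is equivalent to \<open>J\<close> being an isometry.\<close>

lemma D_skew: "ip (G x) (D *v X) Y = - ip (G x) X (D *v Y)"
proof -
  note d1 = ip_has_derivative[OF x_S has_derivative_J_vector[of X] has_derivative_const[of Y]]
  note d2 = ip_has_derivative[OF x_S has_derivative_const[of X] has_derivative_J_vector[of Y]]
  have "((\<lambda>y. ip (G y) (J y *v X) Y + ip (G y) X (J y *v Y)) has_derivative (\<lambda>h. 0)) (at x)"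
    by (rule has_derivative_transform_within_open[OF has_derivative_const[of 0] open_T x]) (simp add: J_skew)
  from fun_cong[OF has_derivative_unique[OF this has_derivative_add[OF d1 d2]], of t]
  have "0 = ip (G x) (J' t *v X + Gam x t (J x *v X)) Y + ip (G x) (J x *v X) (Gam x t Y)
    + (ip (G x) (Gam x t X) (J x *v Y) + ip (G x) X (J' t *v Y + Gam x t (J x *v Y)))"
    by (simp add: cov_deriv_J_vector) (simp add: cov_deriv_def)
  then show ?thesis
    unfolding D_vector using J_skew[OF x, of X "Gam x t Y"] J_skew[OF x, of "Gam x t X" Y] by (simp add: ip_simps)
qed

text \<open>The covariant derivatives of \<open>du \<circ> J = - dv\<close> and \<open>dv \<circ> J = du\<close>.\<close>

lemma D_du: "frechet_derivative u (at x) (D *v X) = - hess G v x t X - hess G u x t (J x *v X)"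
  and D_dv: "frechet_derivative v (at x) (D *v X) = hess G u x t X - hess G v x t (J x *v X)"
proof -
  have g: "(grad G u has_derivative frechet_derivative (grad G u) (at x)) (at x)"
    "(grad G v has_derivative frechet_derivative (grad G v) (at x)) (at x)"
    using Ck_on_SucD[OF _ x] Ck_grad[OF open_T T_S, of "Suc 0"] u v by (auto simp: numeral_2_eq_2)
  let ?u = "frechet_derivative u (at x)" and ?v = "frechet_derivative v (at x)"
  have lin: "linear ?u" "linear ?v" using du[OF x] dv[OF x] linear_frechet_derivative by auto
  note gu = ip_grad[OF x_S du[OF x]] and gv = ip_grad[OF x_S dv[OF x]]
  have J: "?u (J x *v X) = - ?v X" "?v (J x *v X) = ?u X" for X using cl x by (auto simp: complex_linear_def)
  have e1: "ip (G y) (grad G u y) (J y *v X) + ip (G y) (grad G v y) X = 0"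
    and e2: "ip (G y) (grad G v y) (J y *v X) - ip (G y) (grad G u y) X = 0" if "y \<in> T" for y
    using that T_S cl by (auto simp: complex_linear_def ip_grad du dv subset_iff)
  have "((\<lambda>y. ip (G y) (grad G u y) (J y *v X) + ip (G y) (grad G v y) X) has_derivative (\<lambda>h. 0)) (at x)"
    by (rule has_derivative_transform_within_open[OF has_derivative_const[of 0] open_T x]) (simp add: e1)
  from fun_cong[OF has_derivative_unique[OF this has_derivative_add[OF ip_has_derivative[OF x_S g(1) has_derivative_J_vector[of X]]
      ip_has_derivative[OF x_S g(2) has_derivative_const[of X]]]], of t]
  have "0 = hess G u x t (J x *v X) + ?u (J' t *v X + Gam x t (J x *v X)) + (hess G v x t X + ?v (Gam x t X))"
    by (simp add: cov_deriv_J_vector ip_cov_deriv_grad[OF open_T T_S x u] ip_cov_deriv_grad[OF open_T T_S x v] gu gv)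
       (simp add: cov_deriv_def gv)
  then show "?u (D *v X) = - hess G v x t X - hess G u x t (J x *v X)"
    unfolding D_vector by (simp add: linear_diff[OF lin(1)] J)
  have "((\<lambda>y. ip (G y) (grad G v y) (J y *v X) - ip (G y) (grad G u y) X) has_derivative (\<lambda>h. 0)) (at x)"
    by (rule has_derivative_transform_within_open[OF has_derivative_const[of 0] open_T x]) (simp add: e2)
  from fun_cong[OF has_derivative_unique[OF this has_derivative_diff[OF ip_has_derivative[OF x_S g(2) has_derivative_J_vector[of X]]
      ip_has_derivative[OF x_S g(1) has_derivative_const[of X]]]], of t]
  have "0 = hess G v x t (J x *v X) + ?v (J' t *v X + Gam x t (J x *v X)) - (hess G u x t X + ?u (Gam x t X))"
    by (simp add: cov_deriv_J_vector ip_cov_deriv_grad[OF open_T T_S x u] ip_cov_deriv_grad[OF open_T T_S x v] gu gv)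
       (simp add: cov_deriv_def gu)
  then show "?v (D *v X) = hess G u x t X - hess G v x t (J x *v X)"
    unfolding D_vector by (simp add: linear_diff[OF lin(2)] J)
qed

lemma endo_norm_D:
  assumes t: "frechet_derivative u (at x) t = 0" "frechet_derivative v (at x) t = 0" "ip (G x) t t = 1"
  shows "endo_norm (G x) D = 2 / sqrt (ip (G x) (grad G u x) (grad G u x)) *
    sqrt ((hess G v x t t + hess G u x t (J x *v t))\<^sup>2 + (hess G u x t t - hess G v x t (J x *v t))\<^sup>2)"
proof -
  interpret p: adapted_point "G x" "J x" "grad G u x" t by (rule adapted[OF x t])
  have "ip (G x) (grad G u x) (D *v t) = - (hess G v x t t + hess G u x t (J x *v t))"
    using D_du[of t] ip_grad[OF x_S du[OF x]] by simp
  then have 1: "(ip (G x) (grad G u x) (D *v t))\<^sup>2 = (hess G v x t t + hess G u x t (J x *v t))\<^sup>2"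
    by (simp only: power2_minus)
  have 2: "ip (G x) (J x *v grad G u x) (D *v t) = hess G u x t t - hess G v x t (J x *v t)"
    using D_dv[of t] ip_grad[OF x_S dv[OF x]] J_grad(1)[OF x] by simp
  show ?thesis
    using p.endo_norm_anticommuting[OF D_skew D_anticommutes] unfolding 1 2 .
qed

end

end

text \<open>Both structures preserve the vertical plane and are isometries of square \<open>- 1\<close>, so they agree there up to sign; if they agreed, they would induce the same orientation.\<close>

lemma opposite_structures_vertical:
  assumes p: "adapted_point G Jp a t" and m: "adapted_point G Jm a t" and eq: "Jp *v a = Jm *v a"
    and ori: "induces_orientation 1 Jp" "induces_orientation (- 1) Jm"
  shows "Jm *v t = - (Jp *v t)"
proof -
  interpret p: adapted_point G Jp a t by (rule p)
  interpret m: adapted_point G Jm a t by (rule m)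
  let ?c = "ip G (Jp *v t) (Jm *v t)"
  have "ip G a (Jm *v t) = 0" using m.T(2) m.ip_J_skew[of a t] by simp
  moreover have "ip G (Jp *v a) (Jm *v t) = 0" using m.T(1) by (simp add: eq m.ip_J_J)
  moreover have "ip G t (Jm *v t) = 0" by (rule m.ip_J_self)
  ultimately have coef: "ip G (adapted_frame G Jp a t 1) (Jm *v t) = 0" "ip G (adapted_frame G Jp a t 2) (Jm *v t) = 0"
    "ip G (adapted_frame G Jp a t 3) (Jm *v t) = 0"
    by (simp_all add: p.adapted_frame_simps ip_simps)
  have "Jm *v t = (\<Sum>i\<in>UNIV. ip G (adapted_frame G Jp a t i) (Jm *v t) *\<^sub>R adapted_frame G Jp a t i)"
    by (rule frame_expansion[OF p.orthonormal])
  also have "\<dots> = ?c *\<^sub>R (Jp *v t)"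
    unfolding sum_4 coef by (simp add: p.adapted_frame_simps)
  finally have Jm: "Jm *v t = ?c *\<^sub>R (Jp *v t)" .
  have "ip G (Jm *v t) (Jm *v t) = 1" using m.T(3) by (simp add: m.ip_J_J)
  then have "?c * ?c = 1"
    using p.T(3) by (subst (asm) (1 2) Jm) (simp add: ip_simps p.ip_J_J)
  then have c: "?c = 1 \<or> ?c = - 1" by (simp add: square_eq_1_iff)
  have "?c \<noteq> 1"
  proof
    assume "?c = 1"
    then have same: "Jm *v t = Jp *v t" using Jm by simp
    have "- (1 * sqrt (det G) / ip G a a * det (vector [a, Jp *v a, t, Jp *v t] :: real^4^4)) = 1"
      using m.det_oriented[OF ori(2)] unfolding same eq[symmetric] by simp
    then show False unfolding p.det_oriented[OF ori(1) abs_one] by simp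
  qed
  then show ?thesis using c Jm by auto
qed

section \<open>Change of chart\<close>

text \<open>The coordinate change \<open>\<phi>\<close> is an isometry from \<open>U\<close>, a subset of the chart with metric \<open>G'\<close>, into the chart with metric \<open>G\<close>. The bound of the theorem holds in every chart, while the compactness argument is carried out in finitely many; hence gradients and Hessians have to be compared.\<close>

locale chart_change = M': local_metric G' S' + M: local_metric G S
  for G' :: "real^'n \<Rightarrow> real^'n^'n::finite" and S' and G :: "real^'n \<Rightarrow> real^'n^'n" and S +
  fixes \<phi> :: "real^'n \<Rightarrow> real^'n" and U
  assumes open_U: "open U" and U_S': "U \<subseteq> S'" and image_S: "\<phi> ` U \<subseteq> S" and Ck_\<phi>: "Ck_on k \<phi> U"
    and metric: "y \<in> U \<Longrightarrow> G' y = transpose (jacobian \<phi> (at y)) ** G (\<phi> y) ** jacobian \<phi> (at y)"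
begin

abbreviation P where "P y \<equiv> frechet_derivative \<phi> (at y)"

lemma has_derivative_\<phi>: "y \<in> U \<Longrightarrow> (\<phi> has_derivative P y) (at y)"
  using Ck_on_SucD[OF Ck_\<phi>[of "Suc 0"]] .

lemma linear_P: "y \<in> U \<Longrightarrow> linear (P y)"
  using has_derivative_\<phi> has_derivative_linear by blast

lemma jacobian_P: "y \<in> U \<Longrightarrow> jacobian \<phi> (at y) *v X = P y X"
  unfolding jacobian_def using fun_cong[OF matrix_vector_mul(2)[OF linear_P]] .

lemma isometry: assumes y: "y \<in> U" shows "ip (G' y) X Y = ip (G (\<phi> y)) (P y X) (P y Y)"
proof -
  have "G' y *v Y = transpose (jacobian \<phi> (at y)) *v (G (\<phi> y) *v (jacobian \<phi> (at y) *v Y))"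
    by (simp add: metric[OF y] matrix_vector_mul_assoc matrix_mul_assoc)
  then show ?thesis
    using inner_matrix_vector[of X "transpose (jacobian \<phi> (at y))"] by (simp add: ip_def jacobian_P[OF y])
qed

lemma surj_P: assumes y: "y \<in> U" shows "\<exists>Z. P y Z = W"
proof -
  have "v = 0" if "P y v = 0" for v
    using isometry[OF y, of v v] M'.pos_G[of y v] U_S' y that by (force simp: ip_simps)
  then have "inj (P y)" using linear_injective_0[OF linear_P[OF y]] by blast
  then have "surj (P y)" using linear_injective_imp_surjective linear_P[OF y] by blast
  then show ?thesis by (metis surjD)
qed

lemma grad_pullback:
  assumes y: "y \<in> U" and f: "f differentiable (at (\<phi> y))"
  shows "P y (grad G' (\<lambda>x. f (\<phi> x)) y) = grad G f (\<phi> y)"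
proof (rule M.ip_eqI)
  show yS: "\<phi> y \<in> S" using y image_S by auto
  fix W
  obtain Z where Z: "P y Z = W" using surj_P[OF y] by blast
  have D: "((\<lambda>x. f (\<phi> x)) has_derivative (\<lambda>X. frechet_derivative f (at (\<phi> y)) (P y X))) (at y)"
    using diff_chain_at[OF has_derivative_\<phi>[OF y] f[unfolded frechet_derivative_works]] by (simp add: o_def)
  have "ip (G (\<phi> y)) (P y (grad G' (\<lambda>x. f (\<phi> x)) y)) W = ip (G' y) (grad G' (\<lambda>x. f (\<phi> x)) y) Z"
    by (simp add: isometry[OF y] Z)
  also have "\<dots> = frechet_derivative (\<lambda>x. f (\<phi> x)) (at y) Z"
    by (rule M'.ip_grad) (use y U_S' D in \<open>auto simp: differentiable_def\<close>)
  also have "\<dots> = frechet_derivative f (at (\<phi> y)) W"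
    unfolding frechet_derivative_at[OF D, symmetric] Z ..
  also have "\<dots> = ip (G (\<phi> y)) (grad G f (\<phi> y)) W" by (rule M.ip_grad[OF yS f, symmetric])
  finally show "ip (G (\<phi> y)) (P y (grad G' (\<lambda>x. f (\<phi> x)) y)) W = ip (G (\<phi> y)) (grad G f (\<phi> y)) W" .
qed

text \<open>Both sides have the same inner products with all vectors, by the Koszul formula; the derivatives of the metric are related by differentiating the isometry condition, and symmetry of second derivatives removes the superfluous terms.\<close>

lemma connection_pullback:
  assumes x: "x \<in> U"
  shows "P x (M'.Gam x X Y) = M.Gam (\<phi> x) (P x X) (P x Y) + frechet_derivative (\<lambda>y. P y Y) (at x) X"
proof -
  let ?H = "\<lambda>X Y. frechet_derivative (\<lambda>y. P y Y) (at x) X"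
  let ?G = "G (\<phi> x)" and ?p = "P x"
  have xS: "\<phi> x \<in> S" and xS': "x \<in> S'" using x image_S U_S' by auto
  have Hd: "((\<lambda>y. P y Y) has_derivative (\<lambda>X. ?H X Y)) (at x)" for Y
    using Ck_on_SucD[OF Ck_on_SucD2[OF Ck_\<phi>[of "Suc (Suc 0)"]] x] .
  have Hsym: "?H X Y = ?H Y X" for X Y
    by (rule symmetric_second_derivative[OF open_U x Ck_\<phi>])
  have dG': "Y \<bullet> (M'.dG x X *v Z) = ?p Y \<bullet> (M.dG (\<phi> x) (?p X) *v ?p Z) + ip ?G (?H X Y) (?p Z) + ip ?G (?p Y) (?H X Z)" for X Y Z
  proof -
    have "((\<lambda>y. Y \<bullet> (G' y *v Z)) has_derivative (\<lambda>X. Y \<bullet> (M'.dG x X *v Z))) (at x)"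
      using has_derivative_inner[OF has_derivative_const[of Y]
        bounded_bilinear.FDERIV[OF bounded_bilinear_matrix_vector M'.has_derivative_G[OF xS'] has_derivative_const[of Z]]] by simp
    moreover have "((\<lambda>y. Y \<bullet> (G' y *v Z)) has_derivative
      (\<lambda>X. P x Y \<bullet> (G (\<phi> x) *v ?H X Z + M.dG (\<phi> x) (?p X) *v P x Z) + ?H X Y \<bullet> (G (\<phi> x) *v P x Z))) (at x)"
    proof (rule has_derivative_transform_within_open[OF _ open_U x])
      show "((\<lambda>y. P y Y \<bullet> (G (\<phi> y) *v P y Z)) has_derivative
        (\<lambda>X. P x Y \<bullet> (G (\<phi> x) *v ?H X Z + M.dG (\<phi> x) (?p X) *v P x Z) + ?H X Y \<bullet> (G (\<phi> x) *v P x Z))) (at x)"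
        by (intro has_derivative_inner Hd bounded_bilinear.FDERIV[OF bounded_bilinear_matrix_vector]
            diff_chain_at[OF has_derivative_\<phi>[OF x] M.has_derivative_G[OF xS], unfolded o_def])
      show "P y Y \<bullet> (G (\<phi> y) *v P y Z) = Y \<bullet> (G' y *v Z)" if "y \<in> U" for y
        using isometry[OF that, of Y Z] by (simp add: ip_def)
    qed
    ultimately have "(\<lambda>X. Y \<bullet> (M'.dG x X *v Z)) =
      (\<lambda>X. P x Y \<bullet> (G (\<phi> x) *v ?H X Z + M.dG (\<phi> x) (?p X) *v P x Z) + ?H X Y \<bullet> (G (\<phi> x) *v P x Z))"
      by (rule has_derivative_unique)
    from fun_cong[OF this, of X] show ?thesis by (simp add: ip_def inner_add_right)
  qed
  show ?thesis
  proof (rule M.ip_eqI[OF xS])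
    fix W
    obtain Z where Z: "W = ?p Z" using surj_P[OF x] by metis
    have "2 * ip ?G (?p (M'.Gam x X Y)) (?p Z) = 2 * ip (G' x) (M'.Gam x X Y) Z" by (simp add: isometry[OF x])
    also have "\<dots> = Y \<bullet> (M'.dG x X *v Z) + X \<bullet> (M'.dG x Y *v Z) - X \<bullet> (M'.dG x Z *v Y)"
      by (rule M'.koszul[OF xS'])
    also have "\<dots> = (?p Y \<bullet> (M.dG (\<phi> x) (?p X) *v ?p Z) + ?p X \<bullet> (M.dG (\<phi> x) (?p Y) *v ?p Z) - ?p X \<bullet> (M.dG (\<phi> x) (?p Z) *v ?p Y))
       + 2 * ip ?G (?H X Y) (?p Z)"
      unfolding dG' Hsym[of Z X] Hsym[of Z Y] Hsym[of Y X]
      using M.ip_commute[OF xS, of "?p Y" "?H X Z"] M.ip_commute[OF xS, of "?p Y" "?H Z X"] by simp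
    also have "\<dots> = 2 * ip ?G (M.Gam (\<phi> x) (?p X) (?p Y)) (?p Z) + 2 * ip ?G (?H X Y) (?p Z)"
      unfolding M.koszul[OF xS] ..
    finally show "ip ?G (?p (M'.Gam x X Y)) W = ip ?G (M.Gam (\<phi> x) (?p X) (?p Y) + ?H X Y) W"
      unfolding Z by (simp add: ip_simps)
  qed
qed

lemma hess_pullback:
  assumes x: "x \<in> U" and V: "open V" "\<phi> ` U \<subseteq> V" and f: "Ck_on 2 f V"
  shows "hess G' (\<lambda>y. f (\<phi> y)) x X Y = hess G f (\<phi> x) (P x X) (P x Y)"
proof -
  let ?H = "\<lambda>X Y. frechet_derivative (\<lambda>y. P y Y) (at x) X"
  have f2: "Ck_on (Suc (Suc 0)) f V" using f by (simp add: numeral_2_eq_2)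
  have xV: "\<phi> y \<in> V" if "y \<in> U" for y using V(2) that by auto
  have fd: "f differentiable (at (\<phi> y))" if "y \<in> U" for y by (rule Ck_on_differentiable[OF f2 xV[OF that]])
  have D1: "frechet_derivative (\<lambda>y. f (\<phi> y)) (at y) Z = frechet_derivative f (at (\<phi> y)) (P y Z)" if y: "y \<in> U" for y Z
    using fun_cong[OF frechet_derivative_at[OF diff_chain_at[OF has_derivative_\<phi>[OF y] fd[OF y, unfolded frechet_derivative_works]]], of Z]
    by (simp add: o_def)
  have exp: "frechet_derivative f (at (\<phi> y)) W = (\<Sum>k\<in>UNIV. W $ k * pd k f (\<phi> y))" if y: "y \<in> U" for y W
  proof -
    have e: "(\<Sum>k\<in>UNIV. W $ k *\<^sub>R axis k 1) = W" using basis_expansion[of W] by (simp add: scalar_mult_eq_scaleR)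
    have "frechet_derivative f (at (\<phi> y)) (\<Sum>k\<in>UNIV. W $ k *\<^sub>R axis k 1) = (\<Sum>k\<in>UNIV. W $ k * pd k f (\<phi> y))"
      unfolding pd_def using linear_frechet_derivative[OF fd[OF y]] by (simp add: linear_sum linear_cmul)
    then show ?thesis unfolding e .
  qed
  have Hd: "((\<lambda>y. P y Y $ k) has_derivative (\<lambda>X. ?H X Y $ k)) (at x)" for k
    by (rule bounded_linear.has_derivative[OF bounded_linear_vec_nth Ck_on_SucD[OF Ck_on_SucD2[OF Ck_\<phi>[of "Suc (Suc 0)"]] x]])
  have pdd: "((\<lambda>y. pd k f (\<phi> y)) has_derivative (\<lambda>X. frechet_derivative (pd k f) (at (\<phi> x)) (P x X))) (at x)" for k
    using diff_chain_at[OF has_derivative_\<phi>[OF x] Ck_on_SucD[OF Ck_on_pd[OF f2] xV[OF x]]] by (simp add: o_def)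
  have "((\<lambda>y. \<Sum>k\<in>UNIV. P y Y $ k * pd k f (\<phi> y)) has_derivative
    (\<lambda>X. \<Sum>k\<in>UNIV. P x Y $ k * frechet_derivative (pd k f) (at (\<phi> x)) (P x X) + ?H X Y $ k * pd k f (\<phi> x))) (at x)"
    by (intro has_derivative_sum has_derivative_mult Hd pdd)
  then have "((\<lambda>y. frechet_derivative (\<lambda>y. f (\<phi> y)) (at y) Y) has_derivative
    (\<lambda>X. \<Sum>k\<in>UNIV. P x Y $ k * frechet_derivative (pd k f) (at (\<phi> x)) (P x X) + ?H X Y $ k * pd k f (\<phi> x))) (at x)"
    by (rule has_derivative_transform_within_open[OF _ open_U x]) (simp only: D1 exp)
  from fun_cong[OF frechet_derivative_at[OF this], of X]
  have "frechet_derivative (\<lambda>y. frechet_derivative (\<lambda>y. f (\<phi> y)) (at y) Y) (at x) X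
    = (\<Sum>k\<in>UNIV. P x Y $ k * frechet_derivative (pd k f) (at (\<phi> x)) (P x X)) + frechet_derivative f (at (\<phi> x)) (?H X Y)"
    unfolding exp[OF x] by (simp add: sum.distrib)
  also have "(\<Sum>k\<in>UNIV. P x Y $ k * frechet_derivative (pd k f) (at (\<phi> x)) (P x X))
    = frechet_derivative (\<lambda>z. frechet_derivative f (at z) (P x Y)) (at (\<phi> x)) (P x X)"
  proof -
    let ?Q = "frechet_derivative (\<lambda>z. frechet_derivative f (at z) (P x X)) (at (\<phi> x))"
    have "frechet_derivative (pd k f) (at (\<phi> x)) (P x X) = ?Q (axis k 1)" for k
      using symmetric_second_derivative[OF V(1) xV[OF x] f, of "axis k 1" "P x X"] by (simp add: pd_def[abs_def])
    moreover have "linear ?Q"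
      using Ck_on_SucD[OF Ck_on_SucD2[OF f2] xV[OF x]] has_derivative_linear by blast
    ultimately have "(\<Sum>k\<in>UNIV. P x Y $ k * frechet_derivative (pd k f) (at (\<phi> x)) (P x X)) = ?Q (\<Sum>k\<in>UNIV. P x Y $ k *\<^sub>R axis k 1)"
      by (simp add: linear_sum linear_cmul)
    also have "(\<Sum>k\<in>UNIV. P x Y $ k *\<^sub>R axis k 1) = P x Y" using basis_expansion[of "P x Y"] by (simp add: scalar_mult_eq_scaleR)
    finally show ?thesis
      using symmetric_second_derivative[OF V(1) xV[OF x] f, of "P x X" "P x Y"] by simp
  qed
  finally show ?thesis
    using linear_frechet_derivative[OF fd[OF x]]
    by (simp add: hess_def D1[OF x] connection_pullback[OF x] linear_add)
qed

lemma null_pair_pullback: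
  assumes V: "\<phi> ` U \<subseteq> V" and u: "\<And>y. y \<in> V \<Longrightarrow> u differentiable (at y)" and v: "\<And>y. y \<in> V \<Longrightarrow> v differentiable (at y)"
    and null: "M.null_pair u v V"
  shows "M'.null_pair (\<lambda>y. u (\<phi> y)) (\<lambda>y. v (\<phi> y)) U"
  unfolding M'.null_pair_def
proof
  fix y assume y: "y \<in> U"
  then have yV: "\<phi> y \<in> V" using V by auto
  show "ip (G' y) (grad G' (\<lambda>y. u (\<phi> y)) y) (grad G' (\<lambda>y. u (\<phi> y)) y)
        = ip (G' y) (grad G' (\<lambda>y. v (\<phi> y)) y) (grad G' (\<lambda>y. v (\<phi> y)) y) \<and>
      ip (G' y) (grad G' (\<lambda>y. u (\<phi> y)) y) (grad G' (\<lambda>y. v (\<phi> y)) y) = 0"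
    unfolding isometry[OF y] grad_pullback[OF y u[OF yV]] grad_pullback[OF y v[OF yV]]
    using null yV by (simp add: M.null_pair_def)
qed

end

text \<open>Continuity of the components bounds the Ricci form by the Euclidean norms, and by compactness of the unit sphere bundle the metric dominates a multiple of the squared Euclidean norm.\<close>

lemma (in local_metric) Ric_bound_on_compact:
  assumes Q: "compact Q" "Q \<subseteq> S"
  shows "\<exists>C\<ge>0. \<forall>x\<in>Q. \<forall>X Y r. ip (G x) X X = r \<longrightarrow> ip (G x) Y Y = r \<longrightarrow> \<bar>Ric x X Y\<bar> \<le> C * r"
proof (cases "Q = {}")
  case True
  then show ?thesis by auto
next
  case False
  have "continuous_on Q (\<lambda>x. \<Sum>i\<in>UNIV. \<Sum>j\<in>UNIV. \<bar>ric i j x\<bar>)"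
    by (intro continuous_intros continuous_on_subset[OF Ck_ric Q(2)])
  then have "compact ((\<lambda>x. \<Sum>i\<in>UNIV. \<Sum>j\<in>UNIV. \<bar>ric i j x\<bar>) ` Q)" using Q by (intro compact_continuous_image)
  then have "bounded ((\<lambda>x. \<Sum>i\<in>UNIV. \<Sum>j\<in>UNIV. \<bar>ric i j x\<bar>) ` Q)" by (rule compact_imp_bounded)
  then obtain R where "\<forall>y\<in>(\<lambda>x. \<Sum>i\<in>UNIV. \<Sum>j\<in>UNIV. \<bar>ric i j x\<bar>) ` Q. \<bar>y\<bar> \<le> R"
    unfolding bounded_real by (rule exE)
  then have R: "(\<Sum>i\<in>UNIV. \<Sum>j\<in>UNIV. \<bar>ric i j x\<bar>) \<le> R" if "x \<in> Q" for x
    using abs_le_D1 that by blast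
  let ?K = "Q \<times> sphere 0 1 :: ((real^'n) \<times> (real^'n)) set"
  have "continuous_on ?K (\<lambda>p. ip (G (fst p)) (snd p) (snd p))"
  proof -
    have "continuous_on ?K (\<lambda>p. G (fst p))"
      by (rule continuous_on_compose2[OF Ck_on_continuous[OF Ck_G[of 0]]]) (use Q in \<open>auto intro!: continuous_intros\<close>)
    then show ?thesis
      unfolding ip_def by (intro continuous_intros bounded_bilinear.continuous_on[OF bounded_bilinear_matrix_vector])
  qed
  moreover have "compact ?K" using Q by (intro compact_Times compact_sphere)
  moreover have "?K \<noteq> {}" using False by (auto simp: sphere_eq_empty)
  ultimately obtain p where p: "p \<in> ?K" "\<And>q. q \<in> ?K \<Longrightarrow> ip (G (fst p)) (snd p) (snd p) \<le> ip (G (fst q)) (snd q) (snd q)"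
    using continuous_attains_inf[of ?K "\<lambda>p. ip (G (fst p)) (snd p) (snd p)"] by blast
  define \<kappa> where "\<kappa> = ip (G (fst p)) (snd p) (snd p)"
  have \<kappa>: "0 < \<kappa>" unfolding \<kappa>_def by (rule pos_G) (use p(1) Q in auto)
  have lower: "\<kappa> * (norm X)\<^sup>2 \<le> ip (G x) X X" if x: "x \<in> Q" for x X
  proof (cases "X = 0")
    case False
    have "\<kappa> \<le> ip (G x) ((1 / norm X) *\<^sub>R X) ((1 / norm X) *\<^sub>R X)"
      unfolding \<kappa>_def using p(2)[of "(x, (1 / norm X) *\<^sub>R X)"] x False by simp
    then show ?thesis using False by (simp add: ip_simps power2_eq_square field_simps)
  qed (simp add: ip_simps)
  have "0 \<le> R"
  proof -
    obtain x where "x \<in> Q" using False by auto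
    have "0 \<le> (\<Sum>i\<in>UNIV. \<Sum>j\<in>UNIV. \<bar>ric i j x\<bar>)" by (intro sum_nonneg) auto
    then show ?thesis using R[OF \<open>x \<in> Q\<close>] by linarith
  qed
  have "\<bar>Ric x X Y\<bar> \<le> R / \<kappa> * r" if x: "x \<in> Q" and r: "ip (G x) X X = r" "ip (G x) Y Y = r" for x X Y r
  proof -
    have "\<bar>Ric x X Y\<bar> \<le> (\<Sum>i\<in>UNIV. \<Sum>j\<in>UNIV. \<bar>ric i j x * X $ i * Y $ j\<bar>)"
      by (rule order_trans[OF sum_abs]) (intro sum_mono sum_abs)
    also have "\<dots> \<le> (\<Sum>i\<in>UNIV. \<Sum>j\<in>UNIV. \<bar>ric i j x\<bar> * (norm X * norm Y))"
      unfolding abs_mult mult.assoc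
      by (intro sum_mono mult_left_mono mult_mono component_le_norm_cart) auto
    also have "\<dots> = (\<Sum>i\<in>UNIV. \<Sum>j\<in>UNIV. \<bar>ric i j x\<bar>) * (norm X * norm Y)"
      by (simp add: sum_distrib_right)
    also have "\<dots> \<le> R * (r / \<kappa>)"
    proof (rule mult_mono)
      have "norm X * norm Y \<le> ((norm X)\<^sup>2 + (norm Y)\<^sup>2) / 2"
        using sum_squares_bound[of "norm X" "norm Y"] by simp
      moreover have "(norm X)\<^sup>2 \<le> r / \<kappa>" "(norm Y)\<^sup>2 \<le> r / \<kappa>"
        using lower[OF x, of X] lower[OF x, of Y] r \<kappa> by (simp_all add: field_simps)
      ultimately show "norm X * norm Y \<le> r / \<kappa>" by simp
    qed (use R[OF x] \<open>0 \<le> R\<close> in auto)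
    finally show ?thesis by simp
  qed
  then show ?thesis using \<open>0 \<le> R\<close> \<kappa> by (intro exI[of _ "R / \<kappa>"]) auto
qed

section \<open>Isothermal functions on a surface\<close>

text \<open>The entries of a compatible complex structure in terms of the metric; the sign of the upper right entry is fixed by the orientation.\<close>

lemma surface_structure_entries:
  fixes H j :: "real^2^2"
  assumes sym: "transpose H = H" and pos: "\<And>v. v \<noteq> 0 \<Longrightarrow> 0 < ip H v v" and herm: "hermitian_structure H j"
    and ori: "\<And>u. u \<noteq> 0 \<Longrightarrow> 0 < det (vector [u, j *v u] :: real^2^2)"
  shows "0 < H $ 2 $ 2" "0 < det H" "j $ 2 $ 2 = - j $ 1 $ 1" "j $ 1 $ 2 * j $ 2 $ 1 = - 1 - (j $ 1 $ 1)\<^sup>2"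
    "j $ 1 $ 2 < 0" "H $ 1 $ 2 * j $ 1 $ 2 = H $ 2 $ 2 * j $ 1 $ 1" "j $ 1 $ 2 * sqrt (det H) = - H $ 2 $ 2"
proof -
  define E F K where "E = H $ 1 $ 1" and "F = H $ 1 $ 2" and "K = H $ 2 $ 2"
  define p q r w where "p = j $ 1 $ 1" and "q = j $ 1 $ 2" and "r = j $ 2 $ 1" and "w = j $ 2 $ 2"
  note defs = E_def F_def K_def p_def q_def r_def w_def
  have F21: "H $ 2 $ 1 = F" using arg_cong[OF sym, of "\<lambda>M. M $ 1 $ 2"] by (simp add: transpose_def F_def)
  have ipH: "ip H u v = u $ 1 * (E * v $ 1 + F * v $ 2) + u $ 2 * (F * v $ 1 + K * v $ 2)" for u v
    by (simp add: ip_def inner_vec_def matrix_vector_mult_def sum_2 F21 defs[symmetric])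
  have jv: "(j *v u) $ 1 = p * u $ 1 + q * u $ 2" "(j *v u) $ 2 = r * u $ 1 + w * u $ 2" for u
    by (simp_all add: matrix_vector_mult_def sum_2 defs)
  have e: "(axis 1 1 :: real^2) $ 1 = 1" "(axis 1 1 :: real^2) $ 2 = 0" "(axis 2 1 :: real^2) $ 1 = 0" "(axis 2 1 :: real^2) $ 2 = 1"
    by (simp_all add: axis_def)
  have e2: "(axis 2 1 :: real^2) \<noteq> 0" by (simp add: axis_eq_0_iff)
  show K: "0 < H $ 2 $ 2" using pos[OF e2] unfolding ipH e by (simp add: K_def)
  have "0 < det (vector [axis 2 1, j *v axis 2 1] :: real^2^2)" by (rule ori[OF e2])
  then show q: "j $ 1 $ 2 < 0" unfolding det_2 vector_2 jv e by (simp add: q_def)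
  have jj: "(j ** j) $ i $ k = (- mat 1 :: real^2^2) $ i $ k" for i k using herm by (simp add: hermitian_structure_def)
  have "q * (p + w) = 0"
    using jj[of 1 2] by (simp add: matrix_matrix_mult_def sum_2 mat_def defs[symmetric] algebra_simps)
  then have w: "w = - p" using q by (simp add: q_def)
  then show "j $ 2 $ 2 = - j $ 1 $ 1" by (simp add: defs)
  have qr: "q * r = - 1 - p\<^sup>2"
    using jj[of 1 1] by (simp add: matrix_matrix_mult_def sum_2 mat_def defs[symmetric] power2_eq_square)
  then show "j $ 1 $ 2 * j $ 2 $ 1 = - 1 - (j $ 1 $ 1)\<^sup>2" by (simp add: defs)
  have Fq: "F * q = K * p"
    using hermitian_skew[OF herm, of "axis 2 1" "axis 2 1"] unfolding ipH jv e w by (simp add: algebra_simps)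
  then show "H $ 1 $ 2 * j $ 1 $ 2 = H $ 2 $ 2 * j $ 1 $ 1" by (simp add: defs)
  have Kr: "K * r = - (E * q)"
    using hermitian_skew[OF herm, of "axis 1 1" "axis 2 1"] unfolding ipH jv e w by (simp add: algebra_simps)
  have D: "det H = E * K - F * F" by (simp add: det_2 F21 defs)
  have "K * K * (q * r) = K * q * (K * r)" by (simp add: algebra_simps)
  then have "K * K * (- 1 - p\<^sup>2) = K * q * (- (E * q))" unfolding qr Kr .
  then have "K * K + (K * p) * (K * p) = E * K * (q * q)" by (simp add: algebra_simps power2_eq_square)
  then have "K * K = q * q * det H" unfolding Fq[symmetric] D by (simp add: algebra_simps)
  then have KD: "K\<^sup>2 = q\<^sup>2 * det H" by (simp add: power2_eq_square)
  have K0: "0 < K" using K by (simp add: K_def)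
  then have "0 < q\<^sup>2 * det H" unfolding KD[symmetric] by simp
  then show Dp: "0 < det H" by (simp add: zero_less_mult_iff)
  have "sqrt (q\<^sup>2 * det H) = K" unfolding KD[symmetric] using K0 by simp
  then have "\<bar>q\<bar> * sqrt (det H) = K" by (simp add: real_sqrt_mult)
  then show "j $ 1 $ 2 * sqrt (det H) = - H $ 2 $ 2" using q by (simp add: defs)
qed

text \<open>For \<open>\<zeta> = a + \<i> b\<close> the condition \<open>d\<zeta> \<circ> j = \<i> d\<zeta>\<close> is the Beltrami equation with \<open>\<tau> = (H\<^sub>1\<^sub>2 - \<i> sqrt (det H)) / H\<^sub>2\<^sub>2\<close>. The solution has \<open>\<zeta>\<^sub>y \<noteq> 0\<close>, and \<open>Im \<tau> \<noteq> 0\<close>, so \<open>d\<zeta>\<close> is injective.\<close>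

lemma isothermal_pair:
  fixes H j :: "real^2 \<Rightarrow> real^2^2"
  assumes lm: "local_metric H W" and y0: "y0 \<in> W"
    and herm: "\<And>y. y \<in> W \<Longrightarrow> hermitian_structure (H y) (j y)"
    and ori: "\<And>y u. y \<in> W \<Longrightarrow> u \<noteq> 0 \<Longrightarrow> 0 < det (vector [u, j y *v u] :: real^2^2)"
  shows "\<exists>V a b. open V \<and> y0 \<in> V \<and> V \<subseteq> W \<and> Ck_on 3 a V \<and> Ck_on 3 b V \<and> complex_linear a b j V
    \<and> (\<forall>y\<in>V. \<forall>X. frechet_derivative a (at y) X = 0 \<longrightarrow> frechet_derivative b (at y) X = 0 \<longrightarrow> X = 0)"
proof -
  interpret local_metric H W by (rule lm)
  have ent: "0 < H y $ 2 $ 2" "0 < det (H y)" "j y $ 2 $ 2 = - j y $ 1 $ 1"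
    "j y $ 1 $ 2 * j y $ 2 $ 1 = - 1 - (j y $ 1 $ 1)\<^sup>2" "j y $ 1 $ 2 < 0"
    "H y $ 1 $ 2 * j y $ 1 $ 2 = H y $ 2 $ 2 * j y $ 1 $ 1" "j y $ 1 $ 2 * sqrt (det (H y)) = - H y $ 2 $ 2" if y: "y \<in> W" for y
    using surface_structure_entries[OF sym_G[OF y] pos_G[OF y] herm[OF y] ori[OF y]] by blast+
  \<comment> \<open>Chosen such that \<open>\<tau> j\<^sub>1\<^sub>2 = j\<^sub>1\<^sub>1 + \<i>\<close>, but written in terms of \<open>H\<close>, which is known to be smooth.\<close>
  define \<tau> where "\<tau> y = (H y $ 1 $ 2 / H y $ 2 $ 2) *\<^sub>R (1 :: complex) + (- sqrt (det (H y)) / H y $ 2 $ 2) *\<^sub>R \<i>" for y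
  have \<tau>q: "\<tau> y * of_real (j y $ 1 $ 2) = of_real (j y $ 1 $ 1) + \<i>" if y: "y \<in> W" for y
    using ent(1)[OF y] ent(6,7)[OF y] by (simp add: \<tau>_def complex_eq_iff field_simps)
  have im: "Im (\<tau> y) \<noteq> 0" if y: "y \<in> W" for y
    using ent(1,2)[OF y] by (simp add: \<tau>_def)
  have C\<tau>: "Ck_on k \<tau> W" for k
  proof -
    have h: "Ck_on k (\<lambda>y. H y $ a $ b) W" for a b by (intro Ck_on_nth open_S Ck_G)
    have "Ck_on k (\<lambda>y. sqrt (det (H y))) W"
      by (rule Ck_on_sqrt[OF open_S Ck_on_det[OF open_S h]]) (use ent(2) in blast)
    moreover have "H y $ 2 $ 2 \<noteq> 0" if "y \<in> W" for y using ent(1)[OF that] by simp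
    ultimately show ?thesis
      unfolding \<tau>_def[abs_def] by (intro Ck_on_add Ck_on_scaleR Ck_on_divide Ck_on_uminus Ck_on_const open_S h)
  qed
  define \<iota> :: "real \<times> real \<Rightarrow> real^2" where "\<iota> z = vector [fst z, snd z]" for z
  define \<kappa> :: "real^2 \<Rightarrow> real \<times> real" where "\<kappa> y = (y $ 1, y $ 2)" for y
  have \<iota>\<kappa>: "\<iota> (\<kappa> y) = y" for y by (simp add: \<iota>_def \<kappa>_def vec_eq_iff forall_2)
  have bl: "bounded_linear \<iota>" "bounded_linear \<kappa>"
    unfolding linear_conv_bounded_linear[symmetric]
    by (auto intro!: linearI simp: \<iota>_def \<kappa>_def vec_eq_iff forall_2)
  define U where "U = \<iota> -` W"
  have U: "open U"
    unfolding U_def by (rule open_vimage[OF open_S linear_continuous_on[OF bl(1)]])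
  have "Ck_on 14 (\<lambda>z. \<tau> (\<iota> z)) U"
    by (rule Ck_on_compose[OF U open_S _ C\<tau> Ck_on_linear[OF U bl(1)]]) (auto simp: U_def)
  moreover have "\<kappa> y0 \<in> U" "Im (\<tau> (\<iota> (\<kappa> y0))) \<noteq> 0" using y0 im by (auto simp: U_def \<iota>\<kappa>)
  ultimately obtain r \<zeta> where r: "0 < r" "ball (\<kappa> y0) r \<subseteq> U" "Ck_on 3 \<zeta> (ball (\<kappa> y0) r)"
    "\<And>z. z \<in> ball (\<kappa> y0) r \<Longrightarrow> dird (0,1) \<zeta> z \<noteq> 0 \<and> dird (1,0) \<zeta> z = \<tau> (\<iota> z) * dird (0,1) \<zeta> z"
    using beltrami_local[OF U, of "\<kappa> y0" "\<lambda>z. \<tau> (\<iota> z)"] by blast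
  define V where "V = \<kappa> -` ball (\<kappa> y0) r"
  have V: "open V" unfolding V_def by (rule open_vimage[OF open_ball linear_continuous_on[OF bl(2)]])
  have VW: "V \<subseteq> W" using r(2) unfolding V_def U_def using \<iota>\<kappa> by (metis subsetI vimageE vimageI2 subsetD)
  define f where "f y = \<zeta> (\<kappa> y)" for y
  have Cf: "Ck_on 3 f V"
    unfolding f_def by (rule Ck_on_compose[OF V open_ball _ r(3) Ck_on_linear[OF V bl(2)]]) (auto simp: V_def)
  have f1: "Ck_on (Suc 2) f V" using Cf by (simp add: eval_nat_numeral)
  have Df: "frechet_derivative f (at y) X = dird (0,1) \<zeta> (\<kappa> y) * (of_real (X $ 1) * \<tau> y + of_real (X $ 2))" if y: "y \<in> V" for y X
  proof -
    have z: "\<kappa> y \<in> ball (\<kappa> y0) r" using y by (simp add: V_def)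
    have "Ck_on (Suc 2) \<zeta> (ball (\<kappa> y0) r)" using r(3) by (simp add: eval_nat_numeral)
    note D = Ck_on_SucD[OF this z]
    have "frechet_derivative f (at y) X = frechet_derivative \<zeta> (at (\<kappa> y)) (\<kappa> X)"
      using fun_cong[OF frechet_derivative_at[OF diff_chain_at[OF bounded_linear_imp_has_derivative[OF bl(2)] D]], of X]
      by (simp add: o_def f_def[abs_def])
    also have "\<kappa> X = X $ 1 *\<^sub>R (1,0) + X $ 2 *\<^sub>R (0,1)" by (simp add: \<kappa>_def)
    also have "frechet_derivative \<zeta> (at (\<kappa> y)) (X $ 1 *\<^sub>R (1,0) + X $ 2 *\<^sub>R (0,1)) = X $ 1 *\<^sub>R dird (1,0) \<zeta> (\<kappa> y) + X $ 2 *\<^sub>R dird (0,1) \<zeta> (\<kappa> y)"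
      by (simp only: linear_add[OF has_derivative_linear[OF D]] linear_cmul[OF has_derivative_linear[OF D]])
    also have "\<dots> = dird (0,1) \<zeta> (\<kappa> y) * (of_real (X $ 1) * \<tau> y + of_real (X $ 2))"
      using r(4)[OF z] by (simp add: \<iota>\<kappa> scaleR_conv_of_real algebra_simps)
    finally show ?thesis .
  qed
  have Df_j: "frechet_derivative f (at y) (j y *v X) = \<i> * frechet_derivative f (at y) X" if y: "y \<in> V" for y X
  proof -
    have yW: "y \<in> W" using y VW by auto
    let ?p = "of_real (j y $ 1 $ 1) :: complex" and ?q = "of_real (j y $ 1 $ 2) :: complex" and ?r = "of_real (j y $ 2 $ 1) :: complex"
    note e = ent[OF yW]
    have tq: "\<tau> y * ?q = ?p + \<i>" by (rule \<tau>q[OF yW])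
    have qr: "?q * ?r = - 1 - ?p\<^sup>2"
      using arg_cong[OF e(4), of complex_of_real] by simp
    have q0: "?q \<noteq> 0" using e(5) by simp
    have "(?p * \<tau> y + ?r) * ?q = ?p * (\<tau> y * ?q) + ?q * ?r" by (simp add: algebra_simps)
    also have "\<dots> = \<i> * (\<tau> y * ?q)" unfolding tq qr by (simp add: algebra_simps power2_eq_square)
    finally have pr: "?p * \<tau> y + ?r = \<i> * \<tau> y" using q0 by (simp add: mult.assoc[symmetric])
    have jX: "(j y *v X) $ 1 = j y $ 1 $ 1 * X $ 1 + j y $ 1 $ 2 * X $ 2" "(j y *v X) $ 2 = j y $ 2 $ 1 * X $ 1 - j y $ 1 $ 1 * X $ 2"
      by (simp_all add: matrix_vector_mult_def sum_2 e(3))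
    have "of_real ((j y *v X) $ 1) * \<tau> y + of_real ((j y *v X) $ 2)
      = of_real (X $ 1) * (?p * \<tau> y + ?r) + of_real (X $ 2) * (\<tau> y * ?q - ?p)"
      unfolding jX by (simp add: algebra_simps)
    also have "\<dots> = \<i> * (of_real (X $ 1) * \<tau> y + of_real (X $ 2))" unfolding pr tq by (simp add: algebra_simps)
    finally show ?thesis unfolding Df[OF y] by (simp add: mult_ac)
  qed
  have fd: "f differentiable (at y)" if "y \<in> V" for y by (rule Ck_on_differentiable[OF f1 that])
  have DRe: "frechet_derivative (\<lambda>y. Re (f y)) (at y) X = Re (frechet_derivative f (at y) X)"
    and DIm: "frechet_derivative (\<lambda>y. Im (f y)) (at y) X = Im (frechet_derivative f (at y) X)" if "y \<in> V" for y X
    using frechet_derivative_bounded_linear[OF bounded_linear_Re fd[OF that]]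
      frechet_derivative_bounded_linear[OF bounded_linear_Im fd[OF that]] by auto
  show ?thesis
  proof (intro exI conjI ballI allI impI)
    show "open V" "V \<subseteq> W" by (rule V, rule VW)
    show "y0 \<in> V" using r(1) by (simp add: V_def)
    show "Ck_on 3 (\<lambda>y. Re (f y)) V" "Ck_on 3 (\<lambda>y. Im (f y)) V"
      using Ck_on_bounded_linear[OF V bounded_linear_Re Cf] Ck_on_bounded_linear[OF V bounded_linear_Im Cf] by auto
    show "complex_linear (\<lambda>y. Re (f y)) (\<lambda>y. Im (f y)) j V"
      unfolding complex_linear_def by (simp add: DRe DIm Df_j)
    fix y X assume y: "y \<in> V" and 0: "frechet_derivative (\<lambda>y. Re (f y)) (at y) X = 0" "frechet_derivative (\<lambda>y. Im (f y)) (at y) X = 0"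
    have "frechet_derivative f (at y) X = 0" using 0 unfolding DRe[OF y] DIm[OF y] by (simp add: complex_eq_iff)
    moreover have "dird (0,1) \<zeta> (\<kappa> y) \<noteq> 0" using r(4) y by (simp add: V_def)
    ultimately have e: "of_real (X $ 1) * \<tau> y + of_real (X $ 2) = 0" unfolding Df[OF y] by simp
    have "Im (of_real (X $ 1) * \<tau> y + of_real (X $ 2)) = X $ 1 * Im (\<tau> y)" by simp
    then have "X $ 1 = 0" using e im[of y] y VW by auto
    then show "X = 0" using e by (simp add: vec_eq_iff forall_2)
  qed
qed

section \<open>The product of the two norms\<close>

text \<open>The identity for the product of the two sums of squares is where the singular factors combine into the trace of the square of a complex Hessian; \<open>l\<close> is the square of the length of the gradients.\<close>

lemma product_of_norms_le:
  fixes p q r w l C :: real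
  assumes l: "0 < l" and 1: "\<bar>p\<^sup>2 - q\<^sup>2 + r\<^sup>2 - w\<^sup>2\<bar> \<le> C * l" and 2: "\<bar>2 * (p * q + r * w)\<bar> \<le> C * l"
  shows "(2 / sqrt l * sqrt ((q + r)\<^sup>2 + (p - w)\<^sup>2)) * (2 / sqrt l * sqrt ((q - r)\<^sup>2 + (p + w)\<^sup>2)) \<le> 8 * C"
proof -
  have "((q + r)\<^sup>2 + (p - w)\<^sup>2) * ((q - r)\<^sup>2 + (p + w)\<^sup>2) = (p\<^sup>2 - q\<^sup>2 + r\<^sup>2 - w\<^sup>2)\<^sup>2 + (2 * (p * q + r * w))\<^sup>2"
    by (simp add: power2_eq_square algebra_simps)
  then have "sqrt ((q + r)\<^sup>2 + (p - w)\<^sup>2) * sqrt ((q - r)\<^sup>2 + (p + w)\<^sup>2)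
      = sqrt ((p\<^sup>2 - q\<^sup>2 + r\<^sup>2 - w\<^sup>2)\<^sup>2 + (2 * (p * q + r * w))\<^sup>2)"
    unfolding real_sqrt_mult[symmetric] by simp
  also have "\<dots> \<le> \<bar>p\<^sup>2 - q\<^sup>2 + r\<^sup>2 - w\<^sup>2\<bar> + \<bar>2 * (p * q + r * w)\<bar>" by (rule sqrt_sum_squares_le_sum_abs)
  also have "\<dots> \<le> 2 * C * l" using 1 2 by simp
  finally have *: "sqrt ((q + r)\<^sup>2 + (p - w)\<^sup>2) * sqrt ((q - r)\<^sup>2 + (p + w)\<^sup>2) \<le> 2 * C * l" .
  have "(2 / sqrt l * sqrt ((q + r)\<^sup>2 + (p - w)\<^sup>2)) * (2 / sqrt l * sqrt ((q - r)\<^sup>2 + (p + w)\<^sup>2))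
     = 4 / (sqrt l * sqrt l) * (sqrt ((q + r)\<^sup>2 + (p - w)\<^sup>2) * sqrt ((q - r)\<^sup>2 + (p + w)\<^sup>2))"
    by simp
  also have "\<dots> \<le> 4 / (sqrt l * sqrt l) * (2 * C * l)" by (rule mult_left_mono[OF *]) (use l in simp)
  also have "\<dots> = 8 * C" using l by simp
  finally show ?thesis .
qed

text \<open>The structures and their covariant derivatives live in the chart with metric \<open>G'\<close>, the Ricci bound in the chart with metric \<open>G\<close>. The adapted frame is transported by the coordinate change, which preserves gradients, Hessians and inner products.\<close>

lemma product_le_Ricci:
  fixes G' G Jp Jm :: "real^4 \<Rightarrow> real^4^4"
  assumes cc: "chart_change G' S' G S \<phi> U" and T: "open T" "T \<subseteq> S" "\<phi> ` U \<subseteq> T"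
    and u: "Ck_on 3 u T" and v: "Ck_on 3 v T" and null: "local_metric.null_pair G u v T"
    and harm: "\<And>y. y \<in> T \<Longrightarrow> laplacian G u y = 0" "\<And>y. y \<in> T \<Longrightarrow> laplacian G v y = 0"
    and sp: "structure_on_chart G' S' U (\<lambda>y. u (\<phi> y)) (\<lambda>y. v (\<phi> y)) Jp 1"
    and sm: "structure_on_chart G' S' U (\<lambda>y. u (\<phi> y)) (\<lambda>y. v (\<phi> y)) Jm (- 1)"
    and x: "x \<in> U"
    and t: "frechet_derivative (\<lambda>y. u (\<phi> y)) (at x) t = 0" "frechet_derivative (\<lambda>y. v (\<phi> y)) (at x) t = 0" "ip (G' x) t t = 1"
    and C: "\<And>X Y r. ip (G (\<phi> x)) X X = r \<Longrightarrow> ip (G (\<phi> x)) Y Y = r \<Longrightarrow> \<bar>local_metric.Ric G (\<phi> x) X Y\<bar> \<le> C * r"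
  shows "endo_norm (G' x) (cov_deriv_endo G' Jp x t) * endo_norm (G' x) (cov_deriv_endo G' Jm x t) \<le> 8 * C"
proof -
  interpret chart_change G' S' G S \<phi> U by (rule cc)
  interpret p: structure_on_chart G' S' U "\<lambda>y. u (\<phi> y)" "\<lambda>y. v (\<phi> y)" Jp 1 by (rule sp)
  interpret m: structure_on_chart G' S' U "\<lambda>y. u (\<phi> y)" "\<lambda>y. v (\<phi> y)" Jm "- 1" by (rule sm)
  let ?u = "\<lambda>y. u (\<phi> y)" and ?v = "\<lambda>y. v (\<phi> y)"
  let ?a = "grad G' ?u x" and ?b = "grad G' ?v x"
  have ap: "adapted_point (G' x) (Jp x) ?a t" and am: "adapted_point (G' x) (Jm x) ?a t"
    using p.adapted[OF x t] m.adapted[OF x t] by auto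
  interpret ap: adapted_point "G' x" "Jp x" ?a t by (rule ap)
  have Jab: "Jp x *v ?a = ?b" "Jm x *v ?a = ?b" using p.J_grad(1)[OF x] m.J_grad(1)[OF x] by auto
  have Jmt: "Jm x *v t = - (Jp x *v t)"
    using opposite_structures_vertical[OF ap am] Jab p.ori(1)[OF x] m.ori(1)[OF x] by simp
  have lin: "hess G' ?u x t (- X) = - hess G' ?u x t X" "hess G' ?v x t (- X) = - hess G' ?v x t X" for X
    using M'.linear_hess(2)[OF p.open_T p.T_S x p.u, of t "- 1" X] M'.linear_hess(2)[OF p.open_T p.T_S x p.v, of t "- 1" X]
    by simp_all
  define l where "l = ip (G' x) ?a ?a"
  have l: "0 < l" unfolding l_def by (rule ap.pos[OF ap.a])
  define P0 q r w where "P0 = hess G' ?u x t t" and "q = hess G' ?v x t t"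
    and "r = hess G' ?u x t (Jp x *v t)" and "w = hess G' ?v x t (Jp x *v t)"
  note defs = l_def[symmetric] P0_def[symmetric] q_def[symmetric] r_def[symmetric] w_def[symmetric]
  have np: "endo_norm (G' x) (cov_deriv_endo G' Jp x t) = 2 / sqrt l * sqrt ((q + r)\<^sup>2 + (P0 - w)\<^sup>2)"
    unfolding p.endo_norm_D[OF x t] defs ..
  have nm: "endo_norm (G' x) (cov_deriv_endo G' Jm x t) = 2 / sqrt l * sqrt ((q - r)\<^sup>2 + (P0 + w)\<^sup>2)"
    unfolding m.endo_norm_D[OF x t] Jmt lin defs by simp
  let ?x = "\<phi> x"
  have xT: "?x \<in> T" using x T by auto
  have u2: "Ck_on 2 u T" and v2: "Ck_on 2 v T" using u v Ck_on_le by force+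
  have ud: "u differentiable (at ?x)" and vd: "v differentiable (at ?x)"
    using Ck_on_differentiable[of 1] u2 v2 xT by (simp_all add: numeral_2_eq_2)
  have grads: "P x ?a = grad G u ?x" "P x ?b = grad G v ?x"
    using grad_pullback[OF x ud] grad_pullback[OF x vd] by auto
  have ab: "ip (G ?x) (grad G u ?x) (grad G u ?x) = l" "ip (G ?x) (grad G v ?x) (grad G v ?x) = l"
    using isometry[OF x, of ?a ?a] isometry[OF x, of ?b ?b] ap.ip_J_J[of ?a ?a] unfolding grads Jab l_def by auto
  \<comment> \<open>The image under the coordinate change of the frame adapted to \<open>J\<^sub>+\<close>.\<close>
  define e where "e i = P x (adapted_frame (G' x) (Jp x) ?a t i)" for i
  have e: "orthonormal_frame (G ?x) e"
    using ap.orthonormal unfolding orthonormal_frame_def e_def isometry[OF x, symmetric] .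
  have e12: "grad G u ?x = sqrt l *\<^sub>R e 1" "grad G v ?x = sqrt l *\<^sub>R e 2"
    using l unfolding e_def ap.adapted_frame_simps Jab linear_cmul[OF linear_P[OF x]] grads by (simp_all add: l_def)
  have e34: "e 3 = P x t" "e 4 = P x (Jp x *v t)" unfolding e_def ap.adapted_frame_simps by auto
  note hess = hess_pullback[OF x T(1,3) u2] hess_pullback[OF x T(1,3) v2]
  have sl: "sqrt l \<noteq> 0" using l by simp
  note tr = null_pair_4_traces[OF M.local_metric_axioms T(1,2) xT u2 v2 null harm(1)[OF xT] harm(2)[OF xT] e e12 sl,
    unfolded e34 hess[symmetric] defs]
  have bo: "2 * (P0\<^sup>2 - q\<^sup>2 + r\<^sup>2 - w\<^sup>2) = M.Ric ?x (grad G v ?x) (grad G v ?x) - M.Ric ?x (grad G u ?x) (grad G u ?x)"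
    "2 * (2 * (P0 * q + r * w)) = - M.Ric ?x (grad G u ?x) (grad G v ?x) - M.Ric ?x (grad G v ?x) (grad G u ?x)"
    unfolding tr[symmetric] by (rule M.null_pair_bochner[OF T(1,2) xT u v null harm]; assumption)+
  have "\<bar>2 * (P0\<^sup>2 - q\<^sup>2 + r\<^sup>2 - w\<^sup>2)\<bar> \<le> C * l + C * l"
    unfolding bo(1) by (rule order_trans[OF abs_triangle_ineq4]) (intro add_mono C ab)
  moreover have "\<bar>2 * (2 * (P0 * q + r * w))\<bar> \<le> C * l + C * l"
  proof -
    have "\<bar>- x - y\<bar> \<le> \<bar>x\<bar> + \<bar>y\<bar>" for x y :: real by simp
    then show ?thesis unfolding bo(2) by (rule order_trans) (intro add_mono C ab)
  qed
  ultimately show ?thesis unfolding np nm by (intro product_of_norms_le[OF l]) (simp_all add: abs_mult)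
qed

section \<open>Charts of a Riemannian manifold\<close>

lemma is_chart_inverse:
  assumes "is_chart c"
  shows "p \<in> fst c \<Longrightarrow> chart_inv c (snd c p) = p" "x \<in> chart_image c \<Longrightarrow> chart_inv c x \<in> fst c"
    "x \<in> chart_image c \<Longrightarrow> snd c (chart_inv c x) = x"
  using assms homeomorphism_apply1 homeomorphism_apply2 homeomorphism_image2 unfolding is_chart_def by blast+

lemma open_chart_vimage:
  assumes "is_chart c" "open V"
  shows "open {p \<in> fst c. snd c p \<in> V}"
proof -
  have "{p \<in> fst c. snd c p \<in> V} = fst c \<inter> snd c -` V" by auto
  then show ?thesis
    using assms continuous_open_preimage[of "fst c" "snd c" V] by (simp add: is_chart_def homeomorphism_def)
qed

lemma open_chart_image:
  assumes c: "is_chart c" and W: "open W" "W \<subseteq> fst c"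
  shows "open (snd c ` W)"
proof -
  have "snd c ` W = chart_image c \<inter> chart_inv c -` W"
    using W is_chart_inverse[OF c] by (force simp: chart_image_def)
  then show ?thesis
    using c W continuous_open_preimage[of "chart_image c" "chart_inv c" W] by (simp add: is_chart_def homeomorphism_def)
qed

lemma riemannian_manifold_charts: "riemannian_manifold A g \<Longrightarrow> c \<in> A \<Longrightarrow> is_chart c"
  by (simp add: riemannian_manifold_def smooth_atlas_def)

lemma riemannian_manifold_local_metric:
  assumes "riemannian_manifold A g" "c \<in> A"
  shows "local_metric (g c) (chart_image c)"
  using assms by unfold_locales (auto simp: riemannian_manifold_def smooth_atlas_def is_chart_def smooth_on_def)

lemma riemannian_manifold_chart_change:
  assumes R: "riemannian_manifold A g" and c: "c' \<in> A" "c \<in> A" and W: "open W" "W \<subseteq> fst c' \<inter> fst c"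
  shows "chart_change (g c') (chart_image c') (g c) (chart_image c) (transition c' c) (snd c' ` W)"
proof -
  interpret M': local_metric "g c'" "chart_image c'" by (rule riemannian_manifold_local_metric[OF R c(1)])
  interpret M: local_metric "g c" "chart_image c" by (rule riemannian_manifold_local_metric[OF R c(2)])
  have sub: "snd c' ` W \<subseteq> snd c' ` (fst c' \<inter> fst c)" using W by auto
  show ?thesis
  proof
    show "open (snd c' ` W)" using W by (intro open_chart_image riemannian_manifold_charts[OF R c(1)]) auto
    show "snd c' ` W \<subseteq> chart_image c'" using W by (auto simp: chart_image_def)
    have "transition c' c (snd c' p) \<in> chart_image c" if "p \<in> W" for p
    proof -
      have "p \<in> fst c'" "p \<in> fst c" using W that by auto
      then show ?thesis
        using is_chart_inverse(1)[OF riemannian_manifold_charts[OF R c(1)]] by (simp add: transition_def chart_image_def)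
    qed
    then show "transition c' c ` snd c' ` W \<subseteq> chart_image c" by blast
    have "Ck_on k (transition c' c) (snd c' ` (fst c' \<inter> fst c))" for k
      using R c by (simp add: riemannian_manifold_def smooth_atlas_def smooth_on_def)
    then show "Ck_on k (transition c' c) (snd c' ` W)" for k using Ck_on_subset sub by blast
    show "g c' y = transpose (jacobian (transition c' c) (at y)) ** g c (transition c' c y) ** jacobian (transition c' c) (at y)"
      if "y \<in> snd c' ` W" for y
    proof -
      have "\<forall>c\<in>A. \<forall>d\<in>A. \<forall>x\<in>snd c ` (fst c \<inter> fst d).
        g c x = transpose (jacobian (transition c d) (at x)) ** g d (transition c d x) ** jacobian (transition c d) (at x)"
        using R by (simp add: riemannian_manifold_def)
      from this[rule_format, OF c subsetD[OF sub that]] show ?thesis .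
    qed
  qed
qed

lemma frechet_derivative_composed:
  assumes U: "open U" "y \<in> U" and eq: "\<And>z. z \<in> U \<Longrightarrow> f z = a (L z)"
    and L: "L differentiable (at y)" and a: "a differentiable (at (L y))"
  shows "frechet_derivative f (at y) X = frechet_derivative a (at (L y)) (frechet_derivative L (at y) X)"
proof -
  have "((\<lambda>z. a (L z)) has_derivative (\<lambda>X. frechet_derivative a (at (L y)) (frechet_derivative L (at y) X))) (at y)"
    using diff_chain_at[OF L[unfolded frechet_derivative_works] a[unfolded frechet_derivative_works]] by (simp add: o_def)
  then have "(f has_derivative (\<lambda>X. frechet_derivative a (at (L y)) (frechet_derivative L (at y) X))) (at y)"
    by (rule has_derivative_transform_within_open[OF _ U]) (simp add: eq)
  from fun_cong[OF frechet_derivative_at[OF this], of X] show ?thesis by simp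
qed

lemma jacobian_vector:
  fixes f :: "real^'n::finite \<Rightarrow> real^'k::finite"
  assumes "f differentiable (at y)"
  shows "jacobian f (at y) *v X = frechet_derivative f (at y) X"
  unfolding jacobian_def using fun_cong[OF matrix_vector_mul(2)[OF linear_frechet_derivative[OF assms]]] .

lemma smooth_on_differentiable: "smooth_on f S \<Longrightarrow> x \<in> S \<Longrightarrow> f differentiable (at x)"
  using Ck_on_differentiable[of 0 f S x] by (simp add: smooth_on_def)

text \<open>Harmonicity is required in every chart of the surface. In the chart \<open>d\<close> the functions form a null pair; this property is invariant under coordinate changes and implies harmonicity in dimension two.\<close>

lemma isothermal_functions_harmonic:
  fixes B :: "('n::topological_space, 2) chart set"
  assumes R: "riemannian_manifold B h" and d: "d \<in> B" and V: "open V" "V \<subseteq> chart_image d"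
    and a: "Ck_on 2 a V" and b: "Ck_on 2 b V" and cl: "complex_linear a b (j d) V"
    and herm: "\<And>y. y \<in> V \<Longrightarrow> hermitian_structure (h d y) (j d y)"
    and nd: "\<And>y X. y \<in> V \<Longrightarrow> frechet_derivative a (at y) X = 0 \<Longrightarrow> frechet_derivative b (at y) X = 0 \<Longrightarrow> X = 0"
  shows "harmonic_on B h {n \<in> fst d. snd d n \<in> V} (\<lambda>n. a (snd d n))"
    and "harmonic_on B h {n \<in> fst d. snd d n \<in> V} (\<lambda>n. b (snd d n))"
proof -
  interpret M: local_metric "h d" "chart_image d" by (rule riemannian_manifold_local_metric[OF R d])
  have ad: "a differentiable (at y)" and bd: "b differentiable (at y)" if "y \<in> V" for y
    using Ck_on_differentiable[of 1] a b that by (simp_all add: numeral_2_eq_2)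
  have null: "M.null_pair a b V"
    by (rule M.complex_linear_null_pair[OF V(2) ad bd cl herm])
  have nz: "grad (h d) a y \<noteq> 0" if y: "y \<in> V" for y
  proof
    assume "grad (h d) a y = 0"
    then have "frechet_derivative a (at y) X = 0" for X
      using M.ip_grad[OF _ ad[OF y], of X] V(2) y by (auto simp: ip_simps)
    moreover from this have "frechet_derivative b (at y) X = 0" for X
      using cl y unfolding complex_linear_def by (metis neg_equal_0_iff_equal)
    ultimately have "axis 1 1 = (0 :: real^2)" using nd[OF y] by blast
    then show False by (simp add: axis_eq_0_iff)
  qed
  have *: "Ck_on 2 ((\<lambda>n. a (snd d n)) \<circ> chart_inv d') X \<and> Ck_on 2 ((\<lambda>n. b (snd d n)) \<circ> chart_inv d') X \<and>
      (\<forall>x\<in>X. laplacian (h d') ((\<lambda>n. a (snd d n)) \<circ> chart_inv d') x = 0 \<and> laplacian (h d') ((\<lambda>n. b (snd d n)) \<circ> chart_inv d') x = 0)"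
    if d': "d' \<in> B" and X: "X = snd d' ` (fst d' \<inter> {n \<in> fst d. snd d n \<in> V})" for d' X
  proof -
    let ?W = "fst d' \<inter> {n \<in> fst d. snd d n \<in> V}"
    have c: "is_chart d" "is_chart d'" using riemannian_manifold_charts[OF R] d d' by auto
    have W: "open ?W" "?W \<subseteq> fst d' \<inter> fst d"
      using c open_chart_vimage[OF c(1) V(1)] by (auto simp: is_chart_def)
    interpret chart_change "h d'" "chart_image d'" "h d" "chart_image d" "transition d' d" X
      unfolding X by (rule riemannian_manifold_chart_change[OF R d' d W])
    have eq: "(\<lambda>n. f (snd d n)) \<circ> chart_inv d' = (\<lambda>y. f (transition d' d y))" for f :: "real^2 \<Rightarrow> real"
      by (simp add: fun_eq_iff transition_def)
    have XV: "transition d' d ` X \<subseteq> V"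
      unfolding X using is_chart_inverse(1)[OF c(2)] by (auto simp: transition_def)
    have C: "Ck_on 2 (\<lambda>y. a (transition d' d y)) X" "Ck_on 2 (\<lambda>y. b (transition d' d y)) X"
      by (rule Ck_on_compose[OF open_U V(1) XV _ Ck_\<phi>], rule a, rule Ck_on_compose[OF open_U V(1) XV _ Ck_\<phi>], rule b)
    have n: "M'.null_pair (\<lambda>y. a (transition d' d y)) (\<lambda>y. b (transition d' d y)) X"
      by (rule null_pair_pullback[OF XV ad bd null])
    have "grad (h d') (\<lambda>y. a (transition d' d y)) x \<noteq> 0" if x: "x \<in> X" for x
    proof
      assume "grad (h d') (\<lambda>y. a (transition d' d y)) x = 0"
      then show False
        using grad_pullback[OF x ad] nz XV x linear_0[OF linear_P[OF x]] by (metis image_subset_iff)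
    qed
    then show ?thesis
      unfolding eq using C null_pair_surface_harmonic[OF M'.local_metric_axioms open_U U_S' _ C n] by blast
  qed
  show "harmonic_on B h {n \<in> fst d. snd d n \<in> V} (\<lambda>n. a (snd d n))"
    "harmonic_on B h {n \<in> fst d. snd d n \<in> V} (\<lambda>n. b (snd d n))"
    unfolding harmonic_on_def using * by blast+
qed

lemma open_preimage_in_chart:
  assumes R: "riemannian_manifold A g" and F: "smooth_map A B F" and c: "c \<in> A" and N: "open N"
  shows "open {p \<in> fst c. F p \<in> N}"
proof -
  have "fst c \<subseteq> carrier A" using c by (auto simp: carrier_def)
  then have "continuous_on (fst c) F" using F continuous_on_subset by (auto simp: smooth_map_def)
  moreover have "open (fst c)" using riemannian_manifold_charts[OF R c] by (simp add: is_chart_def)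
  moreover have "{p \<in> fst c. F p \<in> N} = fst c \<inter> F -` N" by auto
  ultimately show ?thesis using N continuous_open_preimage by metis
qed

text \<open>The definition of a regular point asks for one pair of charts with non-vanishing differential; by the chain rule every pair of charts has this property.\<close>

lemma regular_point_differential:
  assumes RA: "riemannian_manifold A g" and RB: "riemannian_manifold B h" and F: "smooth_map A B F"
    and c: "c \<in> A" "m \<in> fst c" and d: "d \<in> B" "F m \<in> fst d" and reg: "regular_point A B F m"
  shows "differential c F d (snd c m) \<noteq> 0"
proof
  assume 0: "differential c F d (snd c m) = 0"
  obtain c0 d0 where c0: "c0 \<in> A" "m \<in> fst c0" and d0: "d0 \<in> B" "F m \<in> fst d0"
    and nz: "differential c0 F d0 (snd c0 m) \<noteq> 0"
    using reg by (auto simp: regular_point_def)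
  have ch: "is_chart c" "is_chart c0" and ch': "is_chart d" "is_chart d0"
    using riemannian_manifold_charts[OF RA] riemannian_manifold_charts[OF RB] c c0 d d0 by auto
  define W where "W = {p \<in> fst c0. F p \<in> fst d \<inter> fst d0} \<inter> fst c"
  have "open {p \<in> fst c0. F p \<in> fst d \<inter> fst d0}"
    by (rule open_preimage_in_chart[OF RA F c0(1)]) (use ch' in \<open>auto simp: is_chart_def\<close>)
  then have W: "open W" using ch by (auto simp: W_def is_chart_def)
  have mW: "m \<in> W" using c c0 d d0 by (auto simp: W_def)
  have oW: "open (snd c0 ` W)" by (rule open_chart_image[OF ch(2) W]) (auto simp: W_def)
  let ?x = "snd c0 m" and ?t = "transition c0 c" and ?s = "transition d d0" and ?L = "local_rep c F d" and ?M = "local_rep c0 F d0"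
  have inv: "chart_inv c0 ?x = m" "chart_inv c (snd c m) = m" "chart_inv d (snd d (F m)) = F m"
    using is_chart_inverse(1)[OF ch(2) c0(2)] is_chart_inverse(1)[OF ch(1) c(2)] is_chart_inverse(1)[OF ch'(1) d(2)] by auto
  have tx: "?t ?x = snd c m" "?L (snd c m) = snd d (F m)" by (simp_all add: transition_def local_rep_def inv)
  have sm: "smooth_on ?t (snd c0 ` (fst c0 \<inter> fst c))" "smooth_on ?s (snd d ` (fst d \<inter> fst d0))"
    "smooth_on ?L (snd c ` {p \<in> fst c. F p \<in> fst d})"
    using RA RB F c c0 d d0 by (auto simp: riemannian_manifold_def smooth_atlas_def smooth_map_def)
  have dif: "?t differentiable (at ?x)" "?s differentiable (at (?L (?t ?x)))" "?L differentiable (at (?t ?x))"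
    unfolding tx using c c0 d d0
    by (auto intro!: smooth_on_differentiable[OF sm(1)] smooth_on_differentiable[OF sm(2)] smooth_on_differentiable[OF sm(3)])
  have eq: "?M z = ?s (?L (?t z))" if z: "z \<in> snd c0 ` W" for z
  proof -
    obtain p where "z = snd c0 p" "p \<in> fst c0" "p \<in> fst c" "F p \<in> fst d" using z by (auto simp: W_def)
    then show ?thesis
      using is_chart_inverse(1)[OF ch(1)] is_chart_inverse(1)[OF ch(2)] is_chart_inverse(1)[OF ch'(1)]
      by (simp add: local_rep_def transition_def)
  qed
  have L0: "frechet_derivative ?L (at (?t ?x)) X = 0" for X
    using jacobian_vector[OF dif(3), of X] 0 by (simp add: tx differential_def)
  have Lt: "(\<lambda>z. ?L (?t z)) differentiable (at ?x)"
    using differentiable_chain_at[OF dif(1,3)] by (simp add: o_def)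
  have "frechet_derivative ?M (at ?x) X = 0" for X
  proof -
    have "frechet_derivative (\<lambda>z. ?L (?t z)) (at ?x) X = 0"
      using frechet_derivative_composed[OF oW _ _ dif(1,3), of "\<lambda>z. ?L (?t z)" X] mW by (simp add: L0)
    then show ?thesis
      using frechet_derivative_composed[OF oW _ eq Lt dif(2), of X] mW linear_0[OF linear_frechet_derivative[OF dif(2)]] by simp
  qed
  moreover have "?M differentiable (at ?x)"
    by (rule smooth_on_differentiable[of _ "snd c0 ` {p \<in> fst c0. F p \<in> fst d0}"]) (use F c0 d0 in \<open>auto simp: smooth_map_def\<close>)
  ultimately have "differential c0 F d0 ?x *v X = 0" for X unfolding differential_def using jacobian_vector by metis
  then have "differential c0 F d0 ?x = 0" by (simp add: matrix_eq)
  then show False using nz by simp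
qed

lemma compact_locally_bounded:
  fixes P :: "'m::topological_space \<Rightarrow> real \<Rightarrow> bool"
  assumes K: "compact K" and mono: "\<And>p C D. P p C \<Longrightarrow> C \<le> D \<Longrightarrow> P p D"
    and loc: "\<And>m. m \<in> K \<Longrightarrow> \<exists>N C. open N \<and> m \<in> N \<and> (\<forall>p\<in>N. P p C)"
  shows "\<exists>C. \<forall>p\<in>K. P p C"
proof -
  obtain N C where N: "open (N m)" "m \<in> N m" "\<forall>p\<in>N m. P p (C m)" if "m \<in> K" for m
    using loc by metis
  obtain I where I: "I \<subseteq> K" "finite I" "K \<subseteq> (\<Union>m\<in>I. N m)"
    using compactE_image[OF K, of K N] N by blast
  have "P p (\<Sum>m\<in>I. \<bar>C m\<bar>)" if p: "p \<in> K" for p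
  proof -
    obtain m where m: "m \<in> I" "p \<in> N m" using I(3) p by auto
    have "C m \<le> \<bar>C m\<bar>" by simp
    also have "\<dots> \<le> (\<Sum>m\<in>I. \<bar>C m\<bar>)" using I(2) m(1) member_le_sum[of m I "\<lambda>m. \<bar>C m\<bar>"] by simp
    finally show ?thesis using N(3) I(1) m mono by blast
  qed
  then show ?thesis by blast
qed

section \<open>Harmonic morphisms to a surface\<close>

locale morphism_to_surface =
  fixes A :: "('m::topological_space, 4) chart set" and g :: "('m, 4) matrix_field"
    and B :: "('n::topological_space, 2) chart set" and h j :: "('n, 2) matrix_field" and F :: "'m \<Rightarrow> 'n"
  assumes A: "riemannian_manifold A g" and B: "riemannian_manifold B h"
    and morphism: "harmonic_morphism A g B h F" and surface: "surface_complex_structure B h j"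
begin

lemma smooth_F: "smooth_map A B F"
  using morphism by (simp add: harmonic_morphism_def)

lemma metric_chart: "c \<in> A \<Longrightarrow> local_metric (g c) (chart_image c)"
  by (rule riemannian_manifold_local_metric[OF A])

lemma chart_inverse: "c \<in> A \<Longrightarrow> p \<in> fst c \<Longrightarrow> chart_inv c (snd c p) = p"
  using is_chart_inverse(1) riemannian_manifold_charts[OF A] by blast

text \<open>The part of the domain of \<open>d\<close> on which functions given on the coordinate set \<open>V\<close> are defined.\<close>

definition chart_part where "chart_part d V = {n \<in> fst d. snd d n \<in> V}"

definition regular_part where "regular_part d V = {p \<in> carrier A. F p \<in> chart_part d V \<and> regular_point A B F p}"

text \<open>The assertion of the theorem for one point, named so that the local bound and its monotonicity in \<open>C\<close> can be fed to the compactness argument.\<close>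

definition product_bounded_at where
  "product_bounded_at Jp Jm p C \<longleftrightarrow> (regular_point A B F p \<longrightarrow> (\<forall>c\<in>A. p \<in> fst c \<longrightarrow>
      (\<forall>T. vertical B F c p T \<and> ip (g c (snd c p)) T T = 1 \<longrightarrow>
        endo_norm (g c (snd c p)) (cov_deriv_endo (g c) (Jp c) (snd c p) T) *
        endo_norm (g c (snd c p)) (cov_deriv_endo (g c) (Jm c) (snd c p) T) \<le> C)))"

context
  fixes d V a b
  assumes d: "d \<in> B" and V: "open V" "V \<subseteq> chart_image d" and a: "Ck_on 3 a V" and b: "Ck_on 3 b V"
    and cl: "complex_linear a b (j d) V"
    and nd: "\<And>y X. y \<in> V \<Longrightarrow> frechet_derivative a (at y) X = 0 \<Longrightarrow> frechet_derivative b (at y) X = 0 \<Longrightarrow> X = 0"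
begin

abbreviation "N \<equiv> chart_part d V"
abbreviation "R \<equiv> regular_part d V"

lemma open_N: "open N"
  unfolding chart_part_def by (rule open_chart_vimage[OF riemannian_manifold_charts[OF B d] V(1)])

lemma differentiable_ab: "y \<in> V \<Longrightarrow> a differentiable (at y)" "y \<in> V \<Longrightarrow> b differentiable (at y)"
  using Ck_on_differentiable[of "Suc (Suc 0)" _ V] a b unfolding numeral_3_eq_3 by blast+

lemma local_rep_N:
  assumes c: "c \<in> A" and y: "y \<in> snd c ` {p \<in> fst c. F p \<in> N}"
  shows "local_rep c F d y \<in> V" "local_rep c F d differentiable (at y)" "chart_inv c y \<in> fst c" "F (chart_inv c y) \<in> N"
    "snd c (chart_inv c y) = y"
proof -
  obtain p where p: "p \<in> fst c" "F p \<in> N" "y = snd c p" using y by auto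
  then show "local_rep c F d y \<in> V" "chart_inv c y \<in> fst c" "F (chart_inv c y) \<in> N" "snd c (chart_inv c y) = y"
    using chart_inverse[OF c p(1)] by (auto simp: local_rep_def chart_part_def)
  show "local_rep c F d differentiable (at y)"
    by (rule smooth_on_differentiable[of _ "snd c ` {p \<in> fst c. F p \<in> fst d}"])
       (use smooth_F c d p in \<open>auto simp: smooth_map_def chart_part_def\<close>)
qed

lemma open_chart_N: "c \<in> A \<Longrightarrow> open (snd c ` {p \<in> fst c. F p \<in> N})"
  by (rule open_chart_image[OF riemannian_manifold_charts[OF A] open_preimage_in_chart[OF A smooth_F _ open_N]]) blast+

lemma Ck_local_rep: "c \<in> A \<Longrightarrow> Ck_on k (local_rep c F d) (snd c ` {p \<in> fst c. F p \<in> N})"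
  by (rule Ck_on_subset[of _ _ "snd c ` {p \<in> fst c. F p \<in> fst d}"])
     (use smooth_F d in \<open>simp add: smooth_map_def smooth_on_def\<close>, auto simp: chart_part_def)

lemma differential_vector:
  "c \<in> A \<Longrightarrow> y \<in> snd c ` {p \<in> fst c. F p \<in> N} \<Longrightarrow> differential c F d y *v X = frechet_derivative (local_rep c F d) (at y) X"
  unfolding differential_def by (rule jacobian_vector[OF local_rep_N(2)])

text \<open>In a chart, regularity means that some directional derivative of the representation of \<open>F\<close> is non-zero, which is an open condition.\<close>

lemma open_R: "open R"
proof (subst open_subopen, intro ballI)
  fix p assume "p \<in> R"
  then obtain c where c: "c \<in> A" "p \<in> fst c" and p: "F p \<in> N" "regular_point A B F p"
    by (auto simp: regular_part_def carrier_def)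
  let ?D = "snd c ` {p \<in> fst c. F p \<in> N}"
  have y: "snd c p \<in> ?D" using c p by auto
  have "differential c F d (snd c p) \<noteq> 0"
    using regular_point_differential[OF A B smooth_F c d] p by (auto simp: chart_part_def)
  then obtain X where X: "differential c F d (snd c p) *v X \<noteq> 0"
    by (metis matrix_eq matrix_vector_mult_0)
  let ?f = "\<lambda>y. frechet_derivative (local_rep c F d) (at y) X"
  let ?O = "?D \<inter> ?f -` (- {0})"
  have "continuous_on ?D ?f"
    by (rule Ck_on_continuous[OF Ck_on_SucD2[OF Ck_local_rep[OF c(1), of "Suc 0"]]])
  then have "open ?O"
    by (intro continuous_open_preimage open_chart_N[OF c(1)]) auto
  then have O: "open {q \<in> fst c. snd c q \<in> ?O}"
    by (rule open_chart_vimage[OF riemannian_manifold_charts[OF A c(1)]])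
  have "q \<in> R" if q: "q \<in> fst c" "snd c q \<in> ?O" for q
  proof -
    have D: "snd c q \<in> ?D" and 0: "?f (snd c q) \<noteq> 0" using q by auto
    have Fq: "F q \<in> N" using local_rep_N(4)[OF c(1) D] chart_inverse[OF c(1) q(1)] by simp
    have "differential c F d (snd c q) \<noteq> 0" using 0 differential_vector[OF c(1) D, of X] by auto
    then have "regular_point A B F q" using c(1) d q(1) Fq by (auto simp: regular_point_def chart_part_def)
    then show ?thesis using Fq q c by (auto simp: regular_part_def carrier_def)
  qed
  moreover have "p \<in> {q \<in> fst c. snd c q \<in> ?O}"
    using c y X differential_vector[OF c(1) y, of X] by auto
  ultimately show "\<exists>T. open T \<and> p \<in> T \<and> T \<subseteq> R" using O by blast
qed

context
  fixes c U u v
  assumes c: "c \<in> A" and U: "open U" "U \<subseteq> snd c ` (fst c \<inter> R)"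
    and uv: "\<forall>y\<in>U. u y = a (local_rep c F d y) \<and> v y = b (local_rep c F d y)"
begin

lemma u: "y \<in> U \<Longrightarrow> u y = a (local_rep c F d y)" and v: "y \<in> U \<Longrightarrow> v y = b (local_rep c F d y)"
  using uv by auto

lemma U_N: "y \<in> U \<Longrightarrow> y \<in> snd c ` {p \<in> fst c. F p \<in> N}"
  using U by (auto simp: regular_part_def)

lemma regular_U: assumes y: "y \<in> U" shows "regular_point A B F (chart_inv c y)"
proof -
  obtain p where "p \<in> fst c" "p \<in> R" "y = snd c p" using U y by auto
  then show ?thesis using chart_inverse[OF c] by (simp add: regular_part_def)
qed

lemma derivative_uv:
  assumes y: "y \<in> U"
  shows "frechet_derivative u (at y) X = frechet_derivative a (at (local_rep c F d y)) (differential c F d y *v X)"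
    "frechet_derivative v (at y) X = frechet_derivative b (at (local_rep c F d y)) (differential c F d y *v X)"
proof -
  note L = local_rep_N[OF c U_N[OF y]]
  show "frechet_derivative u (at y) X = frechet_derivative a (at (local_rep c F d y)) (differential c F d y *v X)"
    unfolding differential_vector[OF c U_N[OF y]] 
    by (rule frechet_derivative_composed[OF U(1) y u L(2) differentiable_ab(1)[OF L(1)]])
  show "frechet_derivative v (at y) X = frechet_derivative b (at (local_rep c F d y)) (differential c F d y *v X)"
    unfolding differential_vector[OF c U_N[OF y]] 
    by (rule frechet_derivative_composed[OF U(1) y v L(2) differentiable_ab(2)[OF L(1)]])
qed

lemma Ck_uv: "Ck_on 3 u U" "Ck_on 3 v U"
proof -
  have "local_rep c F d ` U \<subseteq> V" using local_rep_N(1)[OF c U_N] by auto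
  moreover have "Ck_on 3 (local_rep c F d) U" by (rule Ck_on_subset[OF Ck_local_rep[OF c]]) (use U_N in auto)
  ultimately have "Ck_on 3 (\<lambda>y. a (local_rep c F d y)) U" "Ck_on 3 (\<lambda>y. b (local_rep c F d y)) U"
    using Ck_on_compose[OF U(1) V(1)] a b by auto
  then show "Ck_on 3 u U" "Ck_on 3 v U" using Ck_on_cong[OF U(1)] u v by force+
qed

text \<open>The functions \<open>u\<close>, \<open>v\<close> are only required to agree with the compositions on \<open>U\<close>, because in a second chart they arise as pullbacks along the coordinate change. Their gradients cannot vanish at a regular point: \<open>du = 0\<close> would imply \<open>dv = - du \<circ> J = 0\<close>, hence that the differential of \<open>F\<close> is zero, as the isothermal functions have independent differentials.\<close>

lemma structure_on_chart:
  assumes J: "adapted_almost_complex_structure A g B j F s J" and s: "\<bar>s\<bar> = 1"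
  shows "structure_on_chart (g c) (chart_image c) U u v (J c) s"
proof -
  interpret local_metric "g c" "chart_image c" by (rule metric_chart[OF c])
  have US: "U \<subseteq> chart_image c" using U by (auto simp: chart_image_def)
  have Jy: "hermitian_structure (g c y) (J c y)" "induces_orientation s (J c y)"
    "differential c F d y ** J c y = j d (local_rep c F d y) ** differential c F d y" if y: "y \<in> U" for y
  proof -
    note L = local_rep_N(3-5)[OF c U_N[OF y]]
    have "F (chart_inv c y) \<in> fst d" using L by (simp add: chart_part_def)
    then show "hermitian_structure (g c y) (J c y)" "induces_orientation s (J c y)"
      "differential c F d y ** J c y = j d (local_rep c F d y) ** differential c F d y"
      using J[unfolded adapted_almost_complex_structure_def, rule_format, OF c L(1) regular_U[OF y]] d
      by (auto simp: L(3) local_rep_def)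
  qed
  have CL: "complex_linear u v (J c) U"
    unfolding complex_linear_def
  proof (intro ballI allI)
    fix y X assume y: "y \<in> U"
    have "differential c F d y *v (J c y *v X) = j d (local_rep c F d y) *v (differential c F d y *v X)"
      using Jy(3)[OF y] by (simp add: matrix_vector_mul_assoc)
    then show "frechet_derivative u (at y) (J c y *v X) = - frechet_derivative v (at y) X \<and>
        frechet_derivative v (at y) (J c y *v X) = frechet_derivative u (at y) X"
      unfolding derivative_uv[OF y] using cl local_rep_N(1)[OF c U_N[OF y]] by (simp add: complex_linear_def)
  qed
  have C2: "Ck_on 2 u U" "Ck_on 2 v U" using Ck_uv Ck_on_le by force+
  have "grad (g c) u y \<noteq> 0" if y: "y \<in> U" for y
  proof
    assume 0: "grad (g c) u y = 0"
    have "u differentiable (at y)" using Ck_on_differentiable[of 1] C2(1) y by (simp add: numeral_2_eq_2)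
    then have du: "frechet_derivative u (at y) X = 0" for X
      using ip_grad[of y u X] 0 y US by (auto simp: ip_simps)
    moreover have dv: "frechet_derivative v (at y) X = 0" for X
      using CL y du[of "J c y *v X"] by (auto simp: complex_linear_def)
    ultimately have "differential c F d y *v X = 0" for X
      using nd[OF local_rep_N(1)[OF c U_N[OF y]]] unfolding derivative_uv[OF y] by blast
    then have "differential c F d y = 0" by (simp add: matrix_eq)
    moreover have "differential c F d (snd c (chart_inv c y)) \<noteq> 0"
      using regular_point_differential[OF A B smooth_F c _ d _ regular_U[OF y]] local_rep_N(3,4)[OF c U_N[OF y]]
      by (simp add: chart_part_def)
    ultimately show False by (simp add: local_rep_N(5)[OF c U_N[OF y]])
  qed
  then show ?thesis
    by unfold_locales (use U US C2 Jy CL s in auto)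
qed

lemma vertical_uv:
  assumes y: "y \<in> U" and t: "vertical B F c (chart_inv c y) t"
  shows "frechet_derivative u (at y) t = 0" "frechet_derivative v (at y) t = 0"
proof -
  note L = local_rep_N[OF c U_N[OF y]]
  have "differential c F d y *v t = 0"
    using t d L(4,5) by (auto simp: vertical_def chart_part_def)
  then show "frechet_derivative u (at y) t = 0" "frechet_derivative v (at y) t = 0"
    unfolding derivative_uv[OF y]
    using linear_0[OF linear_frechet_derivative[OF differentiable_ab(1)[OF L(1)]]]
      linear_0[OF linear_frechet_derivative[OF differentiable_ab(2)[OF L(1)]]] by simp_all
qed

end

lemma harmonic_pullback:
  assumes f: "harmonic_on B h N (\<lambda>n. f (snd d n))" and c: "c \<in> A" and y: "y \<in> snd c ` (fst c \<inter> R)"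
  shows "laplacian (g c) (\<lambda>y. f (local_rep c F d y)) y = 0"
proof -
  have "N \<subseteq> carrier B" using d by (auto simp: chart_part_def carrier_def)
  then have "harmonic_on A g {p \<in> carrier A. F p \<in> N} ((\<lambda>n. f (snd d n)) \<circ> F)"
    using morphism f open_N by (simp add: harmonic_morphism_def)
  then have all: "\<forall>x\<in>snd c ` (fst c \<inter> {p \<in> carrier A. F p \<in> N}). laplacian (g c) (((\<lambda>n. f (snd d n)) \<circ> F) \<circ> chart_inv c) x = 0"
    using c by (simp add: harmonic_on_def)
  have eq: "((\<lambda>n. f (snd d n)) \<circ> F) \<circ> chart_inv c = (\<lambda>y. f (local_rep c F d y))"
    by (simp add: fun_eq_iff local_rep_def)
  have "y \<in> snd c ` (fst c \<inter> {p \<in> carrier A. F p \<in> N})" using y by (auto simp: regular_part_def)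
  from all[rule_format, OF this] show ?thesis unfolding eq .
qed

lemma product_le:
  assumes Jp: "adapted_almost_complex_structure A g B j F 1 Jp" and Jm: "adapted_almost_complex_structure A g B j F (- 1) Jm"
    and c: "c \<in> A" "c' \<in> A" and p: "p \<in> fst c" "p \<in> fst c'" "p \<in> R"
    and t: "vertical B F c' p t" "ip (g c' (snd c' p)) t t = 1"
    and C: "\<And>X Y r. ip (g c (snd c p)) X X = r \<Longrightarrow> ip (g c (snd c p)) Y Y = r \<Longrightarrow> \<bar>local_metric.Ric (g c) (snd c p) X Y\<bar> \<le> C * r"
  shows "endo_norm (g c' (snd c' p)) (cov_deriv_endo (g c') (Jp c') (snd c' p) t) *
    endo_norm (g c' (snd c' p)) (cov_deriv_endo (g c') (Jm c') (snd c' p) t) \<le> 8 * C"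
proof -
  \<comment> \<open>Everything takes place over the open set of regular points that are mapped into the domain of the isothermal functions, once seen in the chart \<open>c\<close> of the Ricci bound and once in the given chart \<open>c'\<close>.\<close>
  let ?T = "snd c ` (fst c \<inter> R)" and ?W = "fst c' \<inter> fst c \<inter> R"
  let ?U = "snd c' ` ?W" and ?\<phi> = "transition c' c"
  let ?u = "\<lambda>y. a (local_rep c F d y)" and ?v = "\<lambda>y. b (local_rep c F d y)"
  have ch: "is_chart c" "is_chart c'" using riemannian_manifold_charts[OF A] c by auto
  then have o: "open (fst c)" "open (fst c')" by (auto simp: is_chart_def)
  have T: "open ?T" by (rule open_chart_image[OF ch(1)]) (use o open_R in auto)
  have W: "open ?W" using o open_R by auto
  have cc: "chart_change (g c') (chart_image c') (g c) (chart_image c) ?\<phi> ?U"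
    by (rule riemannian_manifold_chart_change[OF A c(2,1) W]) auto
  then have U: "open ?U" by (rule chart_change.open_U)
  have T_S: "?T \<subseteq> chart_image c" by (auto simp: chart_image_def)
  have \<phi>: "?\<phi> (snd c' q) = snd c q" if "q \<in> fst c'" for q using chart_inverse[OF c(2) that] by (simp add: transition_def)
  then have \<phi>T: "?\<phi> ` ?U \<subseteq> ?T" by auto
  have rep: "local_rep c F d (?\<phi> y) = local_rep c' F d y" if y: "y \<in> ?U" for y
  proof -
    obtain q where q: "q \<in> fst c'" "q \<in> fst c" "y = snd c' q" using y by auto
    show ?thesis unfolding q(3) \<phi>[OF q(1)] by (simp add: local_rep_def chart_inverse[OF c(2) q(1)] chart_inverse[OF c(1) q(2)])
  qed
  have U_R: "?U \<subseteq> snd c' ` (fst c' \<inter> R)" by auto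
  have rep': "\<forall>y\<in>?U. ?u (?\<phi> y) = a (local_rep c' F d y) \<and> ?v (?\<phi> y) = b (local_rep c' F d y)"
    using rep by simp
  have uvT: "\<forall>y\<in>?T. ?u y = ?u y \<and> ?v y = ?v y" by simp
  note st = structure_on_chart[OF c(2) U U_R rep']
  have null: "local_metric.null_pair (g c) ?u ?v ?T"
    by (rule structure_on_chart.null[OF structure_on_chart[OF c(1) T subset_refl uvT Jp]]) simp
  have herm: "hermitian_structure (h d y) (j d y)" if "y \<in> V" for y
    using surface d V(2) that by (auto simp: surface_complex_structure_def)
  have ab2: "Ck_on 2 a V" "Ck_on 2 b V" using a b Ck_on_le by force+
  have hN: "harmonic_on B h N (\<lambda>n. a (snd d n))" "harmonic_on B h N (\<lambda>n. b (snd d n))"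
    unfolding chart_part_def by (rule isothermal_functions_harmonic[where j = j, OF B d V ab2 cl herm nd]; assumption)+
  have harm: "laplacian (g c) ?u y = 0" "laplacian (g c) ?v y = 0" if "y \<in> ?T" for y
    using harmonic_pullback[OF hN(1) c(1) that] harmonic_pullback[OF hN(2) c(1) that] by auto
  have x: "snd c' p \<in> ?U" using p by auto
  have v0: "vertical B F c' (chart_inv c' (snd c' p)) t" using t(1) by (simp add: chart_inverse[OF c(2) p(2)])
  have C': "\<bar>local_metric.Ric (g c) (?\<phi> (snd c' p)) X Y\<bar> \<le> C * r"
    if "ip (g c (?\<phi> (snd c' p))) X X = r" "ip (g c (?\<phi> (snd c' p))) Y Y = r" for X Y r
    using that unfolding \<phi>[OF p(2)] by (rule C)
  show ?thesis
    by (rule product_le_Ricci[OF cc T T_S \<phi>T Ck_uv[OF c(1) T subset_refl uvT] null harm st[OF Jp] st[OF Jm] x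
        vertical_uv[OF c(2) U U_R rep' x v0] t(2) C']) (assumption | simp)+
qed

end

text \<open>The chart \<open>c\<close> and the constant are fixed near \<open>m\<close>, while the isothermal functions and the chart \<open>c'\<close> vary with the point \<open>p\<close>. This is harmless because the estimate depends on them only through the Ricci bound in \<open>c\<close>.\<close>

lemma product_le_near:
  assumes Jp: "adapted_almost_complex_structure A g B j F 1 Jp" and Jm: "adapted_almost_complex_structure A g B j F (- 1) Jm"
    and m: "m \<in> carrier A"
  shows "\<exists>N C. open N \<and> m \<in> N \<and> (\<forall>p\<in>N. product_bounded_at Jp Jm p C)"
proof -
  obtain c where c: "c \<in> A" "m \<in> fst c" using m by (auto simp: carrier_def)
  interpret M: local_metric "g c" "chart_image c" by (rule metric_chart[OF c(1)])
  have "snd c m \<in> chart_image c" using c by (auto simp: chart_image_def)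
  then obtain r where r: "0 < r" "cball (snd c m) r \<subseteq> chart_image c"
    using M.open_S open_contains_cball by blast
  obtain C where C: "\<And>x X Y r'. x \<in> cball (snd c m) r \<Longrightarrow> ip (g c x) X X = r' \<Longrightarrow> ip (g c x) Y Y = r' \<Longrightarrow> \<bar>M.Ric x X Y\<bar> \<le> C * r'"
    using M.Ric_bound_on_compact[OF compact_cball r(2)] by blast
  let ?N = "{p \<in> fst c. snd c p \<in> ball (snd c m) r}"
  have N: "open ?N" "m \<in> ?N"
    using open_chart_vimage[OF riemannian_manifold_charts[OF A c(1)] open_ball] c r(1) by auto
  have le: "endo_norm (g c' (snd c' p)) (cov_deriv_endo (g c') (Jp c') (snd c' p) T) *
        endo_norm (g c' (snd c' p)) (cov_deriv_endo (g c') (Jm c') (snd c' p) T) \<le> 8 * C"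
    if p: "p \<in> ?N" "regular_point A B F p" and c': "c' \<in> A" "p \<in> fst c'"
      and T: "vertical B F c' p T" "ip (g c' (snd c' p)) T T = 1" for p c' T
  proof -
    have pA: "p \<in> carrier A" using c' by (auto simp: carrier_def)
    then have "F p \<in> carrier B" using smooth_F unfolding smooth_map_def by blast
    then obtain d where d: "d \<in> B" "F p \<in> fst d" unfolding carrier_def by blast
    have Fp: "snd d (F p) \<in> chart_image d" using d by (auto simp: chart_image_def)
    have sd: "hermitian_structure (h d y) (j d y)" "\<And>u. u \<noteq> 0 \<Longrightarrow> 0 < det (vector [u, j d y *v u] :: real^2^2)"
      if "y \<in> chart_image d" for y
      using surface[unfolded surface_complex_structure_def, rule_format, OF d(1) that] by simp_all
    have "\<exists>V a b. open V \<and> snd d (F p) \<in> V \<and> V \<subseteq> chart_image d \<and> Ck_on 3 a V \<and> Ck_on 3 b V \<and> complex_linear a b (j d) V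
        \<and> (\<forall>y\<in>V. \<forall>X. frechet_derivative a (at y) X = 0 \<longrightarrow> frechet_derivative b (at y) X = 0 \<longrightarrow> X = 0)"
      by (rule isothermal_pair[OF riemannian_manifold_local_metric[OF B d(1)] Fp sd]; assumption)
    then obtain V a b where iso: "open V \<and> snd d (F p) \<in> V \<and> V \<subseteq> chart_image d \<and> Ck_on 3 a V \<and> Ck_on 3 b V \<and> complex_linear a b (j d) V
        \<and> (\<forall>y\<in>V. \<forall>X. frechet_derivative a (at y) X = 0 \<longrightarrow> frechet_derivative b (at y) X = 0 \<longrightarrow> X = 0)"
      by (elim exE) (rule that)
    then have V: "open V" "snd d (F p) \<in> V" "V \<subseteq> chart_image d" "Ck_on 3 a V" "Ck_on 3 b V" "complex_linear a b (j d) V"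
      by iprover+
    have nd: "X = 0" if "y \<in> V" "frechet_derivative a (at y) X = 0" "frechet_derivative b (at y) X = 0" for y X
      using iso that by blast
    have R: "p \<in> regular_part d V" unfolding regular_part_def chart_part_def using pA p(2) d(2) V(2) by simp
    have pc: "p \<in> fst c" "snd c p \<in> cball (snd c m) r" using p(1) by auto
    show ?thesis
      by (rule product_le[OF d(1) V(1,3,4,5,6) nd Jp Jm c(1) c'(1) pc(1) c'(2) R T C[OF pc(2)]]; assumption)
  qed
  have "\<forall>p\<in>?N. product_bounded_at Jp Jm p (8 * C)"
    unfolding product_bounded_at_def by (intro ballI impI allI, elim conjE, rule le)
  then show ?thesis using N by blast
qed

lemma product_bounded_at_mono:
  assumes "product_bounded_at Jp Jm p C" "C \<le> D"
  shows "product_bounded_at Jp Jm p D"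
  unfolding product_bounded_at_def
proof (intro impI ballI allI)
  fix c T assume T: "regular_point A B F p" "c \<in> A" "p \<in> fst c" "vertical B F c p T \<and> ip (g c (snd c p)) T T = 1"
  show "endo_norm (g c (snd c p)) (cov_deriv_endo (g c) (Jp c) (snd c p) T) *
      endo_norm (g c (snd c p)) (cov_deriv_endo (g c) (Jm c) (snd c p) T) \<le> D"
    by (rule order_trans[OF assms(1)[unfolded product_bounded_at_def, rule_format, OF T] assms(2)])
qed

end

theorem proposition1:
  fixes A :: "('m::{t2_space, second_countable_topology}, 4) chart set"
    and g Jp Jm :: "('m, 4) matrix_field"
    and B :: "('n::{t2_space, second_countable_topology}, 2) chart set"
    and h j :: "('n, 2) matrix_field"
    and F :: "'m \<Rightarrow> 'n"
    and K :: "'m set"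
  assumes "riemannian_manifold A g"
    and "riemannian_manifold B h" and "oriented_atlas B"
    and "harmonic_morphism A g B h F"
    and "surface_complex_structure B h j"
    and "adapted_almost_complex_structure A g B j F 1 Jp"
    and "adapted_almost_complex_structure A g B j F (- 1) Jm"
    and "compact K" and "K \<subseteq> carrier A"
  shows "\<exists>C::real. \<forall>m\<in>K. regular_point A B F m \<longrightarrow>
    (\<forall>c\<in>A. m \<in> fst c \<longrightarrow>
      (\<forall>T. vertical B F c m T \<and> ip (g c (snd c m)) T T = 1 \<longrightarrow>
        endo_norm (g c (snd c m)) (cov_deriv_endo (g c) (Jp c) (snd c m) T) *
        endo_norm (g c (snd c m)) (cov_deriv_endo (g c) (Jm c) (snd c m) T) \<le> C))"
proof -
  interpret morphism_to_surface A g B h j F by unfold_locales (rule assms)+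
  have "\<exists>C. \<forall>m\<in>K. product_bounded_at Jp Jm m C"
    by (rule compact_locally_bounded[OF \<open>compact K\<close> product_bounded_at_mono product_le_near[OF assms(6,7)]], assumption+)
       (use assms(9) in auto)
  then show ?thesis unfolding product_bounded_at_def .
qed

end
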